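(* Let $\alpha\in(1/2,1]$. There exists a constant $C_T\in\mathbb{R}_+$, depending on $T$, $\alpha$ (and the fixed model parameters) but not on $n,k_1,k_2$, such that for all $n\ge 1$ and all $0<k_1,k_2\le n$, $$|\mathbb{E}[X_{t_{k_1}}]-\mathbb{E}[\check X^n_{t_{k_1}}]|\le \frac{C_T}{n},$$ $$|\mathbb{E}[X_{t_{k_1}}X_{t_{k_2}}]-\mathbb{E}[\check X^n_{t_{k_1}}\check X^n_{t_{k_2}}]|\le C_T\left((1+t_{k_1}^{\alpha-1}+t_{k_2}^{\alpha-1})\,\mathbf{v}_n(\alpha)+\frac{t_{k_1}^{2\alpha-2}+t_{k_2}^{2\alpha-2}}{n}\right),$$ and $$|\mathrm{Cov}(X_{t_{k_1}},X_{t_{k_2}})-\mathrm{Cov}(\check X^n_{t_{k_1}},\check X^n_{t_{k_2}})|\le C_T\left((1+t_{k_1}^{\alpha-1}+t_{k_2}^{\alpha-1})\,\mathbf{v}_n(\alpha)+\frac{t_{k_1}^{2\alpha-2}+t_{k_2}^{2\alpha-2}}{n}\right).$$ Besides, for any $\Psi\in\mathcal{C}^2_{\exp}(\mathbb{R},\mathbb{R})$ there exists a constant $C\in\mathbb{R}_+$ (not depending on $n,k$) such that for all $n\ge1$ and $1\le k\le n$, $$|\mathbb{E}[\Psi(\check X^n_{t_k})]-\mathbb{E}[\Psi(X_{t_k})]|\le C\left((1+t_k^{\alpha-1})\,\mathbf{v}_n(\alpha)+\frac{t_k^{2\alpha-2}}{n}\right).$$ In particular, for $k=n$, $|\mathbb{E}[\Psi(\check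 X^n_T)]-\mathbb{E}[\Psi(X_T)]|=O(\mathbf{v}_n(\alpha))$ as $n\to\infty$.
   Context: Fix $T>0$, $x_0,\kappa_1,\kappa_2\in\mathbb{R}$, $\sigma>0$, and a real Brownian motion $W$. The process $X$ is the unique strong solution (with $\sup_{t\le T}\mathbb{E}[X_t^2]<\infty$) of $$X_t=x_0+\int_0^t\frac{(t-s)^{\alpha-1}}{\Gamma(\alpha)}(\kappa_1+\kappa_2X_s)\,ds+\sigma\int_0^t\frac{(t-s)^{\alpha-1}}{\Gamma(\alpha)}\,dW_s .$$ For $n\ge1$ let $t_k=kT/n$ and $\eta(t)=t_k$ for $t_k\le t<t_{k+1}$. The scheme $\check X^n$ is defined by $$\check X^n_t=x_0+\int_0^t\frac{(t-s)^{\alpha-1}}{\Gamma(\alpha)}(\kappa_1+\kappa_2\check X^n_{\eta(s)})\,ds+\sigma\int_0^t\frac{(t-s)^{\alpha-1}}{\Gamma(\alpha)}\,dW_s,\quad t\in[0,T].$$ The rate is $\mathbf{v}_n(\alpha)=\frac1n$ if $\alpha\in(2/3,1]$, $\mathbf{v}_n(\alpha)=\frac{\log n}{n}$ if $\alpha=2/3$, and $\mathbf{v}_n(\alpha)=\frac1{n^{3\alpha-1}}$ if $\alpha\in(1/2,2/3)$. For $\ell\in\mathbb{N}$, $\mathcal{C}^\ell_{\exp}(\mathbb{R},\mathbb{R})$ is the set of $g\in\mathcal{C}^\ell(\mathbb{R},\mathbb{R})$ such that for every $k\in\{0,\dots,\ell\}$ there is $C\in\mathbb{R}_+$ with $|g^{(k)}(x)|\le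 Ce^{C|x|}$ for all $x\in\mathbb{R}$. *)

theory Defs
  imports "HOL-Probability.Probability" "HOL-Library.Landau_Symbols"
begin

locale brownian_motion = prob_space M
  for M :: "'a measure" and W :: "real \<Rightarrow> 'a \<Rightarrow> real" +
  assumes random_variable_W: "0 \<le> t \<Longrightarrow> random_variable borel (W t)"
    and start_zero: "AE \<omega> in M. W 0 \<omega> = 0"
    and continuous_paths: "AE \<omega> in M. continuous_on {0..} (\<lambda>t. W t \<omega>)"
    and normal_increments: "0 \<le> s \<Longrightarrow> s < t \<Longrightarrow>
      distributed M lborel (\<lambda>\<omega>. W t \<omega> - W s \<omega>) (normal_density 0 (sqrt (t - s)))"
    and indep_increments: "\<And>(u :: nat \<Rightarrow> real) m. 0 \<le> u 0 \<Longrightarrow> strict_mono_on {..m} u \<Longrightarrow>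
      indep_vars (\<lambda>_. borel) (\<lambda>i \<omega>. W (u (Suc i)) \<omega> - W (u i) \<omega>) {..<m}"

text \<open>
  A list of triples \<open>(c, a, b)\<close> encodes the step function that is the sum of the
  \<open>c * indicator {a<..b}\<close>; the intervals may overlap.
\<close>

definition step_on :: "real \<Rightarrow> (real \<times> real \<times> real) list \<Rightarrow> bool" where
  "step_on t \<phi> \<longleftrightarrow> (\<forall>(c, a, b)\<in>set \<phi>. 0 \<le> a \<and> a \<le> b \<and> b \<le> t)"

definition step_fun :: "(real \<times> real \<times> real) list \<Rightarrow> real \<Rightarrow> real" where
  "step_fun \<phi> s = (\<Sum>(c, a, b)\<leftarrow>\<phi>. c * indicator {a<..b} s)"

definition step_integral ::
    "(real \<Rightarrow> 'a \<Rightarrow> real) \<Rightarrow> (real \<times> real \<times> real) list \<Rightarrow> 'a \<Rightarrow> real" where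
  "step_integral W \<phi> \<omega> = (\<Sum>(c, a, b)\<leftarrow>\<phi>. c * (W b \<omega> - W a \<omega>))"

text \<open>
  \<open>Y\<close> is (a version of) the stochastic integral over \<open>[0, t]\<close> of the deterministic function
  \<open>f\<close> against \<open>W\<close>, i.e. the limit in mean square of the integrals of step functions which
  converge to \<open>f\<close> in \<open>L\<^sup>2([0, t])\<close>. By the Ito isometry \<open>Y\<close> is unique up to almost sure equality.
\<close>

definition has_wiener_integral ::
    "'a measure \<Rightarrow> (real \<Rightarrow> 'a \<Rightarrow> real) \<Rightarrow> (real \<Rightarrow> real) \<Rightarrow> real \<Rightarrow> ('a \<Rightarrow> real) \<Rightarrow> bool" where
  "has_wiener_integral M W f t Y \<longleftrightarrow>
     set_borel_measurable lborel {0..t} f \<and> Y \<in> borel_measurable M \<and>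
     (\<exists>\<phi>. (\<forall>j. step_on t (\<phi> j)) \<and>
       (\<lambda>j::nat. \<integral>\<^sup>+s\<in>{0..t}. ennreal ((f s - step_fun (\<phi> j) s)\<^sup>2) \<partial>lborel) \<longlonglongrightarrow> 0 \<and>
       (\<lambda>j. \<integral>\<^sup>+\<omega>. ennreal ((Y \<omega> - step_integral W (\<phi> j) \<omega>)\<^sup>2) \<partial>M) \<longlonglongrightarrow> 0)"

definition brownian_filtration ::
    "'a measure \<Rightarrow> (real \<Rightarrow> 'a \<Rightarrow> real) \<Rightarrow> real \<Rightarrow> 'a measure" where
  "brownian_filtration M W t =
     sigma (space M) ({W s -` A \<inter> space M | s A. s \<in> {0..t} \<and> A \<in> sets borel} \<union> null_sets M)"

text \<open>
  Since \<open>0 powr a = 0\<close>, the kernel is \<open>0\<close> at \<open>s = t\<close> even for \<open>\<alpha> = 1\<close>; it is only ever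
  integrated over \<open>[0, t]\<close>, where this point is a null set.
\<close>

definition frac_kernel :: "real \<Rightarrow> real \<Rightarrow> real \<Rightarrow> real" where
  "frac_kernel \<alpha> t s = (t - s) powr (\<alpha> - 1) / Gamma \<alpha>"

text \<open>
  The random variable \<open>X t\<close> equals
  \<open>x0 + \<integral>\<^sub>0\<^sup>t K(t - s) (\<kappa>1 + \<kappa>2 * Z s) ds + \<sigma> * \<integral>\<^sub>0\<^sup>t K(t - s) dW\<^sub>s\<close> almost surely,
  where \<open>K\<close> is the fractional kernel. The solution has \<open>Z = X\<close>; the Euler scheme has
  \<open>Z s = X (\<eta> s)\<close>.
\<close>

definition volterra_eq ::
    "'a measure \<Rightarrow> (real \<Rightarrow> 'a \<Rightarrow> real) \<Rightarrow> real \<Rightarrow> real \<Rightarrow> real \<Rightarrow> real \<Rightarrow> real \<Rightarrow>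
     (real \<Rightarrow> 'a \<Rightarrow> real) \<Rightarrow> (real \<Rightarrow> 'a \<Rightarrow> real) \<Rightarrow> real \<Rightarrow> bool" where
  "volterra_eq M W x0 \<kappa>1 \<kappa>2 \<sigma> \<alpha> X Z t \<longleftrightarrow>
     (\<exists>Y. has_wiener_integral M W (frac_kernel \<alpha> t) t Y \<and>
       (AE \<omega> in M.
          set_integrable lborel {0..t} (\<lambda>s. frac_kernel \<alpha> t s * (\<kappa>1 + \<kappa>2 * Z s \<omega>)) \<and>
          X t \<omega> = x0 + (LBINT s:{0..t}. frac_kernel \<alpha> t s * (\<kappa>1 + \<kappa>2 * Z s \<omega>)) + \<sigma> * Y \<omega>))"

definition strong_solution ::
    "'a measure \<Rightarrow> (real \<Rightarrow> 'a \<Rightarrow> real) \<Rightarrow> real \<Rightarrow> real \<Rightarrow> real \<Rightarrow> real \<Rightarrow> real \<Rightarrow> real \<Rightarrow>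
     (real \<Rightarrow> 'a \<Rightarrow> real) \<Rightarrow> bool" where
  "strong_solution M W T x0 \<kappa>1 \<kappa>2 \<sigma> \<alpha> X \<longleftrightarrow>
     (\<lambda>(t, \<omega>). X t \<omega>) \<in> borel_measurable (restrict_space borel {0..T} \<Otimes>\<^sub>M M) \<and>
     (\<forall>t\<in>{0..T}. X t \<in> borel_measurable (brownian_filtration M W t)) \<and>
     (SUP t\<in>{0..T}. \<integral>\<^sup>+\<omega>. ennreal ((X t \<omega>)\<^sup>2) \<partial>M) < \<infinity> \<and>
     (\<forall>t\<in>{0..T}. volterra_eq M W x0 \<kappa>1 \<kappa>2 \<sigma> \<alpha> X X t)"

definition grid_point :: "real \<Rightarrow> nat \<Rightarrow> nat \<Rightarrow> real" where
  "grid_point T n k = real k * T / real n"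

text \<open>\<open>\<eta>(s) = t\<^sub>k\<close> for \<open>t\<^sub>k \<le> s < t\<^sub>k\<^sub>+\<^sub>1\<close>.\<close>

definition grid_floor :: "real \<Rightarrow> nat \<Rightarrow> real \<Rightarrow> real" where
  "grid_floor T n s = grid_point T n (nat \<lfloor>s * real n / T\<rfloor>)"

lemma grid_floor_eq:
  assumes "T > 0" "n \<ge> 1" "grid_point T n k \<le> s" "s < grid_point T n (Suc k)"
  shows "grid_floor T n s = grid_point T n k"
proof -
  have "\<lfloor>s * real n / T\<rfloor> = int k"
    using assms by (intro floor_unique) (auto simp: grid_point_def field_simps)
  then show ?thesis by (simp add: grid_floor_def)
qed

definition euler_scheme ::
    "'a measure \<Rightarrow> (real \<Rightarrow> 'a \<Rightarrow> real) \<Rightarrow> real \<Rightarrow> real \<Rightarrow> real \<Rightarrow> real \<Rightarrow> real \<Rightarrow> real \<Rightarrow> nat \<Rightarrow>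
     (real \<Rightarrow> 'a \<Rightarrow> real) \<Rightarrow> bool" where
  "euler_scheme M W T x0 \<kappa>1 \<kappa>2 \<sigma> \<alpha> n X \<longleftrightarrow>
     (\<forall>t\<in>{0..T}. X t \<in> borel_measurable M \<and>
        volterra_eq M W x0 \<kappa>1 \<kappa>2 \<sigma> \<alpha> X (\<lambda>s. X (grid_floor T n s)) t)"

definition volterra_setting ::
    "'a measure \<Rightarrow> (real \<Rightarrow> 'a \<Rightarrow> real) \<Rightarrow> real \<Rightarrow> real \<Rightarrow> real \<Rightarrow> real \<Rightarrow> real \<Rightarrow> real \<Rightarrow>
     (real \<Rightarrow> 'a \<Rightarrow> real) \<Rightarrow> (nat \<Rightarrow> real \<Rightarrow> 'a \<Rightarrow> real) \<Rightarrow> bool" where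
  "volterra_setting M W T x0 \<kappa>1 \<kappa>2 \<sigma> \<alpha> X Xe \<longleftrightarrow>
     brownian_motion M W \<and> strong_solution M W T x0 \<kappa>1 \<kappa>2 \<sigma> \<alpha> X \<and>
     (\<forall>n\<ge>1. euler_scheme M W T x0 \<kappa>1 \<kappa>2 \<sigma> \<alpha> n (Xe n))"

definition euler_rate :: "real \<Rightarrow> nat \<Rightarrow> real" where
  "euler_rate \<alpha> n =
     (if \<alpha> > 2 / 3 then 1 / real n
      else if \<alpha> = 2 / 3 then ln (real n) / real n
      else 1 / real n powr (3 * \<alpha> - 1))"

definition covariance :: "'a measure \<Rightarrow> ('a \<Rightarrow> real) \<Rightarrow> ('a \<Rightarrow> real) \<Rightarrow> real" where
  "covariance M U V = (\<integral>\<omega>. (U \<omega> - integral\<^sup>L M U) * (V \<omega> - integral\<^sup>L M V) \<partial>M)"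

definition C_exp :: "nat \<Rightarrow> (real \<Rightarrow> real) set" where
  "C_exp l = {g.
     (\<forall>k<l. \<forall>x. (deriv ^^ k) g differentiable (at x)) \<and>
     continuous_on UNIV ((deriv ^^ l) g) \<and>
     (\<forall>k\<le>l. \<exists>C\<ge>0. \<forall>x. \<bar>(deriv ^^ k) g x\<bar> \<le> C * exp (C * \<bar>x\<bar>))}"

end

(*
  X and the scheme are Gaussian, so everything reduces to means and covariances. With the resolvent
  kernel R of K (a Mittag-Leffler function), the mean of X is affine in the integral of R and
  Cov(X_s, X_u) = sigma^2 c(s, u) with c(s, u) the integral of R(s - v) R(u - v). Since
  |R(x)| <= C x^(alpha-1) and |R'(x)| <= C ((1-alpha) x^(alpha-2) + x^(2 alpha-2)), freezing s over
  a step of length h changes c(s, u) by at most C h ((h + |s-u|)^(2 alpha-2) + (h + s)^(2 alpha-2)).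
  Integrated against K this is O(v_n), uniformly in u; this is the local error of the scheme tested
  against X_u. A discrete Gronwall inequality in k propagates it to E[e_k X_u] = O(v_n) for the
  error e_k at t_k. Used twice more, it gives E[e_k e_l] = O(v_n), so that the covariance error is
  O(v_n), and also that the scheme converges in mean square, so that X inherits Gaussianity from
  the scheme. Finally, E[Psi(N(m, v))] is Lipschitz in (m, v): an increase of the variance is the
  addition of an independent centred Gaussian, whose linear term averages out in Taylor's formula.
*)

theory Submission
  imports Defs
begin

section \<open>Square-integrable functions and Wiener integrals\<close>

text \<open>By Cauchy-Schwarz alone, a mean square bound would give the covariances only at the
  square root of its order. In the covariance, however, the error enters linearly only through its
  pairing with the solution, and otherwise quadratically. Solution and scheme share the same Wiener
  integrals, which cancel when the local error is paired with any square integrable V: what remains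
  depends only on the increments of s -> E[G_s V] between s and the grid point below, where G is the
  centred solution. For V = G_u this function is sigma^2 c(s, u). For V = loc_l, the local error at
  t_l, the function is itself of the size of the rate by the first case, so bounding its increments
  by twice its size is enough; hence the mean square error has the same order as the pairing. The
  result is a multiple of v_n + 1/n, uniform in the time points. The 1/n is kept because v_1 = 0 for
  \<alpha> = 2/3; it is absorbed by t^(2 \<alpha> - 2) / n, which is at least T^(2 \<alpha> - 2) /
  n. Since the constants must serve every probability space, the kernel estimates precede the choice
  of one.\<close>

lemma square_integrable_mult:
  fixes f g :: "'a \<Rightarrow> real"
  assumes "integrable M (\<lambda>x. (f x)\<^sup>2)" "integrable M (\<lambda>x. (g x)\<^sup>2)"
    and [measurable]: "f \<in> borel_measurable M" "g \<in> borel_measurable M"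
  shows "integrable M (\<lambda>x. f x * g x)"
    and "\<bar>\<integral>x. f x * g x \<partial>M\<bar> \<le> ((\<integral>x. (f x)\<^sup>2 \<partial>M) + (\<integral>x. (g x)\<^sup>2 \<partial>M)) / 2"
proof -
  have le: "\<bar>f x * g x\<bar> \<le> ((f x)\<^sup>2 + (g x)\<^sup>2) / 2" for x
    using sum_squares_bound[of "\<bar>f x\<bar>" "\<bar>g x\<bar>"] by (simp add: abs_mult)
  have i: "integrable M (\<lambda>x. ((f x)\<^sup>2 + (g x)\<^sup>2) / 2)" using assms by simp
  show 1: "integrable M (\<lambda>x. f x * g x)"
    by (rule Bochner_Integration.integrable_bound[OF i]) (use le in \<open>auto simp: order.trans[OF le abs_ge_self]\<close>)
  have "\<bar>\<integral>x. f x * g x \<partial>M\<bar> \<le> (\<integral>x. ((f x)\<^sup>2 + (g x)\<^sup>2) / 2 \<partial>M)"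
    using 1 i le by (intro integral_abs_bound[THEN order.trans] integral_mono) auto
  also have "\<dots> = ((\<integral>x. (f x)\<^sup>2 \<partial>M) + (\<integral>x. (g x)\<^sup>2 \<partial>M)) / 2"
    using assms by simp
  finally show "\<bar>\<integral>x. f x * g x \<partial>M\<bar> \<le> ((\<integral>x. (f x)\<^sup>2 \<partial>M) + (\<integral>x. (g x)\<^sup>2 \<partial>M)) / 2" .
qed

text \<open>One predicate for random variables and for integrands on the line, so that both sides of
  the isometry are limits of the same kind of inner product.\<close>

definition sqint :: "'a measure \<Rightarrow> ('a \<Rightarrow> real) \<Rightarrow> bool" where
  "sqint M f \<longleftrightarrow> f \<in> borel_measurable M \<and> integrable M (\<lambda>x. (f x)\<^sup>2)"

lemma sqint_measurable: "sqint M f \<Longrightarrow> f \<in> borel_measurable M"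
  by (simp add: sqint_def)

lemma sqint_mult: "sqint M f \<Longrightarrow> sqint M g \<Longrightarrow> integrable M (\<lambda>x. f x * g x)"
  by (auto simp: sqint_def intro: square_integrable_mult)

lemma sqint_cmult: "sqint M f \<Longrightarrow> sqint M (\<lambda>x. c * f x)"
  by (auto simp: sqint_def power_mult_distrib)

lemma sqint_add:
  assumes "sqint M f" "sqint M g"
  shows "sqint M (\<lambda>x. f x + g x)"
  using assms sqint_mult[OF assms] unfolding sqint_def
  by (auto simp: power2_sum mult.assoc intro!: Bochner_Integration.integrable_add)

lemma sqint_diff:
  assumes "sqint M f" "sqint M g"
  shows "sqint M (\<lambda>x. f x - g x)"
  using sqint_add[OF assms(1) sqint_cmult[OF assms(2), of "-1"]] by simp

lemma sqint_zero [simp]: "sqint M (\<lambda>x. 0)" by (simp add: sqint_def)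

lemma sqint_sum: "(\<And>i. i \<in> I \<Longrightarrow> sqint M (f i)) \<Longrightarrow> sqint M (\<lambda>x. \<Sum>i\<in>I. f i x)"
  by (induction I rule: infinite_finite_induct) (auto intro: sqint_add)

lemma (in finite_measure) sqint_const [simp]: "sqint M (\<lambda>x. c)" by (simp add: sqint_def)

lemma (in finite_measure) sqint_integrable: "sqint M f \<Longrightarrow> integrable M f"
  using sqint_mult[of M f "\<lambda>_. 1"] by simp

lemma sqint_cong_AE:
  assumes "sqint M f" "g \<in> borel_measurable M" "AE x in M. f x = g x"
  shows "sqint M g"
proof -
  have "integrable M (\<lambda>x. (g x)\<^sup>2) \<longleftrightarrow> integrable M (\<lambda>x. (f x)\<^sup>2)"
    using assms by (intro integrable_cong_AE) (auto simp: sqint_def)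
  then show ?thesis using assms by (auto simp: sqint_def)
qed

lemma sqint_Cauchy_Schwarz:
  assumes "sqint M f" "sqint M g"
  shows "\<bar>\<integral>x. f x * g x \<partial>M\<bar> \<le> sqrt (\<integral>x. (f x)\<^sup>2 \<partial>M) * sqrt (\<integral>x. (g x)\<^sup>2 \<partial>M)"
proof -
  have [measurable]: "f \<in> borel_measurable M" "g \<in> borel_measurable M"
    and i: "integrable M (\<lambda>x. (f x)\<^sup>2)" "integrable M (\<lambda>x. (g x)\<^sup>2)" using assms by (auto simp: sqint_def)
  have fg: "integrable M (\<lambda>x. \<bar>f x * g x\<bar>)" using sqint_mult[OF assms] by simp
  have "(\<integral>\<^sup>+x. ennreal \<bar>f x\<bar> * ennreal \<bar>g x\<bar> \<partial>M)\<^sup>2 \<le>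
      (\<integral>\<^sup>+x. (ennreal \<bar>f x\<bar>)\<^sup>2 \<partial>M) * (\<integral>\<^sup>+x. (ennreal \<bar>g x\<bar>)\<^sup>2 \<partial>M)"
    by (intro Cauchy_Schwarz_nn_integral) auto
  also have "(\<integral>\<^sup>+x. (ennreal \<bar>f x\<bar>)\<^sup>2 \<partial>M) = ennreal (\<integral>x. (f x)\<^sup>2 \<partial>M)"
    using i by (simp add: ennreal_power nn_integral_eq_integral)
  also have "(\<integral>\<^sup>+x. (ennreal \<bar>g x\<bar>)\<^sup>2 \<partial>M) = ennreal (\<integral>x. (g x)\<^sup>2 \<partial>M)"
    using i by (simp add: ennreal_power nn_integral_eq_integral)
  also have "(\<integral>\<^sup>+x. ennreal \<bar>f x\<bar> * ennreal \<bar>g x\<bar> \<partial>M) = ennreal (\<integral>x. \<bar>f x * g x\<bar> \<partial>M)"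
    using fg by (simp add: nn_integral_eq_integral abs_mult ennreal_mult[symmetric])
  finally have "(\<integral>x. \<bar>f x * g x\<bar> \<partial>M)\<^sup>2 \<le> (\<integral>x. (f x)\<^sup>2 \<partial>M) * (\<integral>x. (g x)\<^sup>2 \<partial>M)"
    by (simp add: ennreal_power ennreal_mult[symmetric])
  then have "(\<integral>x. \<bar>f x * g x\<bar> \<partial>M) \<le> sqrt ((\<integral>x. (f x)\<^sup>2 \<partial>M) * (\<integral>x. (g x)\<^sup>2 \<partial>M))"
    by (rule real_le_rsqrt)
  then show ?thesis unfolding real_sqrt_mult by (rule order.trans[OF integral_abs_bound])
qed

text \<open>Convergence is stated with the nonnegative integral to match the definition of the Wiener
  integral.\<close>

lemma L2_limit:
  assumes f: "f \<in> borel_measurable M" and fj: "\<And>j. sqint M (F j)"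
    and lim: "(\<lambda>j::nat. \<integral>\<^sup>+x. ennreal ((f x - F j x)\<^sup>2) \<partial>M) \<longlonglongrightarrow> 0"
  shows "sqint M f" "(\<lambda>j. \<integral>x. (f x - F j x)\<^sup>2 \<partial>M) \<longlonglongrightarrow> 0"
proof -
  have "\<forall>\<^sub>F j in sequentially. (\<integral>\<^sup>+x. ennreal ((f x - F j x)\<^sup>2) \<partial>M) < 1"
    using lim by (rule order_tendstoD) simp
  then obtain j where j: "(\<integral>\<^sup>+x. ennreal ((f x - F j x)\<^sup>2) \<partial>M) < 1"
    by (auto simp: eventually_sequentially)
  have [measurable]: "F j \<in> borel_measurable M" for j using fj by (rule sqint_measurable)
  \<comment> \<open>A single index at finite distance suffices: \<open>f\<close> is the sum of
    \<open>f - F j\<close> and \<open>F j\<close>.\<close>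
  have "sqint M (\<lambda>x. f x - F j x)" unfolding sqint_def
    using f order.strict_trans[OF j, of \<infinity>] by (auto intro!: integrableI_bounded)
  from sqint_add[OF this fj[of j]] show s: "sqint M f" by simp
  have "integrable M (\<lambda>x. (f x - F j x)\<^sup>2)" for j
    using sqint_diff[OF s fj] by (simp add: sqint_def)
  then have "(\<integral>\<^sup>+x. ennreal ((f x - F j x)\<^sup>2) \<partial>M) = ennreal (\<integral>x. (f x - F j x)\<^sup>2 \<partial>M)" for j
    by (intro nn_integral_eq_integral) auto
  then have "(\<lambda>j. ennreal (\<integral>x. (f x - F j x)\<^sup>2 \<partial>M)) \<longlonglongrightarrow> ennreal 0" using lim by simp
  then show "(\<lambda>j. \<integral>x. (f x - F j x)\<^sup>2 \<partial>M) \<longlonglongrightarrow> 0"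
    by (subst (asm) tendsto_ennreal_iff) auto
qed

text \<open>Expanding around the limits leaves a product of two errors and two mixed terms, and
  Cauchy-Schwarz sends each of them to 0.\<close>

lemma L2_tendsto_inner:
  assumes s: "sqint M f" "sqint M g" "\<And>j. sqint M (F j)" "\<And>j. sqint M (G j)"
    and lim: "(\<lambda>j::nat. \<integral>x. (f x - F j x)\<^sup>2 \<partial>M) \<longlonglongrightarrow> 0" "(\<lambda>j. \<integral>x. (g x - G j x)\<^sup>2 \<partial>M) \<longlonglongrightarrow> 0"
  shows "(\<lambda>j. \<integral>x. F j x * G j x \<partial>M) \<longlonglongrightarrow> (\<integral>x. f x * g x \<partial>M)"
proof -
  let ?nf = "\<lambda>j. sqrt (\<integral>x. (f x - F j x)\<^sup>2 \<partial>M)" and ?ng = "\<lambda>j. sqrt (\<integral>x. (g x - G j x)\<^sup>2 \<partial>M)"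
  let ?f = "sqrt (\<integral>x. (f x)\<^sup>2 \<partial>M)" and ?g = "sqrt (\<integral>x. (g x)\<^sup>2 \<partial>M)"
  have l: "?nf \<longlonglongrightarrow> 0" "?ng \<longlonglongrightarrow> 0" using tendsto_real_sqrt[OF lim(1)] tendsto_real_sqrt[OF lim(2)] by simp_all
  have "(\<lambda>j. ?nf j * ?ng j + ?nf j * ?g + ?f * ?ng j) \<longlonglongrightarrow> 0 * 0 + 0 * ?g + ?f * 0"
    by (intro tendsto_intros l)
  then have l0: "(\<lambda>j. ?nf j * ?ng j + ?nf j * ?g + ?f * ?ng j) \<longlonglongrightarrow> 0" by simp
  have "\<bar>(\<integral>x. F j x * G j x \<partial>M) - (\<integral>x. f x * g x \<partial>M)\<bar> \<le> ?nf j * ?ng j + ?nf j * ?g + ?f * ?ng j" for j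
  proof -
    have df: "sqint M (\<lambda>x. f x - F j x)" and dg: "sqint M (\<lambda>x. g x - G j x)"
      using s by (auto intro: sqint_diff)
    have "F j x * G j x = (f x - F j x) * (g x - G j x) - (f x - F j x) * g x - f x * (g x - G j x) + f x * g x" for x
      by (simp add: algebra_simps)
    then have "(\<integral>x. F j x * G j x \<partial>M) = (\<integral>x. (f x - F j x) * (g x - G j x) \<partial>M)
       - (\<integral>x. (f x - F j x) * g x \<partial>M) - (\<integral>x. f x * (g x - G j x) \<partial>M) + (\<integral>x. f x * g x \<partial>M)"
      using sqint_mult[OF df dg] sqint_mult[OF df s(2)] sqint_mult[OF s(1) dg] sqint_mult[OF s(1,2)]
      by (simp only: Bochner_Integration.integral_add Bochner_Integration.integral_diff
          Bochner_Integration.integrable_add Bochner_Integration.integrable_diff)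
    then show ?thesis
      using sqint_Cauchy_Schwarz[OF df dg] sqint_Cauchy_Schwarz[OF df s(2)] sqint_Cauchy_Schwarz[OF s(1) dg]
      by linarith
  qed
  then have "(\<lambda>j. (\<integral>x. F j x * G j x \<partial>M) - (\<integral>x. f x * g x \<partial>M)) \<longlonglongrightarrow> 0"
    by (intro Lim_null_comparison[OF _ l0]) auto
  then show ?thesis by (simp add: LIM_zero_iff)
qed

lemma sqint_eq_AE:
  assumes "sqint M f" "sqint M g" "(\<integral>x. (f x - g x)\<^sup>2 \<partial>M) = 0"
  shows "AE x in M. f x = g x"
proof -
  have "AE x in M. (f x - g x)\<^sup>2 = 0"
    using assms sqint_diff[OF assms(1,2)]
    by (intro integral_nonneg_eq_0_iff_AE[THEN iffD1]) (auto simp: sqint_def)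
  then show ?thesis by simp
qed

lemma step_fun_Cons: "step_fun (x # \<phi>) s = fst x * indicator {fst (snd x)<..snd (snd x)} s + step_fun \<phi> s"
  by (simp add: step_fun_def case_prod_unfold)

lemma step_integral_Cons: "step_integral W (x # \<phi>) \<omega> = fst x * (W (snd (snd x)) \<omega> - W (fst (snd x)) \<omega>) + step_integral W \<phi> \<omega>"
  by (simp add: step_integral_def case_prod_unfold)

lemma step_fun_Nil: "step_fun [] s = 0" and step_integral_Nil: "step_integral W [] \<omega> = 0"
  by (simp_all add: step_fun_def step_integral_def)

lemma step_on_Cons: "step_on t (x # \<phi>) \<longleftrightarrow>
    0 \<le> fst (snd x) \<and> fst (snd x) \<le> snd (snd x) \<and> snd (snd x) \<le> t \<and> step_on t \<phi>"
  by (auto simp: step_on_def case_prod_unfold)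

lemma step_on_mono: "step_on t \<phi> \<Longrightarrow> t \<le> t' \<Longrightarrow> step_on t' \<phi>"
  by (induction \<phi>) (auto simp: step_on_Cons, simp add: step_on_def)

lemma step_fun_outside: "step_on t \<phi> \<Longrightarrow> s \<notin> {0..t} \<Longrightarrow> step_fun \<phi> s = 0"
  by (induction \<phi>) (auto simp: step_on_Cons step_fun_Cons step_fun_Nil)

lemma sqint_indicator_Ioc: "sqint lborel (indicator {a<..b::real})"
proof -
  have "integrable lborel (indicator {a<..b} :: real \<Rightarrow> real)"
    by (cases "a \<le> b") (auto intro!: integrable_real_indicator)
  moreover have "(indicator {a<..b} x)\<^sup>2 = (indicator {a<..b} x :: real)" for x :: real
    by (simp add: indicator_def)
  ultimately show ?thesis by (simp add: sqint_def)
qed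

lemma sqint_step_fun: "sqint lborel (step_fun \<phi>)"
proof (induction \<phi>)
  case (Cons x \<phi>)
  have "sqint lborel (\<lambda>s. fst x * indicator {fst (snd x)<..snd (snd x)} s + step_fun \<phi> s)"
    by (intro sqint_add sqint_cmult sqint_indicator_Ioc Cons)
  then show ?case by (simp add: step_fun_Cons[abs_def])
qed (simp add: step_fun_Nil[abs_def])

text \<open>The length of the overlap is written through the four distances between endpoints
  because polarization produces exactly this expression from the variances of Brownian
  increments.\<close>

lemma integral_indicator_Ioc_mult:
  fixes a b c d :: real
  assumes "a \<le> b" "c \<le> d"
  shows "(\<integral>s. indicator {a<..b} s * indicator {c<..d} s \<partial>lborel) = (\<bar>b - c\<bar> + \<bar>a - d\<bar> - \<bar>b - d\<bar> - \<bar>a - c\<bar>) / 2"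
proof -
  have "(\<integral>s. indicator {a<..b} s * indicator {c<..d} s \<partial>lborel) = (\<integral>s. indicator {max a c<..min b d} s \<partial>lborel :: real)"
    by (intro Bochner_Integration.integral_cong) (auto simp: indicator_def)
  also have "\<dots> = max 0 (min b d - max a c)"
    by (cases "max a c \<le> min b d") (auto simp: max_def)
  also have "\<dots> = (\<bar>b - c\<bar> + \<bar>a - d\<bar> - \<bar>b - d\<bar> - \<bar>a - c\<bar>) / 2"
    using assms by (auto simp: max_def min_def abs_if)
  finally show ?thesis .
qed

section \<open>The Wiener isometry\<close>

context brownian_motion
begin

text \<open>The order of \<open>a\<close> and \<open>b\<close> is left open, since polarization
  pairs endpoints of different intervals in either order.\<close>

lemma W_diff:
  assumes "0 \<le> a" "0 \<le> b"
  shows "sqint M (\<lambda>\<omega>. W b \<omega> - W a \<omega>)" "(\<integral>\<omega>. W b \<omega> - W a \<omega> \<partial>M) = 0" "(\<integral>\<omega>. (W b \<omega> - W a \<omega>)\<^sup>2 \<partial>M) = \<bar>b - a\<bar>"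
proof -
  have *: "sqint M (\<lambda>\<omega>. W b \<omega> - W a \<omega>) \<and> (\<integral>\<omega>. W b \<omega> - W a \<omega> \<partial>M) = 0 \<and> (\<integral>\<omega>. (W b \<omega> - W a \<omega>)\<^sup>2 \<partial>M) = b - a"
    if ab: "0 \<le> a" "a < b" for a b
  proof -
    note d = normal_increments[OF ab]
    have s: "0 < sqrt (b - a)" using ab by simp
    have n: "AE x in lborel. 0 \<le> normal_density 0 (sqrt (b - a)) x" by simp
    have [measurable]: "W a \<in> borel_measurable M" "W b \<in> borel_measurable M"
      using ab by (auto intro: random_variable_W)
    have "integrable lborel (\<lambda>x. normal_density 0 (sqrt (b - a)) x * (\<lambda>x. x\<^sup>2) x)"
      using integrable_normal_moment[OF s, of 0 2] by simp
    then have 1: "integrable M (\<lambda>\<omega>. (W b \<omega> - W a \<omega>)\<^sup>2)"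
      by (subst (asm) distributed_integrable[OF d, of "\<lambda>x. x\<^sup>2"]) auto
    have 2: "(\<integral>\<omega>. (W b \<omega> - W a \<omega>)\<^sup>2 \<partial>M) = b - a"
      using distributed_integral[OF d, of "\<lambda>x. x\<^sup>2"] integral_normal_moment_even[OF s, of 0 1] ab
      by (simp add: numeral_2_eq_2)
    have 3: "(\<integral>\<omega>. W b \<omega> - W a \<omega> \<partial>M) = 0"
      using distributed_integral[OF d, of "\<lambda>x. x"] integral_normal_moment_nz_1[OF s, of 0] by simp
    show ?thesis using 1 2 3 by (simp add: sqint_def)
  qed
  have "sqint M (\<lambda>\<omega>. W b \<omega> - W a \<omega>) \<and> (\<integral>\<omega>. W b \<omega> - W a \<omega> \<partial>M) = 0 \<and> (\<integral>\<omega>. (W b \<omega> - W a \<omega>)\<^sup>2 \<partial>M) = \<bar>b - a\<bar>"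
  proof (cases a b rule: linorder_cases)
    case greater
    note g = *[OF assms(2) greater]
    have "sqint M (\<lambda>\<omega>. -1 * (W a \<omega> - W b \<omega>))" using g by (intro sqint_cmult) auto
    moreover have "(\<integral>\<omega>. W b \<omega> - W a \<omega> \<partial>M) = - (\<integral>\<omega>. W a \<omega> - W b \<omega> \<partial>M)"
      by (subst Bochner_Integration.integral_minus[symmetric]) simp
    ultimately show ?thesis using g greater by (simp add: power2_commute[of "W b _"])
  qed (use *[OF assms(1)] assms in auto)
  then show "sqint M (\<lambda>\<omega>. W b \<omega> - W a \<omega>)" "(\<integral>\<omega>. W b \<omega> - W a \<omega> \<partial>M) = 0" "(\<integral>\<omega>. (W b \<omega> - W a \<omega>)\<^sup>2 \<partial>M) = \<bar>b - a\<bar>"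
    by auto
qed

text \<open>Polarization reduces the covariance of two increments to the variances of increments, so that
  independence is not needed.\<close>

lemma W_diff_mult:
  assumes "0 \<le> a" "a \<le> b" "0 \<le> c" "c \<le> d"
  shows "(\<integral>\<omega>. (W b \<omega> - W a \<omega>) * (W d \<omega> - W c \<omega>) \<partial>M) = (\<integral>s. indicator {a<..b} s * indicator {c<..d} s \<partial>lborel)"
proof -
  have p: "0 \<le> b" "0 \<le> d" using assms by auto
  have i: "integrable M (\<lambda>\<omega>. (W x \<omega> - W y \<omega>)\<^sup>2)" if "0 \<le> x" "0 \<le> y" for x y
    using W_diff(1)[of y x] that by (simp add: sqint_def)
  have "(W b \<omega> - W a \<omega>) * (W d \<omega> - W c \<omega>) =
    ((W b \<omega> - W c \<omega>)\<^sup>2 + (W a \<omega> - W d \<omega>)\<^sup>2 - (W b \<omega> - W d \<omega>)\<^sup>2 - (W a \<omega> - W c \<omega>)\<^sup>2) / 2" for \<omega>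
    by (simp add: power2_eq_square algebra_simps)
  then have "(\<integral>\<omega>. (W b \<omega> - W a \<omega>) * (W d \<omega> - W c \<omega>) \<partial>M) =
    (\<integral>\<omega>. ((W b \<omega> - W c \<omega>)\<^sup>2 + (W a \<omega> - W d \<omega>)\<^sup>2 - (W b \<omega> - W d \<omega>)\<^sup>2 - (W a \<omega> - W c \<omega>)\<^sup>2) / 2 \<partial>M)"
    by (simp only:)
  also have "\<dots> = (\<bar>b - c\<bar> + \<bar>a - d\<bar> - \<bar>b - d\<bar> - \<bar>a - c\<bar>) / 2"
    using assms p by (simp add: i W_diff(3))
  finally have "(\<integral>\<omega>. (W b \<omega> - W a \<omega>) * (W d \<omega> - W c \<omega>) \<partial>M) = (\<bar>b - c\<bar> + \<bar>a - d\<bar> - \<bar>b - d\<bar> - \<bar>a - c\<bar>) / 2" .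
  then show ?thesis using assms by (simp add: integral_indicator_Ioc_mult)
qed

lemma sqint_step_integral: "step_on t \<phi> \<Longrightarrow> sqint M (step_integral W \<phi>)"
proof (induction \<phi>)
  case (Cons x \<phi>)
  then have "sqint M (\<lambda>\<omega>. fst x * (W (snd (snd x)) \<omega> - W (fst (snd x)) \<omega>) + step_integral W \<phi> \<omega>)"
    by (intro sqint_add sqint_cmult W_diff) (auto simp: step_on_Cons)
  then show ?case by (simp add: step_integral_Cons[abs_def])
qed (simp add: step_integral_Nil[abs_def])

lemma step_integral_mean: "step_on t \<phi> \<Longrightarrow> (\<integral>\<omega>. step_integral W \<phi> \<omega> \<partial>M) = 0"
proof (induction \<phi>)
  case (Cons x \<phi>)
  then have "integrable M (\<lambda>\<omega>. W (snd (snd x)) \<omega> - W (fst (snd x)) \<omega>)" "integrable M (step_integral W \<phi>)"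
    by (auto simp: step_on_Cons intro!: sqint_integrable W_diff sqint_step_integral)
  then show ?case using Cons W_diff(2)[of "fst (snd x)" "snd (snd x)"]
    by (simp add: step_integral_Cons step_on_Cons)
qed (simp add: step_integral_Nil[abs_def])

text \<open>Bilinearity reduces the claim to two single intervals, so overlapping intervals need no
  common refinement: the outer induction peels off intervals of \<open>\<phi>\<close>, the inner one
  intervals of \<open>\<psi>\<close>.\<close>

lemma step_isometry:
  assumes "step_on t \<phi>" "step_on t' \<psi>"
  shows "(\<integral>\<omega>. step_integral W \<phi> \<omega> * step_integral W \<psi> \<omega> \<partial>M) = (\<integral>s. step_fun \<phi> s * step_fun \<psi> s \<partial>lborel)"
  using assms(1)
proof (induction \<phi>)
  case (Cons x \<phi>)
  let ?a = "fst (snd x)" and ?b = "snd (snd x)"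
  have x: "0 \<le> ?a" "?a \<le> ?b" "step_on t \<phi>" using Cons by (auto simp: step_on_Cons)
  have 1: "(\<integral>\<omega>. (W ?b \<omega> - W ?a \<omega>) * step_integral W \<psi> \<omega> \<partial>M) = (\<integral>s. indicator {?a<..?b} s * step_fun \<psi> s \<partial>lborel)"
    using assms(2)
  proof (induction \<psi>)
    case (Cons y \<psi>)
    let ?c = "fst (snd y)" and ?d = "snd (snd y)"
    have y: "0 \<le> ?c" "?c \<le> ?d" "step_on t' \<psi>" using Cons by (auto simp: step_on_Cons)
    have i: "integrable M (\<lambda>\<omega>. (W ?b \<omega> - W ?a \<omega>) * (W ?d \<omega> - W ?c \<omega>))"
      "integrable M (\<lambda>\<omega>. (W ?b \<omega> - W ?a \<omega>) * step_integral W \<psi> \<omega>)"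
      "integrable lborel (\<lambda>s. indicator {?a<..?b} s * indicator {?c<..?d} s :: real)"
      "integrable lborel (\<lambda>s. indicator {?a<..?b} s * step_fun \<psi> s)"
      using x y by (auto intro!: sqint_mult W_diff sqint_step_integral sqint_step_fun sqint_indicator_Ioc)
    show ?case using i Cons y W_diff_mult[OF x(1,2) y(1,2)]
      by (simp add: step_integral_Cons step_fun_Cons distrib_left mult.left_commute[of _ "fst y"])
  qed (simp add: step_integral_Nil step_fun_Nil)
  have i: "integrable M (\<lambda>\<omega>. (W ?b \<omega> - W ?a \<omega>) * step_integral W \<psi> \<omega>)"
      "integrable M (\<lambda>\<omega>. step_integral W \<phi> \<omega> * step_integral W \<psi> \<omega>)"
      "integrable lborel (\<lambda>s. indicator {?a<..?b} s * step_fun \<psi> s)"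
      "integrable lborel (\<lambda>s. step_fun \<phi> s * step_fun \<psi> s)"
    using x assms by (auto intro!: sqint_mult W_diff sqint_step_integral sqint_step_fun sqint_indicator_Ioc)
  then show ?case using i Cons x 1
    by (simp add: step_integral_Cons step_fun_Cons distrib_right mult.assoc)
qed (simp add: step_integral_Nil step_fun_Nil)

text \<open>Step functions on \<open>{0..t}\<close> vanish outside it, so cutting off
  \<open>f\<close> there turns the convergence into one on the whole line. Integrands with different
  horizons can then be multiplied.\<close>

lemma wiener_integral_approx:
  assumes "has_wiener_integral M W f t Y"
  obtains \<phi> where "\<And>j. step_on t (\<phi> j)" "sqint M Y" "sqint lborel (\<lambda>s. indicator {0..t} s * f s)"
    "(\<lambda>j::nat. \<integral>s. (indicator {0..t} s * f s - step_fun (\<phi> j) s)\<^sup>2 \<partial>lborel) \<longlonglongrightarrow> 0"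
    "(\<lambda>j. \<integral>\<omega>. (Y \<omega> - step_integral W (\<phi> j) \<omega>)\<^sup>2 \<partial>M) \<longlonglongrightarrow> 0"
proof -
  from assms obtain \<phi> where f: "set_borel_measurable lborel {0..t} f" "Y \<in> borel_measurable M"
    and s: "\<And>j. step_on t (\<phi> j)"
    and l: "(\<lambda>j::nat. \<integral>\<^sup>+s\<in>{0..t}. ennreal ((f s - step_fun (\<phi> j) s)\<^sup>2) \<partial>lborel) \<longlonglongrightarrow> 0"
      "(\<lambda>j. \<integral>\<^sup>+\<omega>. ennreal ((Y \<omega> - step_integral W (\<phi> j) \<omega>)\<^sup>2) \<partial>M) \<longlonglongrightarrow> 0"
    unfolding has_wiener_integral_def by auto
  have "(\<integral>\<^sup>+s\<in>{0..t}. ennreal ((f s - step_fun (\<phi> j) s)\<^sup>2) \<partial>lborel) =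
      (\<integral>\<^sup>+s. ennreal ((indicator {0..t} s * f s - step_fun (\<phi> j) s)\<^sup>2) \<partial>lborel)" for j
    using step_fun_outside[OF s[of j]] by (intro nn_integral_cong) (auto simp: indicator_def)
  with l(1) have l1: "(\<lambda>j::nat. \<integral>\<^sup>+s. ennreal ((indicator {0..t} s * f s - step_fun (\<phi> j) s)\<^sup>2) \<partial>lborel) \<longlonglongrightarrow> 0"
    by simp
  have m: "(\<lambda>s. indicator {0..t} s * f s) \<in> borel_measurable lborel"
    using f(1) by (simp add: set_borel_measurable_def)
  show thesis
    using that[OF s L2_limit(1)[OF f(2) sqint_step_integral[OF s] l(2)] L2_limit(1)[OF m sqint_step_fun l1]
       L2_limit(2)[OF m sqint_step_fun l1] L2_limit(2)[OF f(2) sqint_step_integral[OF s] l(2)]] .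
qed

lemma wiener_integral_sqint: "has_wiener_integral M W f t Y \<Longrightarrow> sqint M Y"
  by (auto elim: wiener_integral_approx)

lemma wiener_integral_mean:
  assumes "has_wiener_integral M W f t Y"
  shows "(\<integral>\<omega>. Y \<omega> \<partial>M) = 0"
proof -
  obtain \<phi> where *: "\<And>j. step_on t (\<phi> j)" "sqint M Y" "sqint lborel (\<lambda>s. indicator {0..t} s * f s)"
    "(\<lambda>j::nat. \<integral>s. (indicator {0..t} s * f s - step_fun (\<phi> j) s)\<^sup>2 \<partial>lborel) \<longlonglongrightarrow> 0"
    "(\<lambda>j. \<integral>\<omega>. (Y \<omega> - step_integral W (\<phi> j) \<omega>)\<^sup>2 \<partial>M) \<longlonglongrightarrow> 0"
    by (fact wiener_integral_approx[OF assms])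
  have "(\<lambda>j. \<integral>\<omega>. step_integral W (\<phi> j) \<omega> * 1 \<partial>M) \<longlonglongrightarrow> (\<integral>\<omega>. Y \<omega> * 1 \<partial>M)"
    using * by (intro L2_tendsto_inner) (auto intro: sqint_step_integral)
  then show ?thesis by (simp add: step_integral_mean[OF *(1)] LIMSEQ_const_iff)
qed

lemma wiener_isometry:
  assumes "has_wiener_integral M W f t Y" "has_wiener_integral M W g t' Z"
  shows "(\<integral>\<omega>. Y \<omega> * Z \<omega> \<partial>M) = (\<integral>s. (indicator {0..t} s * f s) * (indicator {0..t'} s * g s) \<partial>lborel)"
proof -
  obtain \<phi> where p: "\<And>j. step_on t (\<phi> j)" "sqint M Y" "sqint lborel (\<lambda>s. indicator {0..t} s * f s)"
    "(\<lambda>j::nat. \<integral>s. (indicator {0..t} s * f s - step_fun (\<phi> j) s)\<^sup>2 \<partial>lborel) \<longlonglongrightarrow> 0"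
    "(\<lambda>j. \<integral>\<omega>. (Y \<omega> - step_integral W (\<phi> j) \<omega>)\<^sup>2 \<partial>M) \<longlonglongrightarrow> 0"
    by (fact wiener_integral_approx[OF assms(1)])
  obtain \<psi> where q: "\<And>j. step_on t' (\<psi> j)" "sqint M Z" "sqint lborel (\<lambda>s. indicator {0..t'} s * g s)"
    "(\<lambda>j::nat. \<integral>s. (indicator {0..t'} s * g s - step_fun (\<psi> j) s)\<^sup>2 \<partial>lborel) \<longlonglongrightarrow> 0"
    "(\<lambda>j. \<integral>\<omega>. (Z \<omega> - step_integral W (\<psi> j) \<omega>)\<^sup>2 \<partial>M) \<longlonglongrightarrow> 0"
    by (fact wiener_integral_approx[OF assms(2)])
  have 1: "(\<lambda>j. \<integral>\<omega>. step_integral W (\<phi> j) \<omega> * step_integral W (\<psi> j) \<omega> \<partial>M) \<longlonglongrightarrow> (\<integral>\<omega>. Y \<omega> * Z \<omega> \<partial>M)"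
    using p q by (intro L2_tendsto_inner) (auto intro: sqint_step_integral)
  have 2: "(\<lambda>j. \<integral>s. step_fun (\<phi> j) s * step_fun (\<psi> j) s \<partial>lborel) \<longlonglongrightarrow>
      (\<integral>s. (indicator {0..t} s * f s) * (indicator {0..t'} s * g s) \<partial>lborel)"
    using p q by (intro L2_tendsto_inner) (auto intro: sqint_step_fun)
  show ?thesis using LIMSEQ_unique[OF 1[unfolded step_isometry[OF p(1) q(1)]] 2] .
qed

text \<open>By the isometry the three terms in the expansion of \<open>(Y - Z)\<^sup>2\<close> all
  have the same integral, namely the squared norm of \<open>f\<close>, with coefficients 1, -2 and
  1.\<close>

lemma wiener_integral_unique:
  assumes "has_wiener_integral M W f t Y" "has_wiener_integral M W f t Z"
  shows "AE \<omega> in M. Y \<omega> = Z \<omega>"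
proof (rule sqint_eq_AE)
  show s: "sqint M Y" "sqint M Z" using assms by (auto intro: wiener_integral_sqint)
  have "(\<integral>\<omega>. (Y \<omega> - Z \<omega>)\<^sup>2 \<partial>M) = (\<integral>\<omega>. Y \<omega> * Y \<omega> - 2 * (Y \<omega> * Z \<omega>) + Z \<omega> * Z \<omega> \<partial>M)"
    by (intro Bochner_Integration.integral_cong) (auto simp: power2_eq_square algebra_simps)
  also have "\<dots> = (\<integral>\<omega>. Y \<omega> * Y \<omega> \<partial>M) - 2 * (\<integral>\<omega>. Y \<omega> * Z \<omega> \<partial>M) + (\<integral>\<omega>. Z \<omega> * Z \<omega> \<partial>M)"
    using sqint_mult[OF s(1) s(1)] sqint_mult[OF s(1) s(2)] sqint_mult[OF s(2) s(2)] by simp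
  also have "\<dots> = 0"
    unfolding wiener_isometry[OF assms(1) assms(1)] wiener_isometry[OF assms(1) assms(2)]
      wiener_isometry[OF assms(2) assms(2)] by simp
  finally show "(\<integral>\<omega>. (Y \<omega> - Z \<omega>)\<^sup>2 \<partial>M) = 0" .
qed

end

section \<open>Centred Gaussian random variables\<close>

text \<open>The variance \<open>v\<close> may be \<open>0\<close>; characteristic functions cover this case as well.\<close>

definition gauss :: "'a measure \<Rightarrow> ('a \<Rightarrow> real) \<Rightarrow> real \<Rightarrow> bool" where
  "gauss M U v \<longleftrightarrow> U \<in> borel_measurable M \<and> 0 \<le> v \<and>
     (\<forall>\<theta>. char (distr M borel U) \<theta> = complex_of_real (exp (- (v * \<theta>\<^sup>2) / 2)))"

context prob_space
begin

lemma char_cmult: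
  assumes [measurable]: "U \<in> borel_measurable M"
  shows "char (distr M borel (\<lambda>\<omega>. c * U \<omega>)) \<theta> = char (distr M borel U) (\<theta> * c)"
  by (simp add: char_def integral_distr mult.assoc)

lemma gauss_cmult:
  assumes "gauss M U v"
  shows "gauss M (\<lambda>\<omega>. c * U \<omega>) (c\<^sup>2 * v)"
  using assms by (auto simp: gauss_def char_cmult power_mult_distrib mult_ac)

lemma gauss_normal:
  assumes "distributed M lborel U (normal_density 0 s)" "0 < s"
  shows "gauss M U (s\<^sup>2)"
proof -
  have d: "distributed M lborel (\<lambda>x. (U x - 0) / s) std_normal_density"
    using normal_standard_normal_convert[OF assms(2), of U 0] assms(1) by simp
  have [measurable]: "U \<in> borel_measurable M" using distributed_measurable[OF assms(1)] by simp
  have "distr M borel (\<lambda>x. U x / s) = distr M lborel (\<lambda>x. (U x - 0) / s)"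
    by (intro distr_cong) auto
  also have "\<dots> = std_normal_distribution"
    using distributed_distr_eq_density[OF d] by simp
  finally have "gauss M (\<lambda>x. U x / s) 1"
    by (simp add: gauss_def char_std_normal_distribution)
  from gauss_cmult[OF this, of s] show ?thesis using assms(2) by simp
qed

lemma gauss_sum_indep:
  assumes "indep_vars (\<lambda>_. borel) X I" "finite I" "\<And>i. i \<in> I \<Longrightarrow> gauss M (X i) (v i)"
  shows "gauss M (\<lambda>\<omega>. \<Sum>i\<in>I. X i \<omega>) (\<Sum>i\<in>I. v i)"
proof -
  have "char (distr M borel (\<lambda>\<omega>. \<Sum>i\<in>I. X i \<omega>)) \<theta> = complex_of_real (exp (- ((\<Sum>i\<in>I. v i) * \<theta>\<^sup>2) / 2))" for \<theta>
  proof -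
    have "char (distr M borel (\<lambda>\<omega>. \<Sum>i\<in>I. X i \<omega>)) \<theta> = (\<Prod>i\<in>I. complex_of_real (exp (- (v i * \<theta>\<^sup>2) / 2)))"
      unfolding char_distr_sum[OF assms(1)] using assms(3) by (intro prod.cong) (auto simp: gauss_def)
    also have "\<dots> = complex_of_real (exp (\<Sum>i\<in>I. - (v i * \<theta>\<^sup>2) / 2))"
      using assms(2) by (simp add: exp_sum)
    also have "(\<Sum>i\<in>I. - (v i * \<theta>\<^sup>2) / 2) = - ((\<Sum>i\<in>I. v i) * \<theta>\<^sup>2) / 2"
      by (simp add: sum_distrib_right sum_negf sum_divide_distrib)
    finally show ?thesis .
  qed
  then show ?thesis using assms(3) by (auto simp: gauss_def intro!: sum_nonneg borel_measurable_sum)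
qed

text \<open>Levy's theorem passes from characteristic functions to laws. The scaling by
  \<open>sqrt v\<close> represents the degenerate case \<open>v = 0\<close> as well, which a density
  could not.\<close>

lemma gauss_distr:
  assumes "gauss M U v"
  shows "distr M borel U = distr std_normal_distribution borel (\<lambda>z. sqrt v * z)"
proof (rule Levy_uniqueness)
  have [measurable]: "U \<in> borel_measurable M" using assms by (simp add: gauss_def)
  show "real_distribution (distr M borel U)" by simp
  interpret N: real_distribution std_normal_distribution by (rule real_dist_normal_dist)
  show "real_distribution (distr std_normal_distribution borel (\<lambda>z. sqrt v * z))"
    by (intro N.real_distribution_distr) simp
  have v: "0 \<le> v" using assms by (simp add: gauss_def)
  show "char (distr M borel U) = char (distr std_normal_distribution borel (\<lambda>z. sqrt v * z))"
  proof
    fix \<theta>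
    have "char (distr std_normal_distribution borel (\<lambda>z. sqrt v * z)) \<theta> = char std_normal_distribution (\<theta> * sqrt v)"
      by (simp add: char_def integral_distr mult.assoc)
    then show "char (distr M borel U) \<theta> = char (distr std_normal_distribution borel (\<lambda>z. sqrt v * z)) \<theta>"
      using assms v by (simp add: gauss_def char_std_normal_distribution power_mult_distrib mult_ac)
  qed
qed

text \<open>The parameter is thereby determined by the random variable, so that an unspecified
  variance along a sequence can be replaced by a second moment, which converges in mean square
  limits.\<close>

lemma gauss_variance:
  assumes "gauss M U v"
  shows "(\<integral>\<omega>. (U \<omega>)\<^sup>2 \<partial>M) = v"
proof -
  have [measurable]: "U \<in> borel_measurable M" and v: "0 \<le> v" using assms by (auto simp: gauss_def)
  have "(\<integral>\<omega>. (U \<omega>)\<^sup>2 \<partial>M) = (\<integral>x. x\<^sup>2 \<partial>distr M borel U)" by (simp add: integral_distr)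
  also have "\<dots> = (\<integral>z. (sqrt v * z)\<^sup>2 \<partial>std_normal_distribution)"
    unfolding gauss_distr[OF assms] by (simp add: integral_distr)
  also have "\<dots> = v * (\<integral>z. z ^ (2 * 1) \<partial>std_normal_distribution)"
    using v by (simp add: power_mult_distrib)
  also have "\<dots> = v" unfolding std_normal_distribution_even_moments by simp
  finally show ?thesis .
qed

text \<open>Mean square convergence carries the second moments to the limit, hence the right-hand
  sides of the characteristic functions. The left-hand sides converge because x -> exp(i \<theta> x)
  is Lipschitz with constant |\<theta>|. Uniqueness of limits identifies the two.\<close>

lemma gauss_limit:
  assumes U: "sqint M U" and G: "\<And>j. sqint M (F j)" "\<And>j. \<exists>v. gauss M (F j) v"
    and lim: "(\<lambda>j::nat. \<integral>\<omega>. (U \<omega> - F j \<omega>)\<^sup>2 \<partial>M) \<longlonglongrightarrow> 0"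
  shows "gauss M U (\<integral>\<omega>. (U \<omega>)\<^sup>2 \<partial>M)"
proof -
  have [measurable]: "U \<in> borel_measurable M" "F j \<in> borel_measurable M" for j
    using U G by (auto simp: sqint_def)
  have "gauss M (F j) (\<integral>\<omega>. (F j \<omega>)\<^sup>2 \<partial>M)" for j
    using G(2)[of j] gauss_variance by auto
  then have c: "char (distr M borel (F j)) \<theta> = complex_of_real (exp (- ((\<integral>\<omega>. F j \<omega> * F j \<omega> \<partial>M) * \<theta>\<^sup>2) / 2))" for j \<theta>
    by (simp add: gauss_def power2_eq_square)
  have "(\<lambda>j. \<integral>\<omega>. F j \<omega> * F j \<omega> \<partial>M) \<longlonglongrightarrow> (\<integral>\<omega>. U \<omega> * U \<omega> \<partial>M)"
    by (intro L2_tendsto_inner U G lim)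
  then have 1: "(\<lambda>j. char (distr M borel (F j)) \<theta>) \<longlonglongrightarrow> complex_of_real (exp (- ((\<integral>\<omega>. U \<omega> * U \<omega> \<partial>M) * \<theta>\<^sup>2) / 2))" for \<theta>
    unfolding c by (intro tendsto_intros) auto
  have 2: "(\<lambda>j. char (distr M borel (F j)) \<theta>) \<longlonglongrightarrow> char (distr M borel U) \<theta>" for \<theta>
  proof -
    have le: "cmod (char (distr M borel (F j)) \<theta> - char (distr M borel U) \<theta>) \<le> \<bar>\<theta>\<bar> * sqrt (\<integral>\<omega>. (U \<omega> - F j \<omega>)\<^sup>2 \<partial>M)" for j
    proof -
      have d: "sqint M (\<lambda>\<omega>. U \<omega> - F j \<omega>)" using U G by (intro sqint_diff)
      have ad: "sqint M (\<lambda>\<omega>. \<bar>U \<omega> - F j \<omega>\<bar>)" using d by (auto simp: sqint_def)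
      have i: "integrable M (\<lambda>\<omega>. iexp (\<theta> * F j \<omega>))" "integrable M (\<lambda>\<omega>. iexp (\<theta> * U \<omega>))"
        by (auto intro!: integrable_iexp)
      have "cmod (iexp x - iexp y) \<le> \<bar>x - y\<bar>" for x y
      proof -
        have "iexp x - iexp y = iexp y * (iexp (x - y) - 1)"
          by (simp add: algebra_simps exp_add[symmetric])
        then have "cmod (iexp x - iexp y) = cmod (iexp (x - y) - 1)"
          by (simp add: norm_mult)
        also have "\<dots> \<le> \<bar>x - y\<bar>" using iexp_approx1[of "x - y" 0] by simp
        finally show ?thesis .
      qed
      note lip = this
      have "cmod (char (distr M borel (F j)) \<theta> - char (distr M borel U) \<theta>) =
          cmod (\<integral>\<omega>. iexp (\<theta> * F j \<omega>) - iexp (\<theta> * U \<omega>) \<partial>M)"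
        using i by (simp add: char_def integral_distr)
      also have "\<dots> \<le> (\<integral>\<omega>. \<bar>\<theta>\<bar> * \<bar>U \<omega> - F j \<omega>\<bar> \<partial>M)"
      proof (rule order.trans[OF integral_norm_bound], rule integral_mono)
        show "integrable M (\<lambda>\<omega>. \<bar>\<theta>\<bar> * \<bar>U \<omega> - F j \<omega>\<bar>)"
          using sqint_integrable[OF ad] by simp
        show "cmod (iexp (\<theta> * F j \<omega>) - iexp (\<theta> * U \<omega>)) \<le> \<bar>\<theta>\<bar> * \<bar>U \<omega> - F j \<omega>\<bar>" for \<omega>
          using lip[of "\<theta> * F j \<omega>" "\<theta> * U \<omega>"] by (simp only: right_diff_distrib[symmetric] abs_mult abs_minus_commute[of "F j \<omega>"])
      qed (use i in simp)
      also have "\<dots> = \<bar>\<theta>\<bar> * (\<integral>\<omega>. \<bar>U \<omega> - F j \<omega>\<bar> * 1 \<partial>M)" by simp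
      also have "(\<integral>\<omega>. \<bar>U \<omega> - F j \<omega>\<bar> * 1 \<partial>M) \<le> sqrt (\<integral>\<omega>. (U \<omega> - F j \<omega>)\<^sup>2 \<partial>M)"
        using sqint_Cauchy_Schwarz[OF ad sqint_const[of 1]] by (simp add: prob_space)
      finally show ?thesis by (simp add: mult_left_mono)
    qed
    have "(\<lambda>j. \<bar>\<theta>\<bar> * sqrt (\<integral>\<omega>. (U \<omega> - F j \<omega>)\<^sup>2 \<partial>M)) \<longlonglongrightarrow> \<bar>\<theta>\<bar> * sqrt 0"
      by (rule tendsto_mult_left[OF tendsto_real_sqrt[OF lim]])
    then have "(\<lambda>j. char (distr M borel (F j)) \<theta> - char (distr M borel U) \<theta>) \<longlonglongrightarrow> 0"
      by (intro Lim_null_comparison[OF always_eventually[OF allI[OF le]]]) simp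
    then show ?thesis by (simp add: LIM_zero_iff)
  qed
  show ?thesis
    using LIMSEQ_unique[OF 2 1] by (simp add: gauss_def power2_eq_square)
qed

end

section \<open>The Gaussian space generated by the Brownian motion\<close>

context brownian_motion
begin

text \<open>Independence is available only for increments over consecutive points of one grid. If
  all endpoints lie on that grid, each increment telescopes into grid increments, and overlaps
  merely add up coefficients.\<close>

lemma step_integral_increments:
  fixes u :: "nat \<Rightarrow> real"
  assumes "mono_on {..m} u" "\<forall>x\<in>set \<phi>. fst (snd x) \<in> u ` {..m} \<and> snd (snd x) \<in> u ` {..m} \<and> fst (snd x) \<le> snd (snd x)"
  shows "\<exists>d. \<forall>\<omega>. step_integral W \<phi> \<omega> = (\<Sum>k<m. d k * (W (u (Suc k)) \<omega> - W (u k) \<omega>))"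
  using assms(2)
proof (induction \<phi>)
  case Nil
  show ?case by (rule exI[of _ "\<lambda>_. 0"]) (simp add: step_integral_Nil)
next
  case (Cons x \<phi>)
  then obtain d where d: "\<And>\<omega>. step_integral W \<phi> \<omega> = (\<Sum>k<m. d k * (W (u (Suc k)) \<omega> - W (u k) \<omega>))" by auto
  from Cons.prems obtain i j where ij: "fst (snd x) = u i" "i \<le> m" "snd (snd x) = u j" "j \<le> m" "u i \<le> u j" by auto
  have inc: "W (u j) \<omega> - W (u i) \<omega> = (\<Sum>k<m. (if i \<le> k \<and> k < j then 1 else 0) * (W (u (Suc k)) \<omega> - W (u k) \<omega>))" for \<omega>
  proof (cases "i \<le> j")
    case True
    have "(\<Sum>k<m. (if i \<le> k \<and> k < j then 1 else 0) * (W (u (Suc k)) \<omega> - W (u k) \<omega>)) =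
        (\<Sum>k\<in>{i..<j}. W (u (Suc k)) \<omega> - W (u k) \<omega>)"
      using ij by (intro sum.mono_neutral_cong_right) auto
    then show ?thesis using sum_Suc_diff'[OF True, of "\<lambda>k. W (u k) \<omega>"] by simp
  next
    case False
    \<comment> \<open>Here \<open>j < i\<close>, so monotonicity and \<open>u i \<le> u j\<close>
      leave only an empty interval, and the telescoping sum is empty too.\<close>
    then have "u j = u i" using ij mono_onD[OF assms(1), of j i] by simp
    then show ?thesis using False by (simp add: sum.neutral)
  qed
  show ?case
    by (rule exI[of _ "\<lambda>k. fst x * (if i \<le> k \<and> k < j then 1 else 0) + d k"])
       (simp only: step_integral_Cons ij inc d distrib_right sum.distrib sum_distrib_left mult.assoc simp_thms)
qed

lemma step_integral_gauss:
  assumes "step_on t \<phi>"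
  shows "\<exists>v. gauss M (step_integral W \<phi>) v"
proof -
  \<comment> \<open>The grid consists of all endpoints. The point 0 is added so that the list is
    nonempty even for an empty step function; sorting without repetition then gives a strictly
    increasing grid.\<close>
  define P where "P = insert 0 ((fst \<circ> snd) ` set \<phi> \<union> (snd \<circ> snd) ` set \<phi>)"
  define xs where "xs = sorted_list_of_set P"
  define m where "m = length xs - 1"
  let ?u = "\<lambda>i. xs ! i"
  have fin: "finite P" by (simp add: P_def)
  have xs: "set xs = P" "sorted xs" "distinct xs" using fin by (auto simp: xs_def)
  then have "xs \<noteq> []" by (auto simp: P_def)
  then have len: "length xs = Suc m" by (simp add: m_def)
  have ran: "?u ` {..m} = P"
    using xs(1) len by (auto simp: set_conv_nth image_def less_Suc_eq_le)
  have sm: "strict_mono_on {..m} ?u"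
    using sorted_wrt_nth_less[of "(<)" xs] xs(2,3) len by (auto simp: strict_mono_on_def strict_sorted_iff)
  have pos: "0 \<le> x" if "x \<in> P" for x
    using that assms by (force simp: P_def step_on_def)
  have u0: "0 \<le> ?u i" if "i \<le> m" for i using pos ran that by blast
  have "\<exists>d. \<forall>\<omega>. step_integral W \<phi> \<omega> = (\<Sum>k<m. d k * (W (?u (Suc k)) \<omega> - W (?u k) \<omega>))"
  proof (rule step_integral_increments)
    show "mono_on {..m} ?u" using sm by (rule strict_mono_on_imp_mono_on)
    show "\<forall>x\<in>set \<phi>. fst (snd x) \<in> ?u ` {..m} \<and> snd (snd x) \<in> ?u ` {..m} \<and> fst (snd x) \<le> snd (snd x)"
      unfolding ran
    proof (intro ballI conjI)
      fix x assume x: "x \<in> set \<phi>"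
      then show "fst (snd x) \<in> P" "snd (snd x) \<in> P" by (auto simp: P_def)
      show "fst (snd x) \<le> snd (snd x)" using assms x by (auto simp: step_on_def)
    qed
  qed
  then obtain d where d: "\<And>\<omega>. step_integral W \<phi> \<omega> = (\<Sum>k<m. d k * (W (?u (Suc k)) \<omega> - W (?u k) \<omega>))" by blast
  have "indep_vars (\<lambda>_. borel) (\<lambda>i \<omega>. W (?u (Suc i)) \<omega> - W (?u i) \<omega>) {..<m}"
    using indep_increments[of ?u m] u0[of 0] sm by simp
  then have ind: "indep_vars (\<lambda>_. borel) (\<lambda>i \<omega>. d i * (W (?u (Suc i)) \<omega> - W (?u i) \<omega>)) {..<m}"
    by (rule indep_vars_compose2[where Y = "\<lambda>i x. d i * x"]) auto
  have "gauss M (\<lambda>\<omega>. d k * (W (?u (Suc k)) \<omega> - W (?u k) \<omega>)) ((d k)\<^sup>2 * (sqrt (?u (Suc k) - ?u k))\<^sup>2)" if "k < m" for k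
    using sm that u0[of k] by (intro gauss_cmult gauss_normal normal_increments) (auto simp: strict_mono_on_def)
  from gauss_sum_indep[OF ind _ this] show ?thesis unfolding d[abs_def] by auto
qed

text \<open>Sums of Gaussian random variables need not be Gaussian. Gaussianity is therefore never
  propagated by itself, but through membership in this space, which is closed under linear
  combinations and consists of Gaussian variables.\<close>

definition wiener_limit :: "('a \<Rightarrow> real) \<Rightarrow> bool" where
  "wiener_limit U \<longleftrightarrow> sqint M U \<and>
    (\<exists>\<phi> t. (\<forall>j. step_on t (\<phi> j)) \<and> (\<lambda>j::nat. \<integral>\<omega>. (U \<omega> - step_integral W (\<phi> j) \<omega>)\<^sup>2 \<partial>M) \<longlonglongrightarrow> 0)"

lemma wiener_limit_gauss:
  assumes "wiener_limit U"
  shows "gauss M U (\<integral>\<omega>. (U \<omega>)\<^sup>2 \<partial>M)"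
proof -
  from assms obtain \<phi> t where U: "sqint M U" and s: "\<And>j. step_on t (\<phi> j)"
    and l: "(\<lambda>j::nat. \<integral>\<omega>. (U \<omega> - step_integral W (\<phi> j) \<omega>)\<^sup>2 \<partial>M) \<longlonglongrightarrow> 0"
    by (auto simp: wiener_limit_def)
  show ?thesis
    by (rule gauss_limit[OF U sqint_step_integral[OF s] step_integral_gauss[OF s] l])
qed

lemma wiener_limit_zero: "wiener_limit (\<lambda>_. 0)"
  unfolding wiener_limit_def
  by (auto intro!: exI[of _ "\<lambda>_. []"] exI[of _ 0] simp: step_on_def step_integral_Nil)

lemma wiener_limit_wiener_integral: "has_wiener_integral M W f t Y \<Longrightarrow> wiener_limit Y"
  by (rule wiener_integral_approx) (auto simp: wiener_limit_def)

lemma step_integral_append: "step_integral W (\<phi> @ \<psi>) \<omega> = step_integral W \<phi> \<omega> + step_integral W \<psi> \<omega>"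
  by (simp add: step_integral_def)

lemma step_integral_scale: "step_integral W (map (\<lambda>x. (c * fst x, snd x)) \<phi>) \<omega> = c * step_integral W \<phi> \<omega>"
  by (induction \<phi>) (simp_all add: step_integral_Cons step_integral_Nil algebra_simps)

lemma wiener_limit_cmult:
  assumes "wiener_limit U"
  shows "wiener_limit (\<lambda>\<omega>. c * U \<omega>)"
proof -
  from assms obtain \<phi> t where U: "sqint M U" and s: "\<And>j. step_on t (\<phi> j)"
    and l: "(\<lambda>j::nat. \<integral>\<omega>. (U \<omega> - step_integral W (\<phi> j) \<omega>)\<^sup>2 \<partial>M) \<longlonglongrightarrow> 0"
    by (auto simp: wiener_limit_def)
  let ?\<psi> = "\<lambda>j. map (\<lambda>x. (c * fst x, snd x)) (\<phi> j)"
  have "step_on t (?\<psi> j)" for j using s[of j] by (auto simp: step_on_def)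
  moreover have "(\<lambda>j. \<integral>\<omega>. (c * U \<omega> - step_integral W (?\<psi> j) \<omega>)\<^sup>2 \<partial>M) \<longlonglongrightarrow> 0"
    using tendsto_mult_left[OF l, of "c\<^sup>2"]
    by (simp add: step_integral_scale right_diff_distrib[symmetric] power_mult_distrib)
  ultimately show ?thesis using U unfolding wiener_limit_def by (auto intro!: sqint_cmult exI[of _ ?\<psi>])
qed

text \<open>Since the encoding permits overlapping intervals, concatenating the lists adds both the
  step functions and their integrals; the larger of the two horizons accommodates both.\<close>

lemma wiener_limit_add:
  assumes "wiener_limit U" "wiener_limit V"
  shows "wiener_limit (\<lambda>\<omega>. U \<omega> + V \<omega>)"
proof -
  from assms(1) obtain \<phi> t where U: "sqint M U" and s: "\<And>j. step_on t (\<phi> j)"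
    and l: "(\<lambda>j::nat. \<integral>\<omega>. (U \<omega> - step_integral W (\<phi> j) \<omega>)\<^sup>2 \<partial>M) \<longlonglongrightarrow> 0"
    by (auto simp: wiener_limit_def)
  from assms(2) obtain \<psi> t' where V: "sqint M V" and s': "\<And>j. step_on t' (\<psi> j)"
    and l': "(\<lambda>j::nat. \<integral>\<omega>. (V \<omega> - step_integral W (\<psi> j) \<omega>)\<^sup>2 \<partial>M) \<longlonglongrightarrow> 0"
    by (auto simp: wiener_limit_def)
  have st: "step_on (max t t') (\<phi> j @ \<psi> j)" for j
    using step_on_mono[OF s[of j], of "max t t'"] step_on_mono[OF s'[of j], of "max t t'"] by (auto simp: step_on_def)
  let ?A = "\<lambda>j \<omega>. U \<omega> - step_integral W (\<phi> j) \<omega>" and ?B = "\<lambda>j \<omega>. V \<omega> - step_integral W (\<psi> j) \<omega>"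
  have A: "sqint M (?A j)" and B: "sqint M (?B j)" for j
    using U V s s' by (auto intro!: sqint_diff sqint_step_integral)
  have eq: "(U \<omega> + V \<omega> - step_integral W (\<phi> j @ \<psi> j) \<omega>)\<^sup>2 = (?A j \<omega> + ?B j \<omega>)\<^sup>2" for j \<omega>
    by (simp add: step_integral_append algebra_simps)
  have le: "(\<integral>\<omega>. (U \<omega> + V \<omega> - step_integral W (\<phi> j @ \<psi> j) \<omega>)\<^sup>2 \<partial>M) \<le> 2 * (\<integral>\<omega>. (?A j \<omega>)\<^sup>2 \<partial>M) + 2 * (\<integral>\<omega>. (?B j \<omega>)\<^sup>2 \<partial>M)" for j
  proof -
    have i: "integrable M (\<lambda>\<omega>. (?A j \<omega>)\<^sup>2)" "integrable M (\<lambda>\<omega>. (?B j \<omega>)\<^sup>2)" "integrable M (\<lambda>\<omega>. (?A j \<omega> + ?B j \<omega>)\<^sup>2)"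
      using A B sqint_add[OF A B] unfolding sqint_def by blast+
    have "(\<integral>\<omega>. (?A j \<omega> + ?B j \<omega>)\<^sup>2 \<partial>M) \<le> (\<integral>\<omega>. 2 * (?A j \<omega>)\<^sup>2 + 2 * (?B j \<omega>)\<^sup>2 \<partial>M)"
    proof (rule integral_mono)
      show "integrable M (\<lambda>\<omega>. 2 * (?A j \<omega>)\<^sup>2 + 2 * (?B j \<omega>)\<^sup>2)" using i(1,2) by (intro Bochner_Integration.integrable_add integrable_mult_right)
      show "(a + b)\<^sup>2 \<le> 2 * a\<^sup>2 + 2 * b\<^sup>2" for a b :: real
        using sum_squares_bound[of a b] by (simp add: power2_sum)
    qed (rule i(3))
    then show ?thesis using i(1,2) unfolding eq by simp
  qed
  have z: "(\<lambda>j. 2 * (\<integral>\<omega>. (?A j \<omega>)\<^sup>2 \<partial>M) + 2 * (\<integral>\<omega>. (?B j \<omega>)\<^sup>2 \<partial>M)) \<longlonglongrightarrow> 0"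
    using tendsto_add[OF tendsto_mult_left[OF l, of 2] tendsto_mult_left[OF l', of 2]] by simp
  have "(\<lambda>j. \<integral>\<omega>. (U \<omega> + V \<omega> - step_integral W (\<phi> j @ \<psi> j) \<omega>)\<^sup>2 \<partial>M) \<longlonglongrightarrow> 0"
    by (rule Lim_null_comparison[OF _ z]) (use le in simp)
  then show ?thesis using st U V unfolding wiener_limit_def
    by (intro conjI sqint_add exI[of _ "\<lambda>j. \<phi> j @ \<psi> j"] exI[of _ "max t t'"]) auto
qed

lemma wiener_limit_sum: "(\<And>i. i \<in> I \<Longrightarrow> wiener_limit (f i)) \<Longrightarrow> wiener_limit (\<lambda>\<omega>. \<Sum>i\<in>I. f i \<omega>)"
  by (induction I rule: infinite_finite_induct) (auto intro: wiener_limit_add wiener_limit_zero)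

lemma wiener_limit_cong_AE:
  assumes "wiener_limit U" "V \<in> borel_measurable M" "AE \<omega> in M. U \<omega> = V \<omega>"
  shows "wiener_limit V"
proof -
  from assms obtain \<phi> t where U: "sqint M U" and s: "\<And>j. step_on t (\<phi> j)"
    and l: "(\<lambda>j::nat. \<integral>\<omega>. (U \<omega> - step_integral W (\<phi> j) \<omega>)\<^sup>2 \<partial>M) \<longlonglongrightarrow> 0"
    by (auto simp: wiener_limit_def)
  have [measurable]: "U \<in> borel_measurable M" "V \<in> borel_measurable M" "step_integral W (\<phi> j) \<in> borel_measurable M" for j
    using U assms sqint_step_integral[OF s] by (auto simp: sqint_def)
  have "(\<integral>\<omega>. (V \<omega> - step_integral W (\<phi> j) \<omega>)\<^sup>2 \<partial>M) = (\<integral>\<omega>. (U \<omega> - step_integral W (\<phi> j) \<omega>)\<^sup>2 \<partial>M)" for j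
    using assms(3) by (intro integral_cong_AE) auto
  then show ?thesis using s l sqint_cong_AE[OF U assms(2,3)] unfolding wiener_limit_def
    by (intro conjI exI[of _ \<phi>] exI[of _ t]) auto
qed

end

section \<open>Gaussian expectations of functions of exponential growth\<close>

abbreviation "N01 \<equiv> std_normal_distribution"

interpretation N01: real_distribution N01 by (rule real_dist_normal_dist)

lemma integrable_N01_exp_abs: "integrable N01 (\<lambda>z. exp (c * \<bar>z\<bar>))"
proof -
  have e: "integrable N01 (\<lambda>z. exp (c * z))" for c
  proof -
    \<comment> \<open>Completing the square: the exponential tilt of the standard normal density is
      a multiple of the normal density with mean \<open>c\<close>.\<close>
    have "std_normal_density z * exp (c * z) = exp (c\<^sup>2 / 2) * normal_density c 1 z" for z
      by (simp add: normal_density_def exp_add[symmetric] power2_eq_square field_simps)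
    then have "integrable lborel (\<lambda>z. std_normal_density z * exp (c * z))"
      using integrable_normal_density[of 1 c] by simp
    then show ?thesis by (subst integrable_real_density) auto
  qed
  have "integrable N01 (\<lambda>z. exp (c * z) + exp (- c * z))" using e by (intro Bochner_Integration.integrable_add)
  then show ?thesis
  proof (rule Bochner_Integration.integrable_bound)
    have "exp (c * \<bar>z\<bar>) \<le> exp (c * z) + exp (- c * z)" for z by (cases "z < 0") auto
    then have "norm (exp (c * \<bar>z\<bar>)) \<le> norm (exp (c * z) + exp (- c * z))" for z
      by (simp add: abs_of_pos add_pos_pos)
    then show "AE z in N01. norm (exp (c * \<bar>z\<bar>)) \<le> norm (exp (c * z) + exp (- c * z))" by blast
  qed simp
qed

lemma integrable_N01_sq_exp_abs: "integrable N01 (\<lambda>z. z\<^sup>2 * exp (c * \<bar>z\<bar>))"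
proof -
  have "integrable N01 (\<lambda>z. 2 * exp ((c + 1) * \<bar>z\<bar>))" using integrable_N01_exp_abs by simp
  then show ?thesis
  proof (rule Bochner_Integration.integrable_bound)
    have "z\<^sup>2 * exp (c * \<bar>z\<bar>) \<le> 2 * exp ((c + 1) * \<bar>z\<bar>)" for z :: real
    proof -
      have "\<bar>z\<bar>\<^sup>2 / 2 \<le> exp \<bar>z\<bar>" using exp_lower_Taylor_quadratic[of "\<bar>z\<bar>"] by simp
      then have "z\<^sup>2 * exp (c * \<bar>z\<bar>) \<le> (2 * exp \<bar>z\<bar>) * exp (c * \<bar>z\<bar>)" by (intro mult_right_mono) auto
      also have "\<dots> = 2 * exp ((c + 1) * \<bar>z\<bar>)" by (simp add: distrib_right exp_add)
      finally show ?thesis .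
    qed
    then show "AE z in N01. norm (z\<^sup>2 * exp (c * \<bar>z\<bar>)) \<le> norm (2 * exp ((c + 1) * \<bar>z\<bar>))" by auto
  qed simp
qed

text \<open>A concrete realization of a variance increase as an independent Gaussian summand; the
  product space makes the expectation an iterated integral.\<close>

lemma gauss_add_product:
  assumes "0 \<le> v" "0 \<le> w"
  shows "gauss (N01 \<Otimes>\<^sub>M N01) (\<lambda>p. sqrt v * fst p + sqrt w * snd p) (v + w)"
proof -
  interpret P: pair_prob_space N01 N01 ..
  have c: "(\<integral>y. iexp (\<theta> * (s * y)) \<partial>N01) = complex_of_real (exp (- ((\<theta> * s)\<^sup>2) / 2))" for \<theta> s
    using fun_cong[OF char_std_normal_distribution, of "\<theta> * s"] by (simp add: char_def mult.assoc)
  have "char (distr (N01 \<Otimes>\<^sub>M N01) borel (\<lambda>p. sqrt v * fst p + sqrt w * snd p)) \<theta>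
      = complex_of_real (exp (- ((v + w) * \<theta>\<^sup>2) / 2))" for \<theta>
  proof -
    have i: "integrable (N01 \<Otimes>\<^sub>M N01) (\<lambda>p. iexp (\<theta> * (sqrt v * fst p)) * iexp (\<theta> * (sqrt w * snd p)))"
      by (rule P.integrable_const_bound[of _ 1]) (auto simp: norm_mult)
    have "char (distr (N01 \<Otimes>\<^sub>M N01) borel (\<lambda>p. sqrt v * fst p + sqrt w * snd p)) \<theta> =
      (\<integral>p. iexp (\<theta> * (sqrt v * fst p)) * iexp (\<theta> * (sqrt w * snd p)) \<partial>(N01 \<Otimes>\<^sub>M N01))"
      by (simp add: char_def integral_distr exp_add[symmetric] distrib_left)
    also have "\<dots> = (\<integral>x. (\<integral>y. iexp (\<theta> * (sqrt v * x)) * iexp (\<theta> * (sqrt w * y)) \<partial>N01) \<partial>N01)"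
      using P.integral_fst'[OF i] by simp
    also have "\<dots> = complex_of_real (exp (- ((\<theta> * sqrt v)\<^sup>2) / 2)) * complex_of_real (exp (- ((\<theta> * sqrt w)\<^sup>2) / 2))"
      by (simp only: integral_mult_right_zero integral_mult_left_zero c)
    also have "\<dots> = complex_of_real (exp (- ((v + w) * \<theta>\<^sup>2) / 2))"
      using assms by (simp add: exp_add[symmetric] power_mult_distrib algebra_simps add_divide_distrib flip: of_real_mult)
    finally show ?thesis .
  qed
  then show ?thesis using assms by (auto simp: gauss_def)
qed

definition normal_expect :: "(real \<Rightarrow> real) \<Rightarrow> real \<Rightarrow> real \<Rightarrow> real" where
  "normal_expect \<Psi> m v = (\<integral>z. \<Psi> (m + sqrt v * z) \<partial>N01)"

lemma (in prob_space) gauss_expect: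
  assumes "gauss M G v" and [measurable]: "\<Psi> \<in> borel_measurable borel"
  shows "(\<integral>\<omega>. \<Psi> (m + G \<omega>) \<partial>M) = normal_expect \<Psi> m v"
proof -
  have [measurable]: "G \<in> borel_measurable M" using assms by (simp add: gauss_def)
  have "(\<integral>\<omega>. \<Psi> (m + G \<omega>) \<partial>M) = (\<integral>x. \<Psi> (m + x) \<partial>distr M borel G)" by (simp add: integral_distr)
  also have "\<dots> = normal_expect \<Psi> m v"
    unfolding gauss_distr[OF assms(1)] normal_expect_def by (simp add: integral_distr)
  finally show ?thesis .
qed

lemma C_exp_2E:
  assumes "\<Psi> \<in> C_exp 2"
  obtains D where "0 \<le> D" "\<And>x. \<bar>\<Psi> x\<bar> \<le> D * exp (D * \<bar>x\<bar>)" "\<And>x. \<bar>deriv \<Psi> x\<bar> \<le> D * exp (D * \<bar>x\<bar>)"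
    "\<And>x. \<bar>deriv (deriv \<Psi>) x\<bar> \<le> D * exp (D * \<bar>x\<bar>)"
    "\<And>x. (\<Psi> has_real_derivative deriv \<Psi> x) (at x)"
    "\<And>x. (deriv \<Psi> has_real_derivative deriv (deriv \<Psi>) x) (at x)"
proof -
  have d: "\<forall>k<2. \<forall>x. (deriv ^^ k) \<Psi> differentiable (at x)"
    and b: "\<forall>k\<le>2. \<exists>C\<ge>0. \<forall>x. \<bar>(deriv ^^ k) \<Psi> x\<bar> \<le> C * exp (C * \<bar>x\<bar>)"
    using assms by (auto simp: C_exp_def)
  obtain C0 where C0: "0 \<le> C0" "\<And>x. \<bar>\<Psi> x\<bar> \<le> C0 * exp (C0 * \<bar>x\<bar>)" using b[rule_format, of 0] by auto
  obtain C1 where C1: "0 \<le> C1" "\<And>x. \<bar>deriv \<Psi> x\<bar> \<le> C1 * exp (C1 * \<bar>x\<bar>)" using b[rule_format, of 1] by auto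
  obtain C2 where C2: "0 \<le> C2" "\<And>x. \<bar>deriv (deriv \<Psi>) x\<bar> \<le> C2 * exp (C2 * \<bar>x\<bar>)"
    using b[rule_format, of 2] by (auto simp: numeral_2_eq_2)
  \<comment> \<open>\<open>c * exp (c * \<bar>x\<bar>)\<close> increases with
    \<open>c \<ge> 0\<close>, so the sum of the three constants serves all three orders.\<close>
  define D where "D = C0 + C1 + C2"
  have mono: "c * exp (c * \<bar>x\<bar>) \<le> D * exp (D * \<bar>x\<bar>)" if "0 \<le> c" "c \<le> D" for c x
    using that by (intro mult_mono) (auto intro!: mult_right_mono)
  have le: "C0 \<le> D" "C1 \<le> D" "C2 \<le> D" "0 \<le> D" using C0 C1 C2 by (auto simp: D_def)
  have der: "(\<Psi> has_real_derivative deriv \<Psi> x) (at x)" "(deriv \<Psi> has_real_derivative deriv (deriv \<Psi>) x) (at x)" for x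
    using d[rule_format, of 0 x] d[rule_format, of 1 x]
    by (auto simp: real_differentiable_def DERIV_imp_deriv)
  show thesis
    using that[OF le(4) order.trans[OF C0(2) mono] order.trans[OF C1(2) mono] order.trans[OF C2(2) mono] der] le C0(1) C1(1) C2(1)
    by auto
qed

text \<open>Comparing the arguments \<open>m + sqrt v * z\<close> directly would be only Hoelder
  continuous of order 1/2 in \<open>v\<close> near 0 and would halve the rate for small variances;
  this is why two derivatives of \<Psi> are used. The bound \<open>B\<close> on means and variances
  makes the constant uniform.\<close>

lemma normal_expect_lipschitz:
  assumes "\<Psi> \<in> C_exp 2" "0 \<le> B"
  obtains C where "0 \<le> C"
    "\<And>m m' v v'. \<bar>m\<bar> \<le> B \<Longrightarrow> \<bar>m'\<bar> \<le> B \<Longrightarrow> 0 \<le> v \<Longrightarrow> v \<le> B \<Longrightarrow> 0 \<le> v' \<Longrightarrow> v' \<le> B \<Longrightarrow>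
      \<bar>normal_expect \<Psi> m v - normal_expect \<Psi> m' v'\<bar> \<le> C * (\<bar>m - m'\<bar> + \<bar>v - v'\<bar>)"
proof -
  obtain D where D: "0 \<le> D" "\<And>x. \<bar>\<Psi> x\<bar> \<le> D * exp (D * \<bar>x\<bar>)" "\<And>x. \<bar>deriv \<Psi> x\<bar> \<le> D * exp (D * \<bar>x\<bar>)"
    "\<And>x. \<bar>deriv (deriv \<Psi>) x\<bar> \<le> D * exp (D * \<bar>x\<bar>)"
    and der: "\<And>x. (\<Psi> has_real_derivative deriv \<Psi> x) (at x)"
    "\<And>x. (deriv \<Psi> has_real_derivative deriv (deriv \<Psi>) x) (at x)"
    by (fact C_exp_2E[OF assms(1)])
  have [measurable]: "\<Psi> \<in> borel_measurable borel"
    using der(1) by (intro borel_measurable_continuous_onI continuous_at_imp_continuous_on) (auto intro: DERIV_isCont)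
  have int: "integrable N01 (\<lambda>z. \<Psi> (a + s * z))" for a s
  proof (rule Bochner_Integration.integrable_bound)
    show "integrable N01 (\<lambda>z. D * exp (D * \<bar>a\<bar>) * exp ((D * \<bar>s\<bar>) * \<bar>z\<bar>))"
      using integrable_N01_exp_abs by simp
    have "\<bar>\<Psi> (a + s * z)\<bar> \<le> D * exp (D * \<bar>a\<bar>) * exp ((D * \<bar>s\<bar>) * \<bar>z\<bar>)" for z
    proof -
      have "\<bar>\<Psi> (a + s * z)\<bar> \<le> D * exp (D * (\<bar>a\<bar> + \<bar>s\<bar> * \<bar>z\<bar>))"
        using D(1) abs_triangle_ineq[of a "s * z"] by (intro order.trans[OF D(2)] mult_left_mono) (auto simp: abs_mult intro!: mult_left_mono)
      then show ?thesis by (simp add: distrib_left exp_add mult.assoc)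
    qed
    then show "AE z in N01. norm (\<Psi> (a + s * z)) \<le> norm (D * exp (D * \<bar>a\<bar>) * exp ((D * \<bar>s\<bar>) * \<bar>z\<bar>))"
      using D(1) by auto
  qed simp
  have lip: "\<bar>\<Psi> x - \<Psi> y\<bar> \<le> D * exp (D * r) * \<bar>x - y\<bar>" if "\<bar>x\<bar> \<le> r" "\<bar>y\<bar> \<le> r" for x y r
  proof -
    have "norm (\<Psi> x - \<Psi> y) \<le> (D * exp (D * r)) * norm (x - y)"
    proof (rule field_differentiable_bound[where S = "{-r..r}"])
      show "norm (deriv \<Psi> z) \<le> D * exp (D * r)" if "z \<in> {-r..r}" for z
      proof -
        have "D * exp (D * \<bar>z\<bar>) \<le> D * exp (D * r)" using that D(1) by (auto intro!: mult_left_mono)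
        then show ?thesis using D(3)[of z] by simp
      qed
    qed (use that in \<open>auto intro: has_field_derivative_at_within der\<close>)
    then show ?thesis by simp
  qed
  \<comment> \<open>The second derivative is bounded on the ball of radius |a| + |b|, which contains
    the segment from a to a + b. This keeps the bound exponential in both arguments and therefore
    integrable against the Gaussian weight.\<close>
  have taylor: "\<bar>\<Psi> (a + b) - \<Psi> a - b * deriv \<Psi> a\<bar> \<le> D * exp (D * (\<bar>a\<bar> + \<bar>b\<bar>)) * b\<^sup>2" for a b
  proof -
    let ?r = "\<bar>a\<bar> + \<bar>b\<bar>"
    have "norm (\<Psi> (a + b) - (\<Sum>i\<le>1. (deriv ^^ i) \<Psi> a * (a + b - a) ^ i / fact i))
       \<le> D * exp (D * ?r) * norm (a + b - a) ^ Suc 1 / fact 1"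
    proof (rule field_Taylor[where S = "{-?r..?r}" and f = "\<lambda>i. (deriv ^^ i) \<Psi>" and n = 1, unfolded funpow_0])
      show "((deriv ^^ i) \<Psi> has_field_derivative (deriv ^^ Suc i) \<Psi> x) (at x within {-?r..?r})" if "i \<le> 1" for i x
        using that has_field_derivative_at_within[OF der(1)[of x]] has_field_derivative_at_within[OF der(2)[of x]]
        by (cases "i = 0") (simp_all add: le_Suc_eq)
      show "norm ((deriv ^^ Suc 1) \<Psi> x) \<le> D * exp (D * ?r)" if "x \<in> {-?r..?r}" for x
      proof -
        have "D * exp (D * \<bar>x\<bar>) \<le> D * exp (D * ?r)" using that D(1) by (auto intro!: mult_left_mono)
        then show ?thesis using D(4)[of x] by simp
      qed
    qed auto
    then show ?thesis by (simp add: algebra_simps power2_eq_square)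
  qed
  \<comment> \<open>With |m + sqrt v z| at most B + sqrt B |z|, the exponential growth bound splits
    into the deterministic factor \<open>E\<close> and an exponential in |z|. \<open>Q1\<close> is
    the moment for first-order terms and for the outer integral, \<open>Q2\<close> the one for the
    quadratic remainder.\<close>
  define Q1 where "Q1 = (\<integral>z. exp ((D * sqrt B) * \<bar>z\<bar>) \<partial>N01)"
  define Q2 where "Q2 = (\<integral>z. z\<^sup>2 * exp ((D * sqrt B) * \<bar>z\<bar>) \<partial>N01)"
  define E where "E = D * exp (D * B)"
  have Q: "0 \<le> Q1" "0 \<le> Q2" "0 \<le> E" using D(1) by (auto simp: Q1_def Q2_def E_def intro!: Bochner_Integration.integral_nonneg)
  have absle: "\<bar>m + sqrt v * z\<bar> \<le> B + sqrt B * \<bar>z\<bar>" if "\<bar>m\<bar> \<le> B" "0 \<le> v" "v \<le> B" for m v z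
  proof -
    have "\<bar>m + sqrt v * z\<bar> \<le> \<bar>m\<bar> + \<bar>sqrt v\<bar> * \<bar>z\<bar>" using abs_triangle_ineq[of m "sqrt v * z"] by (simp add: abs_mult)
    also have "\<dots> \<le> B + sqrt B * \<bar>z\<bar>" using that assms(2)
      by (intro add_mono mult_right_mono) auto
    finally show ?thesis .
  qed
  have means: "\<bar>normal_expect \<Psi> m v - normal_expect \<Psi> m' v\<bar> \<le> (E * Q1) * \<bar>m - m'\<bar>"
    if H: "\<bar>m\<bar> \<le> B" "\<bar>m'\<bar> \<le> B" "0 \<le> v" "v \<le> B" for m m' v
  proof -
    have "\<bar>normal_expect \<Psi> m v - normal_expect \<Psi> m' v\<bar> = \<bar>\<integral>z. \<Psi> (m + sqrt v * z) - \<Psi> (m' + sqrt v * z) \<partial>N01\<bar>"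
      unfolding normal_expect_def using int by (subst Bochner_Integration.integral_diff) auto
    also have "\<dots> \<le> (\<integral>z. E * \<bar>m - m'\<bar> * exp ((D * sqrt B) * \<bar>z\<bar>) \<partial>N01)"
    proof (rule integral_abs_bound[THEN order.trans], rule integral_mono)
      fix z
      have "\<bar>\<Psi> (m + sqrt v * z) - \<Psi> (m' + sqrt v * z)\<bar> \<le> D * exp (D * (B + sqrt B * \<bar>z\<bar>)) * \<bar>(m + sqrt v * z) - (m' + sqrt v * z)\<bar>"
        using H by (intro lip absle)
      then show "\<bar>\<Psi> (m + sqrt v * z) - \<Psi> (m' + sqrt v * z)\<bar> \<le> E * \<bar>m - m'\<bar> * exp ((D * sqrt B) * \<bar>z\<bar>)"
        by (simp add: E_def distrib_left exp_add mult_ac)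
    qed (use int integrable_N01_exp_abs in auto)
    also have "\<dots> = (E * Q1) * \<bar>m - m'\<bar>" by (simp add: Q1_def)
    finally show ?thesis .
  qed
  have vars: "\<bar>normal_expect \<Psi> m (v + w) - normal_expect \<Psi> m v\<bar> \<le> (E * Q2 * Q1) * w"
    if H: "\<bar>m\<bar> \<le> B" "0 \<le> v" "0 \<le> w" "v + w \<le> B" for m v w
  proof -
    interpret P: pair_prob_space N01 N01 ..
    let ?U = "\<lambda>p. sqrt v * fst p + sqrt w * snd p"
    have g: "gauss (N01 \<Otimes>\<^sub>M N01) ?U (v + w)" using H by (intro gauss_add_product)
    have gd: "distr (N01 \<Otimes>\<^sub>M N01) borel ?U = distr N01 borel (\<lambda>z. sqrt (v + w) * z)"
      using P.gauss_distr[OF g] .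
    have "integrable (distr N01 borel (\<lambda>z. sqrt (v + w) * z)) (\<lambda>x. \<Psi> (m + x))"
      using int by (subst integrable_distr_eq) auto
    then have i: "integrable (N01 \<Otimes>\<^sub>M N01) (\<lambda>p. \<Psi> (m + ?U p))"
      unfolding gd[symmetric] by (subst (asm) integrable_distr_eq) auto
    have "normal_expect \<Psi> m (v + w) = (\<integral>p. \<Psi> (m + ?U p) \<partial>(N01 \<Otimes>\<^sub>M N01))"
      using P.gauss_expect[OF g] by simp
    also have "\<dots> = (\<integral>x. (\<integral>y. \<Psi> (m + sqrt v * x + sqrt w * y) \<partial>N01) \<partial>N01)"
      using P.integral_fst'[OF i] by (simp add: add.assoc)
    finally have eq: "normal_expect \<Psi> m (v + w) = (\<integral>x. (\<integral>y. \<Psi> (m + sqrt v * x + sqrt w * y) \<partial>N01) \<partial>N01)" .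
    have i2: "integrable N01 (\<lambda>x. \<integral>y. \<Psi> (m + sqrt v * x + sqrt w * y) \<partial>N01)"
      using P.integrable_fst'[OF i] by (simp add: add.assoc)
    have inner: "\<bar>(\<integral>y. \<Psi> (a + sqrt w * y) \<partial>N01) - \<Psi> a\<bar> \<le> w * D * exp (D * \<bar>a\<bar>) * Q2" for a
    proof -
      have iy: "integrable N01 (\<lambda>y. sqrt w * y * deriv \<Psi> a)"
        using integrable_std_normal_distribution_moment[of 1] by simp
      have "(\<integral>y. sqrt w * y * deriv \<Psi> a \<partial>N01) = 0"
        using integral_std_normal_distribution_moment_odd[of 1] by simp
      then have eq: "(\<integral>y. \<Psi> (a + sqrt w * y) \<partial>N01) - \<Psi> a =
          (\<integral>y. \<Psi> (a + sqrt w * y) - \<Psi> a - sqrt w * y * deriv \<Psi> a \<partial>N01)"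
        using int iy N01.prob_space by simp
      have "\<bar>\<integral>y. \<Psi> (a + sqrt w * y) - \<Psi> a - sqrt w * y * deriv \<Psi> a \<partial>N01\<bar> \<le> (\<integral>y. w * D * exp (D * \<bar>a\<bar>) * (y\<^sup>2 * exp ((D * sqrt B) * \<bar>y\<bar>)) \<partial>N01)"
      proof (rule integral_abs_bound[THEN order.trans], rule integral_mono)
        fix y
        have "\<bar>sqrt w * y\<bar> \<le> sqrt B * \<bar>y\<bar>" using H by (simp add: abs_mult mult_right_mono)
        then have "D * exp (D * (\<bar>a\<bar> + \<bar>sqrt w * y\<bar>)) * (sqrt w * y)\<^sup>2 \<le> D * exp (D * (\<bar>a\<bar> + sqrt B * \<bar>y\<bar>)) * (sqrt w * y)\<^sup>2"
          using D(1) by (intro mult_right_mono mult_left_mono) (auto intro!: mult_left_mono)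
        from order.trans[OF taylor this]
        show "\<bar>\<Psi> (a + sqrt w * y) - \<Psi> a - sqrt w * y * deriv \<Psi> a\<bar> \<le> w * D * exp (D * \<bar>a\<bar>) * (y\<^sup>2 * exp ((D * sqrt B) * \<bar>y\<bar>))"
          using H by (simp add: distrib_left exp_add power_mult_distrib mult_ac)
      qed (use int iy integrable_N01_sq_exp_abs in auto)
      also have "\<dots> = w * D * exp (D * \<bar>a\<bar>) * Q2" by (simp add: Q2_def)
      finally show ?thesis unfolding eq .
    qed
    have "\<bar>normal_expect \<Psi> m (v + w) - normal_expect \<Psi> m v\<bar> =
       \<bar>\<integral>x. (\<integral>y. \<Psi> (m + sqrt v * x + sqrt w * y) \<partial>N01) - \<Psi> (m + sqrt v * x) \<partial>N01\<bar>"
      unfolding eq using int i2 by (subst Bochner_Integration.integral_diff) (auto simp: normal_expect_def)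
    also have "\<dots> \<le> (\<integral>x. w * E * Q2 * exp ((D * sqrt B) * \<bar>x\<bar>) \<partial>N01)"
    proof (rule integral_abs_bound[THEN order.trans], rule integral_mono)
      fix x
      have "w * D * exp (D * \<bar>m + sqrt v * x\<bar>) * Q2 \<le> w * D * exp (D * (B + sqrt B * \<bar>x\<bar>)) * Q2"
        using D(1) H Q absle[of m v x] by (intro mult_right_mono mult_left_mono) (auto intro!: mult_left_mono)
      from order.trans[OF inner this]
      show "\<bar>(\<integral>y. \<Psi> (m + sqrt v * x + sqrt w * y) \<partial>N01) - \<Psi> (m + sqrt v * x)\<bar> \<le> w * E * Q2 * exp ((D * sqrt B) * \<bar>x\<bar>)"
        by (simp add: E_def distrib_left exp_add mult_ac)
    qed (use int i2 integrable_N01_exp_abs in auto)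
    also have "\<dots> = (E * Q2 * Q1) * w" by (simp add: Q1_def)
    finally show ?thesis .
  qed
  define C where "C = E * Q1 + E * Q2 * Q1"
  have C: "0 \<le> C" "E * Q1 \<le> C" "E * Q2 * Q1 \<le> C" using Q by (auto simp: C_def)
  have vars': "\<bar>normal_expect \<Psi> m v - normal_expect \<Psi> m v'\<bar> \<le> (E * Q2 * Q1) * \<bar>v - v'\<bar>"
    if H: "\<bar>m\<bar> \<le> B" "0 \<le> v" "v \<le> B" "0 \<le> v'" "v' \<le> B" for m v v'
    using vars[of m v "v' - v"] vars[of m v' "v - v'"] H by (cases "v \<le> v'") (auto simp: abs_minus_commute)
  have "\<bar>normal_expect \<Psi> m v - normal_expect \<Psi> m' v'\<bar> \<le> C * (\<bar>m - m'\<bar> + \<bar>v - v'\<bar>)"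
    if H: "\<bar>m\<bar> \<le> B" "\<bar>m'\<bar> \<le> B" "0 \<le> v" "v \<le> B" "0 \<le> v'" "v' \<le> B" for m m' v v'
  proof -
    have "\<bar>normal_expect \<Psi> m v - normal_expect \<Psi> m' v\<bar> \<le> C * \<bar>m - m'\<bar>"
      using means[of m m' v] H mult_right_mono[OF C(2), of "\<bar>m - m'\<bar>"] by simp
    moreover have "\<bar>normal_expect \<Psi> m' v - normal_expect \<Psi> m' v'\<bar> \<le> C * \<bar>v - v'\<bar>"
      using vars'[of m' v v'] H mult_right_mono[OF C(3), of "\<bar>v - v'\<bar>"] by simp
    ultimately show ?thesis by (simp add: distrib_left)
  qed
  from that[OF C(1) this] show thesis .
qed

section \<open>The fractional kernel and its resolvent\<close>

text \<open>The cutoff at 0 builds causality into the kernel: convolutions over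
  \<open>{0..t}\<close> become integrals over a set that does not depend on \<open>t\<close>, and no
  value of \<open>powr\<close> at or below 0 ever enters.\<close>

definition tpow :: "real \<Rightarrow> real \<Rightarrow> real" where
  "tpow p x = (if 0 < x then x powr p else 0)"

lemma tpow_nonneg [simp]: "0 \<le> tpow p x"
  by (simp add: tpow_def)

lemma tpow_measurable [measurable]: "tpow p \<in> borel_measurable borel"
  unfolding tpow_def by measurable

text \<open>Euler's Beta integral, carried from the unit interval to the one between
  \<open>r\<close> and \<open>t\<close> by x = (s - r) / (t - r). It expresses the semigroup
  property of fractional kernels. If \<open>t \<le> r\<close> the two supports are disjoint.\<close>

lemma has_bochner_integral_tpow_conv:
  fixes a b r t :: real
  assumes "0 < a" "0 < b"
  shows "has_bochner_integral lborel (\<lambda>s. tpow (a - 1) (t - s) * tpow (b - 1) (s - r))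
           (Beta a b * tpow (a + b - 1) (t - r))"
proof (cases "r < t")
  case False
  then have "(\<lambda>s. tpow (a - 1) (t - s) * tpow (b - 1) (s - r)) = (\<lambda>_. 0)"
    by (auto simp: tpow_def)
  then show ?thesis using False by (simp add: tpow_def has_bochner_integral_zero)
next
  case True
  let ?f = "\<lambda>x. tpow (a - 1) (1 - x) * tpow (b - 1) x"
  have "((\<lambda>t. t powr (b - 1) * (1 - t) powr (a - 1)) has_integral Beta b a) {0..1}"
    using has_integral_Beta_real[of b a] assms by simp
  from nn_integral_has_integral_lebesgue[OF _ this]
  have "(\<integral>\<^sup>+x. ennreal ((x powr (b - 1) * (1 - x) powr (a - 1)) * indicator {0..1} x) \<partial>lborel)
      = ennreal (Beta b a)" by (simp add: mult_ac)
  moreover have "(\<integral>\<^sup>+x. ennreal ((x powr (b - 1) * (1 - x) powr (a - 1)) * indicator {0..1} x) \<partial>lborel)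
      = (\<integral>\<^sup>+x. ennreal (?f x) \<partial>lborel)"
  proof (rule nn_integral_cong_AE)
    have "AE x in lborel. x \<noteq> (0::real) \<and> x \<noteq> 1"
      using AE_lborel_singleton by auto
    then show "AE x in lborel. ennreal ((x powr (b - 1) * (1 - x) powr (a - 1)) * indicator {0..1} x)
        = ennreal (?f x)"
      by eventually_elim (auto simp: tpow_def indicator_def)
  qed
  ultimately have "has_bochner_integral lborel ?f (Beta b a)"
    using assms by (intro has_bochner_integral_nn_integral) (auto simp: Beta_def)
  then have "has_bochner_integral lborel (\<lambda>x. ?f ((x - r) / (t - r))) (Beta b a * (t - r))"
  proof (subst lborel_has_bochner_integral_real_affine_iff[where c = "t - r" and t = r])
    have "(r + (t - r) * x - r) / (t - r) = x" for x using True by simp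
    moreover have "Beta b a * (t - r) /\<^sub>R \<bar>t - r\<bar> = Beta b a" using True by simp
    ultimately show "has_bochner_integral lborel ?f (Beta b a) \<Longrightarrow>
        has_bochner_integral lborel (\<lambda>x. ?f ((r + (t - r) * x - r) / (t - r)))
         (Beta b a * (t - r) /\<^sub>R \<bar>t - r\<bar>)" by (simp only:)
  qed (use True in simp)
  then have "has_bochner_integral lborel (\<lambda>x. (t - r) powr (a + b - 2) * ?f ((x - r) / (t - r)))
      ((t - r) powr (a + b - 2) * (Beta b a * (t - r)))"
    by (rule has_bochner_integral_mult_right)
  moreover have "(t - r) powr (a + b - 2) * ?f ((x - r) / (t - r)) =
      tpow (a - 1) (t - x) * tpow (b - 1) (x - r)" for x
  proof -
    have 1: "1 - (x - r) / (t - r) = (t - x) / (t - r)"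
      using True by (auto simp: field_simps)
    have 2: "(t - r) powr (a + b - 2) = (t - r) powr (a - 1) * (t - r) powr (b - 1)"
      by (simp add: powr_add[symmetric] algebra_simps)
    have 3: "tpow p ((t - r) * y) = (t - r) powr p * tpow p y" for p y
      using True by (auto simp: tpow_def powr_mult zero_less_mult_iff)
    show ?thesis unfolding 1 2 using 3[of "a - 1" "(t - x) / (t - r)"] 3[of "b - 1" "(x - r) / (t - r)"] True
      by simp
  qed
  moreover have "(t - r) powr (a + b - 2) * (Beta b a * (t - r)) = Beta a b * tpow (a + b - 1) (t - r)"
  proof -
    have "(t - r) powr (a + b - 2) * (Beta b a * (t - r)) = Beta b a * ((t - r) * (t - r) powr (a + b - 2))"
      by (simp only: mult_ac)
    also have "(t - r) * (t - r) powr (a + b - 2) = tpow (a + b - 1) (t - r)"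
      using True powr_mult_base[of "t - r" "a + b - 2"] by (simp add: tpow_def)
    finally show ?thesis by (simp add: Beta_commute)
  qed
  ultimately show ?thesis by simp
qed

text \<open>On \<open>{A..}\<close> the integrand of the Gamma integral is at least
  \<open>A powr (x - 1) * exp (- t)\<close>. As \<open>A\<close> is free, Gamma grows faster than
  any geometric sequence, which is what the convergence of the resolvent series rests on.\<close>

lemma powr_times_exp_le_Gamma:
  fixes x A :: real
  assumes "1 \<le> x" "0 < A"
  shows "A powr (x - 1) * exp (- A) \<le> Gamma x"
proof -
  have "((\<lambda>t. exp (- 1 * t)) has_integral exp (- 1 * A) / 1) {A..}"
    by (rule has_integral_exp_minus_to_infinity) simp
  from has_integral_mult_right[OF this, of "A powr (x - 1)"]
  have "((\<lambda>t. A powr (x - 1) * exp (- t)) has_integral A powr (x - 1) * exp (- A)) {A..}"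
    by simp
  then have "((\<lambda>t. if t \<in> {A..} then A powr (x - 1) * exp (- t) else 0) has_integral
      A powr (x - 1) * exp (- A)) {0..}"
    using assms by (subst has_integral_restrict) auto
  moreover have "((\<lambda>t. t powr (x - 1) / exp t) has_integral Gamma x) {0..}"
    using assms by (intro Gamma_integral_real) auto
  ultimately show ?thesis
    using assms by (elim has_integral_le) (auto simp: exp_minus field_simps intro!: powr_mono2)
qed

text \<open>The locale holds the deterministic part of the argument, so every constant obtained in
  it depends only on \<open>\<alpha>\<close>, \<open>\<kappa>\<close> and \<open>T\<close>. The sign
  of \<open>\<kappa>\<close> is arbitrary; the instance with \<open>\<bar>\<kappa>\<bar>\<close>
  later provides absolute convergence.\<close>

locale fractional =
  fixes \<alpha> \<kappa> T :: real
  assumes alpha_gt: "1 / 2 < \<alpha>" and alpha_le: "\<alpha> \<le> 1" and T_pos: "0 < T"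
begin

definition K :: "real \<Rightarrow> real" where "K x = tpow (\<alpha> - 1) x / Gamma \<alpha>"

lemma Gamma_alpha_pos [simp]: "0 < Gamma \<alpha>" using alpha_gt by (intro Gamma_real_pos) auto

lemma K_nonneg [simp]: "0 \<le> K x" by (simp add: K_def Gamma_alpha_pos less_imp_le)

lemma K_measurable [measurable]: "K \<in> borel_measurable borel" unfolding K_def by measurable

text \<open>The coefficients of the two-parameter Mittag-Leffler function with both parameters equal
  to \<alpha>.\<close>

definition mlc :: "nat \<Rightarrow> real" where "mlc j = 1 / Gamma (real (Suc j) * \<alpha>)"

lemma mlc_pos: "0 < mlc j"
  unfolding mlc_def using alpha_gt by (intro divide_pos_pos Gamma_real_pos mult_pos_pos) auto

lemma summable_mlc: "summable (\<lambda>j. mlc j * z ^ j)"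
proof -
  \<comment> \<open>\<open>A\<close> is chosen such that
    \<open>A powr \<alpha> = 2 * (\<bar>z\<bar> + 1)\<close>; the lower bound on Gamma then
    dominates the series by a geometric one of ratio 1/2.\<close>
  define A where "A = (2 * (\<bar>z\<bar> + 1)) powr (1 / \<alpha>)"
  have A: "0 < A" "A powr \<alpha> = 2 * (\<bar>z\<bar> + 1)" using alpha_gt by (auto simp: A_def powr_powr)
  let ?D = "exp A * A powr (1 - \<alpha>)"
  show ?thesis
  proof (rule summable_comparison_test_ev)
    show "summable (\<lambda>j. ?D * (1 / 2) ^ j)"
      by (intro summable_mult summable_geometric) auto
    show "\<forall>\<^sub>F j in sequentially. norm (mlc j * z ^ j) \<le> ?D * (1 / 2) ^ j"
      using eventually_ge_at_top[of 1]
    proof eventually_elim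
      case (elim j)
      \<comment> \<open>The bound on Gamma is stated for arguments from 1 on; as \<alpha> > 1/2,
        only the term of index 0 can fall below that.\<close>
      have "1 \<le> real (Suc j) * \<alpha>" using alpha_gt elim mult_mono[of 2 "real (Suc j)" "1/2" \<alpha>] by auto
      note le = powr_times_exp_le_Gamma[OF this A(1)]
      have "mlc j \<le> 1 / (A powr (real (Suc j) * \<alpha> - 1) * exp (- A))"
        unfolding mlc_def using A by (intro divide_left_mono le mult_pos_pos order.strict_trans2[OF _ le]) auto
      also have "\<dots> = exp A * (A powr (1 - \<alpha>) * A powr (- (real j * \<alpha>)))"
        using A(1) by (simp add: powr_diff powr_minus powr_add exp_minus field_simps)
      also have "A powr (- (real j * \<alpha>)) = (A powr \<alpha>) powr - real j"
        by (simp add: powr_powr mult_ac)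
      also have "\<dots> = 1 / (A powr \<alpha>) ^ j"
        using A by (simp add: powr_minus powr_realpow divide_inverse)
      finally have "mlc j \<le> ?D / (2 * (\<bar>z\<bar> + 1)) ^ j" by (simp add: A)
      then have "norm (mlc j * z ^ j) \<le> (?D / (2 * (\<bar>z\<bar> + 1)) ^ j) * \<bar>z\<bar> ^ j"
        using mlc_pos[of j] by (simp only: real_norm_def abs_mult power_abs abs_of_pos) (intro mult_right_mono; simp)
      also have "\<dots> \<le> (?D / (2 * (\<bar>z\<bar> + 1)) ^ j) * (\<bar>z\<bar> + 1) ^ j"
        by (intro mult_left_mono power_mono) auto
      also have "\<dots> = ?D * (1 / 2) ^ j"
        by (simp only: power_mult_distrib power_divide) (simp add: add_nonneg_pos less_imp_neq[symmetric])
      finally show ?case .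
    qed
  qed
qed

definition mlf :: "real \<Rightarrow> real" where "mlf z = (\<Sum>j. mlc j * z ^ j)"
definition mlf' :: "real \<Rightarrow> real" where "mlf' z = (\<Sum>j. diffs mlc j * z ^ j)"

lemma DERIV_mlf: "DERIV mlf z :> mlf' z"
  using termdiffs_strong_converges_everywhere[of mlc z] summable_mlc
  unfolding mlf_def mlf'_def by blast

lemma isCont_mlf: "isCont mlf z" using DERIV_mlf DERIV_isCont by blast

lemma isCont_mlf': "isCont mlf' z"
proof -
  have "summable (\<lambda>j. diffs mlc j * (\<bar>z\<bar> + 1) ^ j)"
    using termdiff_converges_all[of mlc] summable_mlc by blast
  then show ?thesis unfolding mlf'_def by (intro isCont_powser) auto
qed

text \<open>This is \<open>\<kappa> ^ j\<close> times the convolution power of \<open>K\<close> with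
  \<open>Suc j\<close> factors, so summing over \<open>j\<close> gives the Neumann series of the
  resolvent.\<close>

definition rterm :: "nat \<Rightarrow> real \<Rightarrow> real" where
  "rterm j x = \<kappa> ^ j * mlc j * tpow (real (Suc j) * \<alpha> - 1) x"

definition R :: "real \<Rightarrow> real" where "R x = (\<Sum>j. rterm j x)"

lemma rterm_pos: "0 < x \<Longrightarrow> rterm j x = x powr (\<alpha> - 1) * (mlc j * (\<kappa> * x powr \<alpha>) ^ j)"
proof -
  assume x: "0 < x"
  have "x powr (real (Suc j) * \<alpha> - 1) = x powr (\<alpha> - 1) * (x powr \<alpha>) ^ j"
    using x by (simp add: powr_powr powr_add[symmetric] algebra_simps flip: powr_realpow)
  then show ?thesis using x by (simp add: rterm_def tpow_def power_mult_distrib)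
qed

lemma summable_abs_rterm: "summable (\<lambda>j. \<bar>rterm j x\<bar>)"
proof (cases "0 < x")
  case True
  have "\<bar>rterm j x\<bar> = x powr (\<alpha> - 1) * (mlc j * (\<bar>\<kappa>\<bar> * x powr \<alpha>) ^ j)" for j
    using True mlc_pos[of j] by (simp add: rterm_pos abs_mult power_abs)
  then show ?thesis using summable_mlc by (simp add: summable_mult)
qed (simp add: rterm_def tpow_def)

lemma R_nonpos: "x \<le> 0 \<Longrightarrow> R x = 0"
  by (simp add: R_def rterm_def tpow_def)

lemma R_pos: "0 < x \<Longrightarrow> R x = x powr (\<alpha> - 1) * mlf (\<kappa> * x powr \<alpha>)"
  unfolding R_def mlf_def using summable_mlc by (simp add: rterm_pos suminf_mult)

lemma R_measurable [measurable]: "R \<in> borel_measurable borel"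
proof -
  have [measurable]: "mlf \<in> borel_measurable borel"
    by (intro borel_measurable_continuous_onI continuous_at_imp_continuous_on ballI isCont_mlf)
  have "R = (\<lambda>x. if 0 < x then x powr (\<alpha> - 1) * mlf (\<kappa> * x powr \<alpha>) else 0)"
    by (auto simp: R_pos R_nonpos)
  then show ?thesis by simp
qed

text \<open>Differentiate \<open>x powr (\<alpha> - 1) * mlf (\<kappa> * x powr \<alpha>)\<close>.
  The power yields the first term with its factor \<open>1 - \<alpha>\<close>, which is kept because
  it is needed to integrate that term uniformly up to \<alpha> = 1; the entire function yields the
  second. The bound decreases in \<open>x\<close>, so the intermediate point of the mean value
  theorem may be replaced by the left end.\<close>

lemma R_bounds:
  obtains C where "0 < C"
    "\<And>x. 0 < x \<Longrightarrow> x \<le> T \<Longrightarrow> \<bar>R x\<bar> \<le> C * x powr (\<alpha> - 1)"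
    "\<And>x y. 0 < x \<Longrightarrow> x \<le> y \<Longrightarrow> y \<le> T \<Longrightarrow>
      \<bar>R y - R x\<bar> \<le> C * ((1 - \<alpha>) * x powr (\<alpha> - 2) + x powr (2 * \<alpha> - 2)) * (y - x)"
proof -
  define Z where "Z = \<bar>\<kappa>\<bar> * T powr \<alpha>"
  have "bounded (mlf ` {-Z..Z})" "bounded (mlf' ` {-Z..Z})"
    by (intro compact_imp_bounded compact_continuous_image continuous_at_imp_continuous_on ballI
        isCont_mlf isCont_mlf' compact_Icc)+
  then obtain B1 B2 where B: "\<And>z. \<bar>z\<bar> \<le> Z \<Longrightarrow> \<bar>mlf z\<bar> \<le> B1" "\<And>z. \<bar>z\<bar> \<le> Z \<Longrightarrow> \<bar>mlf' z\<bar> \<le> B2"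
    unfolding bounded_iff by (force simp: abs_le_iff)
  have Z: "0 \<le> Z" by (simp add: Z_def)
  have B0: "0 \<le> B1" "0 \<le> B2" using B[of 0] Z by auto
  define C where "C = B1 + B2 * \<bar>\<kappa>\<bar> + 1"
  have C: "0 < C" "B1 \<le> C" "B2 * \<bar>\<kappa>\<bar> \<le> C" using B0 by (auto simp: C_def add_nonneg_pos)
  have xZ: "\<bar>\<kappa> * x powr \<alpha>\<bar> \<le> Z" if "0 < x" "x \<le> T" for x
    unfolding Z_def abs_mult using that alpha_gt by (intro mult_mono) (auto intro!: powr_mono2)
  have 1: "\<bar>R x\<bar> \<le> C * x powr (\<alpha> - 1)" if "0 < x" "x \<le> T" for x
    using B(1)[OF xZ[OF that]] C that
    by (auto simp: R_pos abs_mult mult.commute intro!: mult_right_mono)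
  define R' where "R' x = (\<alpha> - 1) * x powr (\<alpha> - 2) * mlf (\<kappa> * x powr \<alpha>) +
    x powr (\<alpha> - 1) * (mlf' (\<kappa> * x powr \<alpha>) * (\<kappa> * (\<alpha> * x powr (\<alpha> - 1))))" for x
  have D: "(R has_real_derivative R' x) (at x)" if "0 < x" for x
  proof (rule has_field_derivative_transform_within_open[where S = "{0<..}"])
    show "((\<lambda>x. x powr (\<alpha> - 1) * mlf (\<kappa> * x powr \<alpha>)) has_real_derivative R' x) (at x)"
      unfolding R'_def using that
      by (auto intro!: derivative_eq_intros DERIV_chain2[OF DERIV_mlf] simp: algebra_simps)
  qed (use that in \<open>auto simp: R_pos\<close>)
  have R': "\<bar>R' x\<bar> \<le> C * ((1 - \<alpha>) * x powr (\<alpha> - 2) + x powr (2 * \<alpha> - 2))" if "0 < x" "x \<le> T" for x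
  proof -
    have sq: "x powr (2 * \<alpha> - 2) = x powr (\<alpha> - 1) * x powr (\<alpha> - 1)"
      by (simp add: powr_add[symmetric])
    have "\<bar>R' x\<bar> \<le> (1 - \<alpha>) * x powr (\<alpha> - 2) * \<bar>mlf (\<kappa> * x powr \<alpha>)\<bar> +
       \<bar>mlf' (\<kappa> * x powr \<alpha>)\<bar> * \<bar>\<kappa>\<bar> * (\<alpha> * x powr (2 * \<alpha> - 2))"
      unfolding R'_def using alpha_gt alpha_le
      by (intro order.trans[OF abs_triangle_ineq] add_mono)
         (auto simp: abs_mult sq)
    also have "\<dots> \<le> (1 - \<alpha>) * x powr (\<alpha> - 2) * C + C * (1 * x powr (2 * \<alpha> - 2))"
      using B(1)[OF xZ[OF that]] B(2)[OF xZ[OF that]] C alpha_gt alpha_le B0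
      by (intro add_mono mult_left_mono mult_mono order.trans[OF mult_right_mono C(3)]) auto
    finally show ?thesis by (simp add: algebra_simps)
  qed
  have 2: "\<bar>R y - R x\<bar> \<le> C * ((1 - \<alpha>) * x powr (\<alpha> - 2) + x powr (2 * \<alpha> - 2)) * (y - x)"
    if xy: "0 < x" "x \<le> y" "y \<le> T" for x y
  proof (cases "x = y")
    case False
    then have "x < y" using xy by simp
    then obtain z where z: "x < z" "z < y" "R y - R x = (y - x) * R' z"
      using MVT2[of x y R R'] D xy by auto
    have "\<bar>R' z\<bar> \<le> C * ((1 - \<alpha>) * z powr (\<alpha> - 2) + z powr (2 * \<alpha> - 2))"
      using R' z xy by auto
    also have "\<dots> \<le> C * ((1 - \<alpha>) * x powr (\<alpha> - 2) + x powr (2 * \<alpha> - 2))"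
      using z xy alpha_le C(1) by (intro mult_left_mono add_mono powr_mono2') auto
    finally show ?thesis using z xy by (simp add: abs_mult mult.commute mult_left_mono)
  qed auto
  show thesis using that[OF C(1) 1 2] .
qed

text \<open>One application of the Volterra operator raises the index by one: the Beta factor
  exchanges the two Gamma values for that of the sum of the exponents.\<close>

lemma has_bochner_integral_K_rterm:
  "has_bochner_integral lborel (\<lambda>s. \<kappa> * (K (t - s) * rterm j (s - r))) (rterm (Suc j) (t - r))"
proof -
  let ?b = "real (Suc j) * \<alpha>"
  have b: "0 < ?b" "0 < \<alpha>" using alpha_gt by auto
  have "has_bochner_integral lborel (\<lambda>s. (\<kappa> * \<kappa> ^ j * mlc j / Gamma \<alpha>) * (tpow (\<alpha> - 1) (t - s) * tpow (?b - 1) (s - r)))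
     ((\<kappa> * \<kappa> ^ j * mlc j / Gamma \<alpha>) * (Beta \<alpha> ?b * tpow (\<alpha> + ?b - 1) (t - r)))"
    using b by (intro has_bochner_integral_mult_right has_bochner_integral_tpow_conv)
  moreover have "(\<kappa> * \<kappa> ^ j * mlc j / Gamma \<alpha>) * (Beta \<alpha> ?b * tpow (\<alpha> + ?b - 1) (t - r)) = rterm (Suc j) (t - r)"
  proof -
    have "\<alpha> + ?b = real (Suc (Suc j)) * \<alpha>" by (simp add: algebra_simps)
    moreover have "Gamma ?b \<noteq> 0" using Gamma_real_pos[OF b(1)] by linarith
    moreover have "Gamma \<alpha> \<noteq> 0" using Gamma_alpha_pos by linarith
    ultimately show ?thesis by (simp add: rterm_def mlc_def Beta_def del: of_nat_Suc)
  qed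
  ultimately show ?thesis by (simp add: K_def rterm_def mult_ac)
qed

lemma R_resolvent:
  shows "integrable lborel (\<lambda>s. \<kappa> * (K (t - s) * R (s - r)))"
    and "R (t - r) = K (t - r) + (\<integral>s. \<kappa> * (K (t - s) * R (s - r)) \<partial>lborel)"
proof -
  let ?f = "\<lambda>j s. \<kappa> * (K (t - s) * rterm j (s - r))"
  have i: "integrable lborel (?f j)" and e: "integral\<^sup>L lborel (?f j) = rterm (Suc j) (t - r)" for j
    using has_bochner_integral_K_rterm[of t j r] by (auto simp: has_bochner_integral_iff)
  \<comment> \<open>The absolute values of the terms are the terms for
    \<open>\<bar>\<kappa>\<bar>\<close>. Hence the integrals of the norms are again terms of an
    absolutely convergent resolvent series, shifted by one, which justifies integrating term by
    term.\<close>
  interpret abs: fractional \<alpha> "\<bar>\<kappa>\<bar>" T using alpha_gt alpha_le T_pos by unfold_locales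
  have abs: "\<bar>rterm j x\<bar> = abs.rterm j x" for j x
    using mlc_pos[of j] by (simp add: rterm_def abs.rterm_def abs_mult power_abs abs.mlc_def mlc_def)
  have n: "norm (?f j s) = \<bar>\<kappa>\<bar> * (abs.K (t - s) * abs.rterm j (s - r))" for j s
    using less_imp_le[OF Gamma_alpha_pos] by (simp add: abs_mult abs abs.K_def K_def)
  have R: "(\<Sum>j. ?f j s) = \<kappa> * (K (t - s) * R (s - r))" for s
  proof -
    have "summable (\<lambda>j. rterm j (s - r))" using summable_abs_rterm by (rule summable_rabs_cancel)
    then show ?thesis by (simp add: R_def suminf_mult summable_mult)
  qed
  have s1: "AE s in lborel. summable (\<lambda>j. norm (?f j s))"
    unfolding n by (intro AE_I2 summable_mult) (use summable_abs_rterm in \<open>simp flip: abs\<close>)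
  have "(\<integral>s. norm (?f j s) \<partial>lborel) = \<bar>rterm (Suc j) (t - r)\<bar>" for j
    unfolding n abs using abs.has_bochner_integral_K_rterm[of t j r] by (simp add: has_bochner_integral_iff)
  then have s2: "summable (\<lambda>j. \<integral>s. norm (?f j s) \<partial>lborel)"
    using summable_Suc_iff[of "\<lambda>j. \<bar>rterm j (t - r)\<bar>"] summable_abs_rterm[of "t - r"] by simp
  show "integrable lborel (\<lambda>s. \<kappa> * (K (t - s) * R (s - r)))"
    using integrable_suminf[OF i s1 s2] by (simp add: R)
  have "(\<integral>s. \<kappa> * (K (t - s) * R (s - r)) \<partial>lborel) = (\<Sum>j. rterm (Suc j) (t - r))"
    using integral_suminf[OF i s1 s2] unfolding R e .
  also have "\<dots> = R (t - r) - rterm 0 (t - r)"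
    unfolding R_def using summable_rabs_cancel[OF summable_abs_rterm] by (rule suminf_split_head)
  also have "rterm 0 (t - r) = K (t - r)" by (simp add: rterm_def mlc_def K_def)
  finally show "R (t - r) = K (t - r) + (\<integral>s. \<kappa> * (K (t - s) * R (s - r)) \<partial>lborel)" by simp
qed

end

section \<open>Elementary bounds for integrals of powers\<close>

lemma nn_integral_powr_Ioc:
  assumes "-1 < p" "0 \<le> b"
  shows "(\<integral>\<^sup>+r. ennreal (indicator {0<..b} r * r powr p) \<partial>lborel) = ennreal (b powr (p + 1) / (p + 1))"
proof -
  have "(\<integral>\<^sup>+r. ennreal (indicator {0<..b} r * r powr p) \<partial>lborel)
      = (\<integral>\<^sup>+r. ennreal (indicator {0..b} r *\<^sub>R r powr p) \<partial>lborel)"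
    by (intro nn_integral_cong) (auto simp: indicator_def)
  also have "\<dots> = ennreal (b powr (p + 1) / (p + 1))"
    using nn_integral_has_integral_lebesgue[OF _ has_integral_powr_from_0[OF assms]]
    by (simp add: mult.commute)
  finally show ?thesis .
qed

lemma nn_integral_powr_Ici:
  assumes "p < -1" "0 < b"
  shows "(\<integral>\<^sup>+r. ennreal (indicator {b..} r * r powr p) \<partial>lborel) = ennreal (b powr (p + 1) / - (p + 1))"
  using nn_integral_has_integral_lebesgue[OF _ has_integral_powr_to_inf[OF assms]]
  by (simp add: mult.commute minus_divide_right)

lemma nn_integral_inverse_Icc:
  assumes "0 < a" "a \<le> b"
  shows "(\<integral>\<^sup>+r. ennreal (indicator {a..b} r * r powr -1) \<partial>lborel) = ennreal (ln b - ln a)"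
proof -
  have "((\<lambda>x. x powr -1) has_integral (ln b - ln a)) {a..b}"
    using assms
    by (intro fundamental_theorem_of_calculus)
       (auto intro!: derivative_eq_intros simp: has_real_derivative_iff_has_vector_derivative[symmetric] powr_minus divide_inverse)
  from nn_integral_has_integral_lebesgue[OF _ this] show ?thesis
    by (simp add: mult.commute)
qed

text \<open>Majorants are assembled inside nonnegative integrals, where sums and multiples need no
  integrability conditions.\<close>

lemma nn_bound_add:
  fixes f g :: "'a \<Rightarrow> real"
  assumes [measurable]: "f \<in> borel_measurable M" "g \<in> borel_measurable M"
    and "\<And>x. 0 \<le> f x" "\<And>x. 0 \<le> g x" "0 \<le> a" "0 \<le> b"
    and "(\<integral>\<^sup>+x. ennreal (f x) \<partial>M) \<le> ennreal a" "(\<integral>\<^sup>+x. ennreal (g x) \<partial>M) \<le> ennreal b"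
  shows "(\<integral>\<^sup>+x. ennreal (f x + g x) \<partial>M) \<le> ennreal (a + b)"
  using assms by (simp add: ennreal_plus nn_integral_add add_mono)

lemma nn_bound_cmult:
  fixes f :: "'a \<Rightarrow> real"
  assumes [measurable]: "f \<in> borel_measurable M" and "0 \<le> c"
    and "(\<integral>\<^sup>+x. ennreal (f x) \<partial>M) \<le> ennreal a"
  shows "(\<integral>\<^sup>+x. ennreal (c * f x) \<partial>M) \<le> ennreal (c * a)"
  using assms by (simp add: ennreal_mult' nn_integral_cmult mult_left_mono)

text \<open>For exponents between -1 and 0, arguments comparable up to \<open>k\<close> have powers
  comparable up to the same \<open>k\<close>. The exponents \<open>\<alpha> - 1\<close> and
  \<open>2 * \<alpha> - 2\<close> both lie in this range.\<close>

lemma powr_le_scaled: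
  fixes x y q :: real
  assumes "-1 \<le> q" "q \<le> 0" "0 < x" "x \<le> k * y" "1 \<le> k" "0 < y"
  shows "y powr q \<le> k * x powr q"
proof -
  have "y powr q \<le> (x / k) powr q"
    using assms by (intro powr_mono2') (auto simp: field_simps)
  also have "\<dots> = x powr q * k powr (- q)"
    using assms by (simp add: powr_divide powr_minus field_simps)
  also have "\<dots> \<le> x powr q * k powr 1"
    using assms by (intro mult_left_mono powr_mono) auto
  finally show ?thesis using assms by (simp add: mult.commute)
qed

section \<open>The Volterra operator on the interval from 0 to T\<close>

context fractional
begin

text \<open>Because the kernels vanish at nonpositive arguments, every integral over
  \<open>{0..t}\<close> with \<open>t \<le> T\<close> is an integral against this one finite
  measure, and Fubini applies to a fixed product space.\<close>

definition L :: "real measure" where "L = restrict_space lborel {0..T}"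

lemma space_L [simp]: "space L = {0..T}"
  by (simp add: L_def space_restrict_space)

lemma sets_L [measurable_cong]: "sets L = sets (restrict_space borel {0..T})"
  unfolding L_def by (intro sets_restrict_space_cong) simp

lemma finite_measure_L: "finite_measure L"
  unfolding L_def by (intro finite_measureI) (use T_pos in \<open>simp add: emeasure_restrict_space space_restrict_space\<close>)

sublocale L: finite_measure L by (rule finite_measure_L)

lemma integral_L: "integral\<^sup>L L f = (\<integral>x. indicator {0..T} x * f x \<partial>lborel)" for f :: "real \<Rightarrow> real"
  unfolding L_def by (subst integral_restrict_space) auto

lemma integrable_L: "integrable L f \<longleftrightarrow> integrable lborel (\<lambda>x. indicator {0..T} x * f x)" for f :: "real \<Rightarrow> real"
  unfolding L_def by (subst integrable_restrict_space) auto

lemma nn_integral_L: "nn_integral L f = (\<integral>\<^sup>+x. f x * indicator {0..T} x \<partial>lborel)"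
  unfolding L_def by (subst nn_integral_restrict_space) auto

lemma measurable_L [measurable (raw)]: "f \<in> borel_measurable borel \<Longrightarrow> f \<in> borel_measurable L"
  unfolding L_def by (intro measurable_restrict_space1) simp

lemma measurable_L_pair:
  assumes f: "f \<in> borel \<Otimes>\<^sub>M N \<rightarrow>\<^sub>M N'"
  shows "f \<in> L \<Otimes>\<^sub>M N \<rightarrow>\<^sub>M N'"
proof -
  have "(\<lambda>p. (fst p, snd p)) \<in> L \<Otimes>\<^sub>M N \<rightarrow>\<^sub>M borel \<Otimes>\<^sub>M N"
    by (intro measurable_Pair measurable_compose[OF measurable_fst measurable_L[of "\<lambda>x. x"]]) auto
  from measurable_compose[OF this f] show ?thesis by simp
qed

lemma measurable_LL:
  assumes "f \<in> borel_measurable (borel \<Otimes>\<^sub>M borel)"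
  shows "f \<in> borel_measurable (L \<Otimes>\<^sub>M L)"
proof (rule measurable_L_pair)
  have "(\<lambda>p. (fst p, snd p)) \<in> borel \<Otimes>\<^sub>M L \<rightarrow>\<^sub>M borel \<Otimes>\<^sub>M borel"
    by (intro measurable_Pair measurable_compose[OF measurable_snd measurable_L[of "\<lambda>x. x"]]) auto
  from measurable_compose[OF this assms] show "f \<in> borel_measurable (borel \<Otimes>\<^sub>M L)" by simp
qed

lemma nn_integral_L_tpow:
  assumes "-1 < p" "t \<le> T"
  shows "(\<integral>\<^sup>+s. ennreal (tpow p (t - s)) \<partial>L) \<le> ennreal (T powr (p + 1) / (p + 1))"
proof -
  have "(\<integral>\<^sup>+s. ennreal (tpow p (t - s)) \<partial>L) =
      (\<integral>\<^sup>+s. ennreal (tpow p (t - s)) * indicator {0..T} s \<partial>lborel)"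
    by (simp add: nn_integral_L)
  also have "\<dots> \<le> (\<integral>\<^sup>+s. ennreal (indicator {0<..T} (t + (-1) * s) * (t + (-1) * s) powr p) \<partial>lborel)"
    using assms by (intro nn_integral_mono) (auto simp: tpow_def indicator_def)
  also have "\<dots> = (\<integral>\<^sup>+s. ennreal (indicator {0<..T} s * s powr p) \<partial>lborel)"
    by (subst (2) nn_integral_real_affine[where c = "-1" and t = t]) auto
  also have "\<dots> = ennreal (T powr (p + 1) / (p + 1))"
    using assms T_pos by (intro nn_integral_powr_Ioc) auto
  finally show ?thesis .
qed

lemma integrable_L_tpow:
  assumes "-1 < p" "t \<le> T"
  shows "integrable L (\<lambda>s. tpow p (t - s))"
    and "(\<integral>s. tpow p (t - s) \<partial>L) \<le> T powr (p + 1) / (p + 1)"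
proof -
  note le = nn_integral_L_tpow[OF assms]
  show i: "integrable L (\<lambda>s. tpow p (t - s))"
    by (intro integrableI_bounded) (use le in \<open>auto simp: le_less_trans[OF le]\<close>)
  show "(\<integral>s. tpow p (t - s) \<partial>L) \<le> T powr (p + 1) / (p + 1)"
    using le assms by (subst (asm) nn_integral_eq_integral[OF i]) auto
qed

text \<open>The full mass of \<open>K\<close> on the interval from 0 to T, hence a bound for the
  Volterra operator on bounded functions.\<close>

definition KI :: real where "KI = T powr \<alpha> / \<alpha> / Gamma \<alpha>"

lemma K_integrable: "t \<le> T \<Longrightarrow> integrable L (\<lambda>s. K (t - s))"
  using integrable_L_tpow(1)[of "\<alpha> - 1" t] alpha_gt by (simp add: K_def)

lemma K_exp_le: "0 \<le> l \<Longrightarrow> K x * exp (- (l * x)) \<le> K x"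
  by (cases "0 < x") (auto simp: K_def tpow_def intro!: mult_left_le divide_right_mono less_imp_le[OF Gamma_alpha_pos])

lemma K_exp_integrable: "0 \<le> l \<Longrightarrow> t \<le> T \<Longrightarrow> integrable L (\<lambda>s. K (t - s) * exp (- l * (t - s)))"
  by (rule Bochner_Integration.integrable_bound[OF K_integrable[of t]])
     (use K_exp_le in \<open>auto simp: abs_mult\<close>)

lemma K_integral_le: "t \<le> T \<Longrightarrow> (\<integral>s. K (t - s) \<partial>L) \<le> KI"
  using integrable_L_tpow(2)[of "\<alpha> - 1" t] alpha_gt less_imp_le[OF Gamma_alpha_pos]
  unfolding K_def KI_def by (simp add: divide_right_mono del: divide_divide_eq_left)

lemma KI_nonneg: "0 \<le> KI" using alpha_gt T_pos by (simp add: KI_def less_imp_le)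

text \<open>Both kernels have the singularity \<open>x powr (\<alpha> - 1)\<close>, and the exponent
  \<open>2 * \<alpha> - 2\<close> of its square exceeds -1 precisely because \<alpha> > 1/2.\<close>

lemma R_sq_bound:
  obtains B where "0 \<le> B" "\<And>t. t \<le> T \<Longrightarrow> integrable L (\<lambda>s. (R (t - s))\<^sup>2)"
     "\<And>t. t \<le> T \<Longrightarrow> integrable L (\<lambda>s. (K (t - s))\<^sup>2)"
     "\<And>t. t \<le> T \<Longrightarrow> (\<integral>s. (R (t - s))\<^sup>2 \<partial>L) \<le> B"
     "\<And>t. t \<le> T \<Longrightarrow> (\<integral>s. (K (t - s))\<^sup>2 \<partial>L) \<le> B"
proof -
  obtain C where C: "0 < C" "\<And>x. 0 < x \<Longrightarrow> x \<le> T \<Longrightarrow> \<bar>R x\<bar> \<le> C * x powr (\<alpha> - 1)"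
    using R_bounds by metis
  have p: "-1 < 2 * \<alpha> - 2" using alpha_gt by simp
  define D where "D = T powr (2 * \<alpha> - 1) / (2 * \<alpha> - 1)"
  define B where "B = (C\<^sup>2 + 1 / (Gamma \<alpha>)\<^sup>2) * D"
  have D: "0 \<le> D" using alpha_gt by (simp add: D_def)
  have sq: "(tpow (\<alpha> - 1) x)\<^sup>2 = tpow (2 * \<alpha> - 2) x" for x
    by (simp add: tpow_def power2_eq_square powr_add[symmetric])
  have Rb: "(R (t - s))\<^sup>2 \<le> C\<^sup>2 * tpow (2 * \<alpha> - 2) (t - s)" if "t \<le> T" "0 \<le> s" for t s
  proof (cases "0 < t - s")
    case True
    then have "\<bar>R (t - s)\<bar> \<le> C * tpow (\<alpha> - 1) (t - s)" using C(2)[of "t - s"] that by (simp add: tpow_def)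
    from power_mono[OF this, of 2] show ?thesis by (simp add: power_mult_distrib sq)
  qed (simp add: R_nonpos)
  have i: "integrable L (\<lambda>s. C\<^sup>2 * tpow (2 * \<alpha> - 2) (t - s))" if "t \<le> T" for t
    using integrable_L_tpow(1)[OF p that] by simp
  have 1: "integrable L (\<lambda>s. (R (t - s))\<^sup>2)" if "t \<le> T" for t
    by (rule Bochner_Integration.integrable_bound[OF i[OF that]]) (use Rb that in auto)
  have 2: "integrable L (\<lambda>s. (K (t - s))\<^sup>2)" if "t \<le> T" for t
    using integrable_L_tpow(1)[OF p that] by (simp add: K_def power_divide sq)
  have TI: "(\<integral>s. tpow (2 * \<alpha> - 2) (t - s) \<partial>L) \<le> D" if "t \<le> T" for t
    using integrable_L_tpow(2)[OF p that] by (simp add: D_def algebra_simps)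
  have 3: "(\<integral>s. (R (t - s))\<^sup>2 \<partial>L) \<le> B" if "t \<le> T" for t
  proof -
    have "(\<integral>s. (R (t - s))\<^sup>2 \<partial>L) \<le> (\<integral>s. C\<^sup>2 * tpow (2 * \<alpha> - 2) (t - s) \<partial>L)"
      using 1 i that Rb by (intro integral_mono) auto
    also have "\<dots> \<le> C\<^sup>2 * D" using TI[OF that] by (simp add: mult_left_mono)
    also have "\<dots> \<le> B" using D by (simp add: B_def distrib_right)
    finally show ?thesis .
  qed
  have 4: "(\<integral>s. (K (t - s))\<^sup>2 \<partial>L) \<le> B" if "t \<le> T" for t
  proof -
    have "(\<integral>s. (K (t - s))\<^sup>2 \<partial>L) = (\<integral>s. tpow (2 * \<alpha> - 2) (t - s) \<partial>L) / (Gamma \<alpha>)\<^sup>2"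
      by (simp add: K_def power_divide sq)
    also have "\<dots> \<le> D / (Gamma \<alpha>)\<^sup>2" using TI[OF that] by (simp add: divide_right_mono)
    also have "\<dots> \<le> B" using D by (simp add: B_def distrib_right)
    finally show ?thesis .
  qed
  have "0 \<le> B" using D by (simp add: B_def)
  from that[OF this 1 2 3 4] show thesis .
qed

lemma resolvent_L:
  assumes "0 \<le> r" "t \<le> T"
  shows "R (t - r) = K (t - r) + \<kappa> * (\<integral>s. K (t - s) * R (s - r) \<partial>L)"
proof -
  have *: "indicator {0..T} s * (K (t - s) * R (s - r)) = K (t - s) * R (s - r)" for s :: real
    using assms by (auto simp: indicator_def K_def tpow_def R_nonpos)
  show ?thesis using R_resolvent(2)[of t r] by (simp only: integral_L *) simp
qed

text \<open>An exponential weight turns the Volterra operator into a contraction with factor \<open>1 / 2\<close>.\<close>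

lemma gronwall_weight:
  obtains l where "0 < l" "\<And>t. t \<le> T \<Longrightarrow> \<bar>\<kappa>\<bar> * (\<integral>s. K (t - s) * exp (- l * (t - s)) \<partial>L) \<le> 1 / 2"
proof -
  \<comment> \<open>The weight is found without a rate: dominated convergence with majorant
    \<open>K\<close> makes the weighted mass at the final time small for some natural number
    \<open>j\<close>.\<close>
  have "(\<lambda>j. \<integral>s. K (T - s) * exp (- real j * (T - s)) \<partial>L) \<longlonglongrightarrow> (\<integral>s. 0 \<partial>L)"
  proof (rule integral_dominated_convergence[where w = "\<lambda>s. K (T - s)"])
    show "AE s in L. (\<lambda>j. K (T - s) * exp (- real j * (T - s))) \<longlonglongrightarrow> 0"
    proof (intro AE_I2)
      fix s assume "s \<in> space L"
      show "(\<lambda>j. K (T - s) * exp (- real j * (T - s))) \<longlonglongrightarrow> 0"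
      proof (cases "0 < T - s")
        case True
        then have "(\<lambda>j. exp (- (T - s)) ^ j) \<longlonglongrightarrow> 0"
          by (intro LIMSEQ_power_zero) simp
        from tendsto_mult_right_zero[OF this, of "K (T - s)"] show ?thesis
          by (simp add: exp_of_nat_mult[symmetric] algebra_simps)
      qed (simp add: K_def tpow_def)
    qed
    show "AE s in L. norm (K (T - s) * exp (- real j * (T - s))) \<le> K (T - s)" for j
      using K_exp_le[of "real j" "T - s" for s] by (auto simp: abs_mult)
  qed (auto simp: K_integrable)
  then have "(\<lambda>j. \<bar>\<kappa>\<bar> * (\<integral>s. K (T - s) * exp (- real j * (T - s)) \<partial>L)) \<longlonglongrightarrow> \<bar>\<kappa>\<bar> * 0"
    by (intro tendsto_mult tendsto_const) simp
  then have "\<forall>\<^sub>F j in sequentially. \<bar>\<kappa>\<bar> * (\<integral>s. K (T - s) * exp (- real j * (T - s)) \<partial>L) < 1 / 2"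
    by (rule order_tendstoD) simp
  from eventually_conj[OF this eventually_ge_at_top[of 1]]
  obtain j :: nat where j: "1 \<le> j" "\<bar>\<kappa>\<bar> * (\<integral>s. K (T - s) * exp (- real j * (T - s)) \<partial>L) < 1 / 2"
    by (auto simp: eventually_sequentially)
  let ?g = "\<lambda>x. K x * exp (- real j * x)"
  \<comment> \<open>The final time is the worst case: shifting \<open>s\<close> by
    \<open>T - t\<close> maps the integral for \<open>t\<close> into a part of the integral for
    \<open>T\<close>.\<close>
  have "\<bar>\<kappa>\<bar> * (\<integral>s. ?g (t - s) \<partial>L) \<le> 1 / 2" if t: "t \<le> T" for t
  proof -
    have i: "integrable L (\<lambda>s. ?g (t - s))" if "t \<le> T" for t
      using K_exp_integrable[of "real j" t] that by simp
    have "ennreal (\<integral>s. ?g (t - s) \<partial>L) = (\<integral>\<^sup>+s. ennreal (?g (t - s)) * indicator {0..T} s \<partial>lborel)"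
      using i[OF t] by (subst nn_integral_L[symmetric], subst nn_integral_eq_integral) auto
    also have "\<dots> \<le> (\<integral>\<^sup>+s. ennreal (?g (T - (T - t + s))) * indicator {0..T} (T - t + s) \<partial>lborel)"
      using t by (intro nn_integral_mono) (auto simp: indicator_def K_def tpow_def)
    also have "\<dots> = (\<integral>\<^sup>+s. ennreal (?g (T - s)) * indicator {0..T} s \<partial>lborel)"
      by (subst (2) nn_integral_real_affine[where c = 1 and t = "T - t"]) auto
    also have "\<dots> = ennreal (\<integral>s. ?g (T - s) \<partial>L)"
      using i by (subst nn_integral_L[symmetric], subst nn_integral_eq_integral) auto
    finally have "(\<integral>s. ?g (t - s) \<partial>L) \<le> (\<integral>s. ?g (T - s) \<partial>L)"
      by (subst (asm) ennreal_le_iff) (auto intro!: integral_nonneg_AE)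
    from mult_left_mono[OF this, of "\<bar>\<kappa>\<bar>"] show ?thesis using j(2) by simp
  qed
  then show thesis using that[of "real j"] j by simp
qed

text \<open>Iterating the weighted contraction bounds |f t| by B exp(l t) / 2^j for every j. The a
  priori bound \<open>B\<close> is what starts the iteration.\<close>

lemma volterra_unique:
  assumes f: "f \<in> borel_measurable L" and b: "\<And>t. t \<in> {0..T} \<Longrightarrow> \<bar>f t\<bar> \<le> B"
    and eq: "\<And>t. t \<in> {0..T} \<Longrightarrow> f t = \<kappa> * (\<integral>s. K (t - s) * f s \<partial>L)"
    and t: "t \<in> {0..T}"
  shows "f t = 0"
proof -
  obtain l where l: "0 < l" "\<And>t. t \<le> T \<Longrightarrow> \<bar>\<kappa>\<bar> * (\<integral>s. K (t - s) * exp (- l * (t - s)) \<partial>L) \<le> 1 / 2"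
    using gronwall_weight by metis
  have B: "0 \<le> B" using b[OF t] by linarith
  have le: "\<bar>f t\<bar> \<le> B * exp (l * t) * (1 / 2) ^ j" if "t \<in> {0..T}" for j t
    using that
  proof (induction j arbitrary: t)
    case 0
    have "B * 1 \<le> B * exp (l * t)" using 0 l(1) B by (intro mult_left_mono) auto
    then show ?case using b[OF 0] by simp
  next
    case (Suc j)
    let ?D = "B * exp (l * t) * (1 / 2) ^ j"
    have i: "integrable L (\<lambda>s. K (t - s) * exp (- l * (t - s)))"
      using K_exp_integrable[of l t] Suc l(1) by simp
    have "\<bar>f t\<bar> = \<bar>\<kappa>\<bar> * \<bar>\<integral>s. K (t - s) * f s \<partial>L\<bar>" using eq[OF Suc.prems] by (simp add: abs_mult)
    also have "\<bar>\<integral>s. K (t - s) * f s \<partial>L\<bar> \<le> (\<integral>s. ?D * (K (t - s) * exp (- l * (t - s))) \<partial>L)"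
    proof (rule integral_abs_bound[THEN order.trans], rule integral_mono)
      show "integrable L (\<lambda>s. \<bar>K (t - s) * f s\<bar>)"
        by (rule Bochner_Integration.integrable_bound[where f = "\<lambda>s. B * K (t - s)"])
           (use Suc K_integrable b B f in \<open>auto simp: abs_mult mult.commute[of B] intro!: mult_left_mono AE_I2\<close>)
      show "integrable L (\<lambda>s. ?D * (K (t - s) * exp (- l * (t - s))))" using i by simp
      fix s assume "s \<in> space L"
      then have "\<bar>f s\<bar> \<le> B * exp (l * s) * (1 / 2) ^ j" using Suc.IH[of s] by simp
      also have "exp (l * s) = exp (l * t) * exp (- l * (t - s))" by (simp add: exp_add[symmetric] algebra_simps)
      finally have "\<bar>f s\<bar> \<le> B * (exp (l * t) * exp (- l * (t - s))) * (1 / 2) ^ j" .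
      from mult_left_mono[OF this K_nonneg[of "t - s"]]
      show "\<bar>K (t - s) * f s\<bar> \<le> ?D * (K (t - s) * exp (- l * (t - s)))"
        by (simp add: abs_mult mult_ac)
    qed
    then have "\<bar>\<kappa>\<bar> * \<bar>\<integral>s. K (t - s) * f s \<partial>L\<bar> \<le> \<bar>\<kappa>\<bar> * (\<integral>s. ?D * (K (t - s) * exp (- l * (t - s))) \<partial>L)"
      by (intro mult_left_mono) auto
    also have "\<dots> = ?D * (\<bar>\<kappa>\<bar> * (\<integral>s. K (t - s) * exp (- l * (t - s)) \<partial>L))" by simp
    also have "\<dots> \<le> ?D * (1 / 2)" using l(2)[of t] Suc B by (intro mult_left_mono) auto
    finally show ?case by simp
  qed
  have "(\<lambda>j. B * exp (l * t) * (1 / 2) ^ j) \<longlonglongrightarrow> B * exp (l * t) * 0"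
    by (intro tendsto_mult tendsto_const LIMSEQ_power_zero) simp
  from tendsto_lowerbound[OF this, of "\<bar>f t\<bar>"] le[OF t] show ?thesis by simp
qed

end

text \<open>If \<open>s \<le> 2 * h\<close>, the strip is enlarged to \<open>{0<..2 * h}\<close> and
  the singularity is integrated. Otherwise \<open>s' \<ge> s / 2\<close>, and the integrand is
  bounded by its value at \<open>s / 2\<close>. In both regimes \<open>h + s\<close> is the relevant
  scale up to a factor of 3.\<close>

lemma strip_bound:
  assumes "-1 < q" "q \<le> 0" "0 \<le> s'" "s' \<le> s" "s - s' \<le> h" "0 < h"
  shows "(\<integral>\<^sup>+r. ennreal (indicator {s'<..s} r * r powr q) \<partial>lborel)
    \<le> ennreal (6 / (q + 1) * (h * (h + s) powr q))"
proof (cases "s \<le> 2 * h")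
  case True
  have "(\<integral>\<^sup>+r. ennreal (indicator {s'<..s} r * r powr q) \<partial>lborel) \<le>
      (\<integral>\<^sup>+r. ennreal (indicator {0<..2 * h} r * r powr q) \<partial>lborel)"
    using assms True by (intro nn_integral_mono) (auto simp: indicator_def)
  also have "\<dots> = ennreal ((2 * h) powr (q + 1) / (q + 1))"
    using assms by (intro nn_integral_powr_Ioc) auto
  also have "(2 * h) powr (q + 1) / (q + 1) = 2 / (q + 1) * (h * (2 * h) powr q)"
    using powr_mult_base[of "2 * h" q] assms by (simp add: add.commute)
  also have "\<dots> \<le> 2 / (q + 1) * (h * (3 * (h + s) powr q))"
    using assms True by (intro mult_left_mono powr_le_scaled) auto
  finally show ?thesis by (simp add: ennreal_leI)
next
  case False
  have "(\<integral>\<^sup>+r. ennreal (indicator {s'<..s} r * r powr q) \<partial>lborel) \<le>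
      (\<integral>\<^sup>+r. ennreal ((s / 2) powr q) * indicator {s'<..s} r \<partial>lborel)"
    using assms False by (intro nn_integral_mono) (auto simp: indicator_def intro!: ennreal_leI powr_mono2')
  also have "\<dots> = ennreal ((s / 2) powr q * (s - s'))"
    using assms by (simp add: nn_integral_cmult_indicator ennreal_mult)
  also have "(s / 2) powr q * (s - s') \<le> (3 * (h + s) powr q) * h"
    using assms False by (intro mult_mono powr_le_scaled) auto
  also have "\<dots> = 3 * (h * (h + s) powr q)" by simp
  \<comment> \<open>The constant of the singular regime, 2 / (q + 1) times 3, also covers this
    regime, since \<open>q + 1 \<le> 1\<close>.\<close>
  also have "\<dots> \<le> 6 / (q + 1) * (h * (h + s) powr q)"
    using assms by (intro mult_right_mono) (auto simp: field_simps)
  finally show ?thesis by (simp add: ennreal_leI)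
qed

section \<open>Regularity of the covariance function\<close>

context fractional
begin

definition cov :: "real \<Rightarrow> real \<Rightarrow> real" where
  "cov s u = (\<integral>v. R (s - v) * R (u - v) \<partial>L)"

lemma cov_commute: "cov s u = cov u s"
  by (simp add: cov_def mult.commute)

lemma cov_bound: obtains B where "0 \<le> B" "\<And>s u. s \<le> T \<Longrightarrow> u \<le> T \<Longrightarrow> \<bar>cov s u\<bar> \<le> B"
proof -
  obtain B where B: "0 \<le> B" "\<And>t. t \<le> T \<Longrightarrow> integrable L (\<lambda>s. (R (t - s))\<^sup>2)"
     "\<And>t. t \<le> T \<Longrightarrow> (\<integral>s. (R (t - s))\<^sup>2 \<partial>L) \<le> B"
    using R_sq_bound by metis
  have "\<bar>cov s u\<bar> \<le> B" if "s \<le> T" "u \<le> T" for s u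
    unfolding cov_def
    by (rule square_integrable_mult(2)[THEN order.trans])
       (use B(2) that add_mono[OF B(3)[OF that(1)] B(3)[OF that(2)]] in auto)
  from that[OF B(1) this] show thesis .
qed

lemma cov_measurable [measurable]: "(\<lambda>s. cov s u) \<in> borel_measurable borel"
  unfolding cov_def integral_L by measurable

lemma cov_shift:
  assumes "0 \<le> s" "0 \<le> a" "s + a \<le> T"
  shows "cov s (s + a) = (\<integral>r. indicator {0<..s} r * (R r * R (a + r)) \<partial>lborel)"
    and "integrable lborel (\<lambda>r. indicator {0<..s} r * (R r * R (a + r)))"
proof -
  obtain B where B: "\<And>t. t \<le> T \<Longrightarrow> integrable L (\<lambda>s. (R (t - s))\<^sup>2)"
    using R_sq_bound by metis
  have i: "integrable L (\<lambda>v. R (s - v) * R (s + a - v))"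
    using assms B by (intro square_integrable_mult) auto
  let ?f = "\<lambda>v. indicator {0..T} v * (R (s - v) * R (s + a - v))"
  have eq: "?f (s + (-1) * r) = indicator {0<..s} r * (R r * R (a + r))" for r
    using assms by (cases "0 < r") (auto simp: indicator_def R_nonpos algebra_simps)
  show "cov s (s + a) = (\<integral>r. indicator {0<..s} r * (R r * R (a + r)) \<partial>lborel)"
    unfolding cov_def integral_L
    by (subst lborel_integral_real_affine[where c = "-1" and t = s]) (simp_all only: eq, simp_all)
  have "integrable lborel (\<lambda>r. ?f (s + (-1) * r))"
    using i unfolding integrable_L by (subst lborel_integrable_real_affine_iff) auto
  then show "integrable lborel (\<lambda>r. indicator {0<..s} r * (R r * R (a + r)))"
    by (simp only: eq)
qed

text \<open>Close to the singularity, for \<open>a\<close> and \<open>r\<close> below \<open>h\<close>, the increment of \<open>R\<close> is bounded by its two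
  terms; elsewhere by the derivative. The factor \<open>1 - \<alpha>\<close> in the bound on the derivative compensates the divergence of
  the integral of \<open>r powr (2 * \<alpha> - 3)\<close> over \<open>{b..}\<close> as \<open>\<alpha>\<close> tends to \<open>1\<close>.\<close>

lemma shift_bound:
  obtains C where "0 \<le> C" "\<And>a d h p. 0 \<le> a \<Longrightarrow> 0 \<le> d \<Longrightarrow> d \<le> h \<Longrightarrow> 0 < h \<Longrightarrow> 0 \<le> p \<Longrightarrow> a + d + p \<le> T \<Longrightarrow>
    (\<integral>\<^sup>+r. ennreal (indicator {0<..p} r * (\<bar>R r\<bar> * \<bar>R (a + d + r) - R (a + r)\<bar>)) \<partial>lborel)
      \<le> ennreal (C * (h * (h + a) powr (2 * \<alpha> - 2)))"
proof -
  obtain C where C: "0 < C" "\<And>x. 0 < x \<Longrightarrow> x \<le> T \<Longrightarrow> \<bar>R x\<bar> \<le> C * x powr (\<alpha> - 1)"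
    "\<And>x y. 0 < x \<Longrightarrow> x \<le> y \<Longrightarrow> y \<le> T \<Longrightarrow>
      \<bar>R y - R x\<bar> \<le> C * ((1 - \<alpha>) * x powr (\<alpha> - 2) + x powr (2 * \<alpha> - 2)) * (y - x)"
    using R_bounds by metis
  \<comment> \<open>\<open>c1\<close> dominates the constants 2 / (2 \<alpha> - 1) and 1 / \<alpha>
    of the two cases of \<open>X\<close>, and \<open>c2\<close> is the integral of r^(\<alpha> - 1)
    up to \<open>T\<close>. The last factor 2 in \<open>D\<close> pays for replacing the scale
    \<open>b\<close> by \<open>h + a\<close>.\<close>
  define c1 where "c1 = 2 / (2 * \<alpha> - 1) + (1 + T powr \<alpha>) / \<alpha>"
  define c2 where "c2 = T powr \<alpha> / \<alpha>"
  define D where "D = C\<^sup>2 * (c1 + (1 / 2 + c2)) * 2"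
  have c: "0 \<le> c1" "0 \<le> c2" using alpha_gt by (auto simp: c1_def c2_def)
  have D: "0 \<le> D" using c by (simp add: D_def)
  have "(\<integral>\<^sup>+r. ennreal (indicator {0<..p} r * (\<bar>R r\<bar> * \<bar>R (a + d + r) - R (a + r)\<bar>)) \<partial>lborel)
      \<le> ennreal (D * (h * (h + a) powr (2 * \<alpha> - 2)))"
    if H: "0 \<le> a" "0 \<le> d" "d \<le> h" "0 < h" "0 \<le> p" "a + d + p \<le> T" for a d h p
  proof -
    \<comment> \<open>The larger of the two lengths separates the singular range from the rest and
      is comparable to \<open>a + h\<close>.\<close>
    define b where "b = max a h"
    have b: "0 < b" "a + h \<le> 2 * b" "a \<le> b" "h \<le> b" using H by (auto simp: b_def)
    define \<beta> where "\<beta> = b powr (2 * \<alpha> - 2)"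
    have \<beta>: "0 < \<beta>" using b by (simp add: \<beta>_def)
    \<comment> \<open>\<open>X\<close> majorizes the range up to \<open>b\<close>: the two values of
      \<open>R\<close> by size if \<open>a < h\<close>, the first term of the derivative at
      \<open>b\<close> otherwise. \<open>Y\<close> is the first term of the derivative beyond
      \<open>b\<close>. \<open>Z\<close> is the second term, with its power frozen at
      \<open>b\<close>, on all of \<open>{0<..T}\<close>.\<close>
    define X where "X r = (if a < h then 2 * (indicator {0<..b} r * r powr (2 * \<alpha> - 2)) else
        (h * b powr (\<alpha> - 2)) * (indicator {0<..b} r * r powr (\<alpha> - 1)))" for r
    define Y where "Y r = (1 - \<alpha>) * (indicator {b..} r * r powr (2 * \<alpha> - 3))" for r
    define Z where "Z r = \<beta> * (indicator {0<..T} r * r powr (\<alpha> - 1))" for r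
    have [measurable]: "X \<in> borel_measurable borel" "Y \<in> borel_measurable borel" "Z \<in> borel_measurable borel"
      unfolding X_def Y_def Z_def by measurable
    have nonneg: "0 \<le> X r" "0 \<le> Y r" "0 \<le> Z r" for r
      using H alpha_le \<beta> by (auto simp: X_def Y_def Z_def)
    have IX: "(\<integral>\<^sup>+r. ennreal (X r) \<partial>lborel) \<le> ennreal (c1 * (h * \<beta>))"
    proof (cases "a < h")
      case True
      then have bh: "b = h" by (simp add: b_def)
      have "(\<integral>\<^sup>+r. ennreal (X r) \<partial>lborel) \<le> ennreal (2 * (b powr (2 * \<alpha> - 2 + 1) / (2 * \<alpha> - 2 + 1)))"
        using True alpha_gt b unfolding X_def
        by (simp only: if_True, intro nn_bound_cmult) (auto simp: nn_integral_powr_Ioc)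
      also have "b powr (2 * \<alpha> - 2 + 1) = h * \<beta>"
        using b bh powr_mult_base[of h "2 * \<alpha> - 2"] by (simp add: \<beta>_def)
      also have "2 * (h * \<beta> / (2 * \<alpha> - 2 + 1)) = 2 / (2 * \<alpha> - 1) * (h * \<beta>)" by simp
      also have "\<dots> \<le> c1 * (h * \<beta>)" using H \<beta> alpha_gt by (intro mult_right_mono) (auto simp: c1_def)
      finally show ?thesis by (simp add: ennreal_leI)
    next
      case False
      have "(\<integral>\<^sup>+r. ennreal (X r) \<partial>lborel) \<le> ennreal (h * b powr (\<alpha> - 2) * (b powr (\<alpha> - 1 + 1) / (\<alpha> - 1 + 1)))"
        using False alpha_gt b H unfolding X_def
        by (simp only: if_False, intro nn_bound_cmult) (auto simp: nn_integral_powr_Ioc)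
      also have "h * b powr (\<alpha> - 2) * (b powr (\<alpha> - 1 + 1) / (\<alpha> - 1 + 1)) = 1 / \<alpha> * (h * \<beta>)"
        by (simp add: \<beta>_def powr_add[symmetric] algebra_simps)
      also have "\<dots> \<le> c1 * (h * \<beta>)" using H \<beta> alpha_gt
        by (intro mult_right_mono) (auto simp: c1_def add_divide_distrib)
      finally show ?thesis by (simp add: ennreal_leI)
    qed
    have IY: "(\<integral>\<^sup>+r. ennreal (Y r) \<partial>lborel) \<le> ennreal (1 / 2 * \<beta>)"
    proof (cases "\<alpha> = 1")
      case True
      then have "Y r = 0" for r by (simp add: Y_def)
      then show ?thesis by simp
    next
      case False
      then have lt: "\<alpha> < 1" using alpha_le by simp
      have "(\<integral>\<^sup>+r. ennreal (Y r) \<partial>lborel) \<le> ennreal ((1 - \<alpha>) * (b powr (2 * \<alpha> - 3 + 1) / - (2 * \<alpha> - 3 + 1)))"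
        using lt b unfolding Y_def by (intro nn_bound_cmult) (auto simp: nn_integral_powr_Ici)
      also have "(1 - \<alpha>) * (b powr (2 * \<alpha> - 3 + 1) / - (2 * \<alpha> - 3 + 1)) = 1 / 2 * \<beta>"
        using lt by (simp add: \<beta>_def field_simps)
      finally show ?thesis .
    qed
    have IZ: "(\<integral>\<^sup>+r. ennreal (Z r) \<partial>lborel) \<le> ennreal (\<beta> * c2)"
      using \<beta> alpha_gt T_pos unfolding Z_def by (intro nn_bound_cmult) (auto simp: nn_integral_powr_Ioc c2_def)
    have pt: "indicator {0<..p} r * (\<bar>R r\<bar> * \<bar>R (a + d + r) - R (a + r)\<bar>) \<le> C\<^sup>2 * (X r + h * (Y r + Z r))" for r
    proof (cases "0 < r \<and> r \<le> p")
      case False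
      then show ?thesis using nonneg[of r] H by (auto simp: indicator_def)
    next
      case True
      then have r: "0 < r" "a + d + r \<le> T" "r \<le> T" using H by auto
      have Rr: "\<bar>R r\<bar> \<le> C * r powr (\<alpha> - 1)" using C r by auto
      have lip: "\<bar>R (a + d + r) - R (a + r)\<bar> \<le> C * ((1 - \<alpha>) * (a + r) powr (\<alpha> - 2) + (a + r) powr (2 * \<alpha> - 2)) * h"
      proof -
        have "\<bar>R (a + d + r) - R (a + r)\<bar> \<le> C * ((1 - \<alpha>) * (a + r) powr (\<alpha> - 2) + (a + r) powr (2 * \<alpha> - 2)) * (a + d + r - (a + r))"
          using r H by (intro C(3)) auto
        also have "\<dots> \<le> C * ((1 - \<alpha>) * (a + r) powr (\<alpha> - 2) + (a + r) powr (2 * \<alpha> - 2)) * h"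
          using H C(1) alpha_le by (intro mult_left_mono) auto
        finally show ?thesis .
      qed
      have Zr: "Z r = \<beta> * r powr (\<alpha> - 1)" using r by (simp add: Z_def)
      have key: "\<bar>R r\<bar> * \<bar>R (a + d + r) - R (a + r)\<bar> \<le> C\<^sup>2 * (r powr (\<alpha> - 1) * W)"
        if "\<bar>R (a + d + r) - R (a + r)\<bar> \<le> C * W" for W
        using mult_mono[OF Rr that] C(1) by (simp add: power2_eq_square mult_ac)
      have key2: "\<bar>R r\<bar> * \<bar>R (a + d + r) - R (a + r)\<bar> \<le> C\<^sup>2 * (h * (r powr (\<alpha> - 1) * U + Z r))"
        if U: "(1 - \<alpha>) * (a + r) powr (\<alpha> - 2) \<le> U" and ar: "b \<le> a + r" for U
      proof -
        have "(a + r) powr (2 * \<alpha> - 2) \<le> \<beta>" unfolding \<beta>_def using ar b alpha_le by (intro powr_mono2') auto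
        then have "C * ((1 - \<alpha>) * (a + r) powr (\<alpha> - 2) + (a + r) powr (2 * \<alpha> - 2)) * h \<le> C * (U + \<beta>) * h"
          using U C(1) H by (intro mult_right_mono mult_left_mono add_mono) auto
        then have "\<bar>R (a + d + r) - R (a + r)\<bar> \<le> C * ((U + \<beta>) * h)" using lip by (simp add: mult.assoc)
        from key[OF this] show ?thesis by (simp add: Zr algebra_simps)
      qed
      have sq: "r powr (2 * \<alpha> - 2) = r powr (\<alpha> - 1) * r powr (\<alpha> - 1)" by (simp add: powr_add[symmetric])
      have "\<bar>R r\<bar> * \<bar>R (a + d + r) - R (a + r)\<bar> \<le> C\<^sup>2 * (X r + h * (Y r + Z r))"
      proof (cases "b \<le> r")
        case True
        have "(1 - \<alpha>) * (a + r) powr (\<alpha> - 2) \<le> (1 - \<alpha>) * r powr (\<alpha> - 2)"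
          using r H alpha_le by (intro mult_left_mono powr_mono2') auto
        from key2[OF this] have "\<bar>R r\<bar> * \<bar>R (a + d + r) - R (a + r)\<bar>
            \<le> C\<^sup>2 * (h * (r powr (\<alpha> - 1) * ((1 - \<alpha>) * r powr (\<alpha> - 2)) + Z r))"
          using True H by simp
        also have "r powr (\<alpha> - 1) * ((1 - \<alpha>) * r powr (\<alpha> - 2)) = Y r"
          using True by (simp add: Y_def powr_add[symmetric])
        also have "C\<^sup>2 * (h * (Y r + Z r)) \<le> C\<^sup>2 * (X r + h * (Y r + Z r))"
          using nonneg[of r] by (intro mult_left_mono) auto
        finally show ?thesis .
      next
        case nb: False
        show ?thesis
        proof (cases "a < h")
          case True
          have "\<bar>R (a + d + r) - R (a + r)\<bar> \<le> C * (a + d + r) powr (\<alpha> - 1) + C * (a + r) powr (\<alpha> - 1)"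
            using C(2)[of "a + d + r"] C(2)[of "a + r"] r H by linarith
          also have "\<dots> \<le> C * r powr (\<alpha> - 1) + C * r powr (\<alpha> - 1)"
            using r H alpha_le C(1) by (intro add_mono mult_left_mono powr_mono2') auto
          finally have "\<bar>R (a + d + r) - R (a + r)\<bar> \<le> C * (2 * r powr (\<alpha> - 1))" by simp
          from key[OF this] have "\<bar>R r\<bar> * \<bar>R (a + d + r) - R (a + r)\<bar> \<le> C\<^sup>2 * X r"
            using True nb r by (simp add: X_def sq)
          also have "\<dots> \<le> C\<^sup>2 * (X r + h * (Y r + Z r))"
            using nonneg[of r] H by (intro mult_left_mono) auto
          finally show ?thesis .
        next
          case False
          then have ba: "b = a" by (simp add: b_def)
          have "(1 - \<alpha>) * (a + r) powr (\<alpha> - 2) \<le> 1 * b powr (\<alpha> - 2)"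
            using r H alpha_le alpha_gt b ba by (intro mult_mono powr_mono2') auto
          from key2[OF this] have "\<bar>R r\<bar> * \<bar>R (a + d + r) - R (a + r)\<bar>
             \<le> C\<^sup>2 * (h * (r powr (\<alpha> - 1) * b powr (\<alpha> - 2) + Z r))"
            using r ba by simp
          also have "h * (r powr (\<alpha> - 1) * b powr (\<alpha> - 2) + Z r) = X r + h * Z r"
            using False nb r by (simp add: X_def algebra_simps)
          also have "C\<^sup>2 * \<dots> \<le> C\<^sup>2 * (X r + h * (Y r + Z r))"
            using nonneg[of r] H by (intro mult_left_mono) auto
          finally show ?thesis .
        qed
      qed
      then show ?thesis using True by simp
    qed
    have "(\<integral>\<^sup>+r. ennreal (indicator {0<..p} r * (\<bar>R r\<bar> * \<bar>R (a + d + r) - R (a + r)\<bar>)) \<partial>lborel)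
       \<le> (\<integral>\<^sup>+r. ennreal (C\<^sup>2 * (X r + h * (Y r + Z r))) \<partial>lborel)"
      by (intro nn_integral_mono ennreal_leI pt)
    also have "\<dots> \<le> ennreal (C\<^sup>2 * (c1 * (h * \<beta>) + h * (1 / 2 * \<beta> + \<beta> * c2)))"
      using nonneg H \<beta> c by (intro nn_bound_cmult nn_bound_add IX IY IZ) auto
    also have "C\<^sup>2 * (c1 * (h * \<beta>) + h * (1 / 2 * \<beta> + \<beta> * c2)) = C\<^sup>2 * (c1 + (1 / 2 + c2)) * (h * \<beta>)"
      by (simp add: algebra_simps)
    also have "\<dots> \<le> C\<^sup>2 * (c1 + (1 / 2 + c2)) * (h * (2 * (h + a) powr (2 * \<alpha> - 2)))"
      unfolding \<beta>_def using b c H alpha_gt alpha_le by (intro mult_left_mono powr_le_scaled) auto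
    also have "\<dots> = D * (h * (h + a) powr (2 * \<alpha> - 2))" by (simp add: D_def mult_ac)
    finally show ?thesis by (simp add: ennreal_leI)
  qed
  from that[OF D this] show thesis .
qed

text \<open>For \<open>s \<le> u\<close> the substitution \<open>r = s - v\<close> moves the increment from the singular factor \<open>R (s - v)\<close>
  to \<open>R (u - v)\<close>.\<close>

lemma cov_diff_le_right:
  obtains C where "0 \<le> C" "\<And>s' s u h. 0 \<le> s' \<Longrightarrow> s' \<le> s \<Longrightarrow> s \<le> u \<Longrightarrow> u \<le> T \<Longrightarrow> s - s' \<le> h \<Longrightarrow> 0 < h \<Longrightarrow>
    \<bar>cov s u - cov s' u\<bar> \<le> C * (h * (h + (u - s)) powr (2 * \<alpha> - 2) + h * (h + s) powr (2 * \<alpha> - 2))"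
proof -
  obtain C where C: "0 < C" "\<And>x. 0 < x \<Longrightarrow> x \<le> T \<Longrightarrow> \<bar>R x\<bar> \<le> C * x powr (\<alpha> - 1)"
    using R_bounds by metis
  obtain D where D: "0 \<le> D" "\<And>a d h p. 0 \<le> a \<Longrightarrow> 0 \<le> d \<Longrightarrow> d \<le> h \<Longrightarrow> 0 < h \<Longrightarrow> 0 \<le> p \<Longrightarrow> a + d + p \<le> T \<Longrightarrow>
    (\<integral>\<^sup>+r. ennreal (indicator {0<..p} r * (\<bar>R r\<bar> * \<bar>R (a + d + r) - R (a + r)\<bar>)) \<partial>lborel)
      \<le> ennreal (D * (h * (h + a) powr (2 * \<alpha> - 2)))"
    by (fact shift_bound)
  define E where "E = D + C\<^sup>2 * (6 / (2 * \<alpha> - 1))"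
  have E: "0 \<le> E" "D \<le> E" "C\<^sup>2 * (6 / (2 * \<alpha> - 1)) \<le> E"
    using D alpha_gt by (auto simp: E_def intro!: add_nonneg_nonneg divide_nonneg_pos)
  have "\<bar>cov s u - cov s' u\<bar> \<le> E * (h * (h + (u - s)) powr (2 * \<alpha> - 2) + h * (h + s) powr (2 * \<alpha> - 2))"
    if H: "0 \<le> s'" "s' \<le> s" "s \<le> u" "u \<le> T" "s - s' \<le> h" "0 < h" for s' s u h
  proof -
    let ?F = "\<lambda>s r. indicator {0<..s} r * (R r * R (u - s + r))"
    let ?G1 = "\<lambda>r. indicator {s'<..s} r * r powr (2 * \<alpha> - 2)"
    let ?G2 = "\<lambda>r. indicator {0<..s'} r * (\<bar>R r\<bar> * \<bar>R ((u - s) + (s - s') + r) - R ((u - s) + r)\<bar>)"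
    let ?P = "h * (h + (u - s)) powr (2 * \<alpha> - 2)" and ?Q = "h * (h + s) powr (2 * \<alpha> - 2)"
    have F: "cov s u = integral\<^sup>L lborel (?F s)" "integrable lborel (?F s)"
      "cov s' u = integral\<^sup>L lborel (?F s')" "integrable lborel (?F s')"
      using cov_shift[of s "u - s"] cov_shift[of s' "u - s'"] H by auto
    \<comment> \<open>On the common range up to \<open>s'\<close> only the factor away from the
      singularity changes, giving \<open>?G2\<close>. On the strip up to \<open>s\<close> only
      \<open>?F s\<close> is alive, and both of its factors are bounded by r^(\<alpha> - 1), giving
      \<open>?G1\<close>.\<close>
    have "\<bar>?F s r - ?F s' r\<bar> \<le> ?G2 r + C\<^sup>2 * ?G1 r" for r
    proof -
      consider "r \<le> 0 \<or> s < r" | "0 < r" "r \<le> s'" | "0 < r" "s' < r" "r \<le> s" by linarith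
      then show ?thesis
      proof cases
        case 1
        then show ?thesis using H by (auto simp: R_nonpos indicator_def)
      next
        case 2
        then have "?F s r - ?F s' r = R r * (R (u - s + r) - R (u - s' + r))"
          using H by (simp add: algebra_simps)
        moreover have "?G2 r = \<bar>R r\<bar> * \<bar>R (u - s' + r) - R (u - s + r)\<bar>"
          using 2 by simp
        ultimately show ?thesis using 2 H by (simp add: abs_mult abs_minus_commute)
      next
        case 3
        have "\<bar>R r\<bar> * \<bar>R (u - s + r)\<bar> \<le> (C * r powr (\<alpha> - 1)) * (C * (u - s + r) powr (\<alpha> - 1))"
          using 3 H C by (intro mult_mono C(2)) auto
        also have "\<dots> \<le> (C * r powr (\<alpha> - 1)) * (C * r powr (\<alpha> - 1))"
          using 3 H C(1) alpha_le by (intro mult_left_mono powr_mono2') auto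
        also have "\<dots> = C\<^sup>2 * r powr (2 * \<alpha> - 2)"
          by (simp add: power2_eq_square powr_add[symmetric])
        finally show ?thesis using 3 H by (simp add: abs_mult)
      qed
    qed
    note pt = this
    have "ennreal \<bar>cov s u - cov s' u\<bar> = ennreal (norm (\<integral>r. ?F s r - ?F s' r \<partial>lborel))"
      using F by simp
    also have "\<dots> \<le> (\<integral>\<^sup>+r. ennreal (norm (?F s r - ?F s' r)) \<partial>lborel)"
      using F by (intro integral_norm_bound_ennreal) auto
    also have "\<dots> \<le> (\<integral>\<^sup>+r. ennreal (?G2 r + C\<^sup>2 * ?G1 r) \<partial>lborel)"
      using pt by (intro nn_integral_mono ennreal_leI) simp
    also have "\<dots> \<le> ennreal (D * ?P + C\<^sup>2 * (6 / (2 * \<alpha> - 2 + 1) * ?Q))"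
      using H D(1) alpha_gt alpha_le
      by (intro nn_bound_add nn_bound_cmult strip_bound D(2)) auto
    also have "2 * \<alpha> - 2 + 1 = 2 * \<alpha> - 1" by simp
    also have "D * ?P + C\<^sup>2 * (6 / (2 * \<alpha> - 1) * ?Q) \<le> E * ?P + E * ?Q"
      unfolding mult.assoc[symmetric, of "C\<^sup>2"] using H E by (intro add_mono mult_right_mono) auto
    finally have "ennreal \<bar>cov s u - cov s' u\<bar> \<le> ennreal (E * ?P + E * ?Q)" by (simp add: ennreal_leI)
    moreover have "0 \<le> E * ?P + E * ?Q" using E H by auto
    ultimately have "\<bar>cov s u - cov s' u\<bar> \<le> E * ?P + E * ?Q" by simp
    then show ?thesis by (simp only: distrib_left)
  qed
  from that[OF E(1) this] show thesis .
qed

text \<open>With both times to the right of \<open>u\<close>, the integration range is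
  \<open>{0<..u}\<close> for both, so there is no strip term. The factor 2 replaces
  \<open>s' - u\<close> by \<open>s - u\<close>, which is larger by at most
  \<open>h\<close>.\<close>

lemma cov_diff_le_left:
  obtains C where "0 \<le> C" "\<And>s' s u h. 0 \<le> u \<Longrightarrow> u \<le> s' \<Longrightarrow> s' \<le> s \<Longrightarrow> s \<le> T \<Longrightarrow> s - s' \<le> h \<Longrightarrow> 0 < h \<Longrightarrow>
    \<bar>cov s u - cov s' u\<bar> \<le> C * (h * (h + (s - u)) powr (2 * \<alpha> - 2))"
proof -
  obtain D where D: "0 \<le> D" "\<And>a d h p. 0 \<le> a \<Longrightarrow> 0 \<le> d \<Longrightarrow> d \<le> h \<Longrightarrow> 0 < h \<Longrightarrow> 0 \<le> p \<Longrightarrow> a + d + p \<le> T \<Longrightarrow>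
    (\<integral>\<^sup>+r. ennreal (indicator {0<..p} r * (\<bar>R r\<bar> * \<bar>R (a + d + r) - R (a + r)\<bar>)) \<partial>lborel)
      \<le> ennreal (D * (h * (h + a) powr (2 * \<alpha> - 2)))"
    by (fact shift_bound)
  have "\<bar>cov s u - cov s' u\<bar> \<le> (2 * D) * (h * (h + (s - u)) powr (2 * \<alpha> - 2))"
    if H: "0 \<le> u" "u \<le> s'" "s' \<le> s" "s \<le> T" "s - s' \<le> h" "0 < h" for s' s u h
  proof -
    let ?F = "\<lambda>s r. indicator {0<..u} r * (R r * R (s - u + r))"
    let ?G2 = "\<lambda>r. indicator {0<..u} r * (\<bar>R r\<bar> * \<bar>R ((s' - u) + (s - s') + r) - R ((s' - u) + r)\<bar>)"
    have F: "cov s u = integral\<^sup>L lborel (?F s)" "integrable lborel (?F s)"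
      "cov s' u = integral\<^sup>L lborel (?F s')" "integrable lborel (?F s')"
      using cov_shift[of u "s - u"] cov_shift[of u "s' - u"] H by (auto simp: cov_commute)
    have pt: "\<bar>?F s r - ?F s' r\<bar> = ?G2 r" for r
      by (auto simp: indicator_def abs_mult simp flip: right_diff_distrib)
    have "ennreal \<bar>cov s u - cov s' u\<bar> = ennreal (norm (\<integral>r. ?F s r - ?F s' r \<partial>lborel))"
      using F by simp
    also have "\<dots> \<le> (\<integral>\<^sup>+r. ennreal (norm (?F s r - ?F s' r)) \<partial>lborel)"
      using F by (intro integral_norm_bound_ennreal) auto
    also have "\<dots> = (\<integral>\<^sup>+r. ennreal (?G2 r) \<partial>lborel)"
      unfolding real_norm_def pt ..
    also have "\<dots> \<le> ennreal (D * (h * (h + (s' - u)) powr (2 * \<alpha> - 2)))"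
      using H by (intro D(2)) auto
    also have "D * (h * (h + (s' - u)) powr (2 * \<alpha> - 2)) \<le> D * (h * (2 * (h + (s - u)) powr (2 * \<alpha> - 2)))"
      using H D(1) alpha_gt alpha_le by (intro mult_left_mono powr_le_scaled) auto
    finally have "ennreal \<bar>cov s u - cov s' u\<bar> \<le> ennreal (D * (h * (2 * (h + (s - u)) powr (2 * \<alpha> - 2))))"
      by (simp add: ennreal_leI)
    then show ?thesis using D(1) H by (subst (asm) ennreal_le_iff) (simp_all add: mult_ac)
  qed
  moreover have "0 \<le> 2 * D" using D by simp
  ultimately show thesis using that by blast
qed

text \<open>The two one-sided estimates cover all positions of \<open>u\<close> except strictly
  between \<open>s'\<close> and \<open>s\<close>; there the increment is split at
  \<open>u\<close>.\<close>

lemma cov_diff_le: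
  obtains C where "0 \<le> C" "\<And>s' s u h. 0 \<le> s' \<Longrightarrow> s' \<le> s \<Longrightarrow> s \<le> T \<Longrightarrow> 0 \<le> u \<Longrightarrow> u \<le> T \<Longrightarrow> s - s' \<le> h \<Longrightarrow> 0 < h \<Longrightarrow>
    \<bar>cov s u - cov s' u\<bar> \<le> C * (h * (h + \<bar>s - u\<bar>) powr (2 * \<alpha> - 2) + h * (h + s) powr (2 * \<alpha> - 2))"
proof -
  obtain C1 where C1: "0 \<le> C1" "\<And>s' s u h. 0 \<le> s' \<Longrightarrow> s' \<le> s \<Longrightarrow> s \<le> u \<Longrightarrow> u \<le> T \<Longrightarrow> s - s' \<le> h \<Longrightarrow> 0 < h \<Longrightarrow>
    \<bar>cov s u - cov s' u\<bar> \<le> C1 * (h * (h + (u - s)) powr (2 * \<alpha> - 2) + h * (h + s) powr (2 * \<alpha> - 2))"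
    by (fact cov_diff_le_right)
  obtain C2 where C2: "0 \<le> C2" "\<And>s' s u h. 0 \<le> u \<Longrightarrow> u \<le> s' \<Longrightarrow> s' \<le> s \<Longrightarrow> s \<le> T \<Longrightarrow> s - s' \<le> h \<Longrightarrow> 0 < h \<Longrightarrow>
    \<bar>cov s u - cov s' u\<bar> \<le> C2 * (h * (h + (s - u)) powr (2 * \<alpha> - 2))"
    by (fact cov_diff_le_left)
  have "\<bar>cov s u - cov s' u\<bar> \<le> (2 * C1 + C2) * (h * (h + \<bar>s - u\<bar>) powr (2 * \<alpha> - 2) + h * (h + s) powr (2 * \<alpha> - 2))"
    if H: "0 \<le> s'" "s' \<le> s" "s \<le> T" "0 \<le> u" "u \<le> T" "s - s' \<le> h" "0 < h" for s' s u h
  proof -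
    let ?P = "h * (h + \<bar>s - u\<bar>) powr (2 * \<alpha> - 2)" and ?Q = "h * (h + s) powr (2 * \<alpha> - 2)"
    have PQ: "0 \<le> ?P" "0 \<le> ?Q" using H by auto
    have C1P: "0 \<le> C1 * (?P + ?Q)" and C2P: "0 \<le> C2 * (?P + ?Q)" using PQ C1 C2 by (auto intro!: mult_nonneg_nonneg)
    have C2le: "C2 * ?P \<le> C2 * (?P + ?Q)" using PQ C2 by (intro mult_left_mono) auto
    have D: "(2 * C1 + C2) * (?P + ?Q) = C1 * (?P + ?Q) + C1 * (?P + ?Q) + C2 * (?P + ?Q)"
      by (simp add: algebra_simps)
    consider "s \<le> u" | "u \<le> s'" | "s' < u" "u < s" by linarith
    then show ?thesis
    proof cases
      case 1
      then have e: "\<bar>s - u\<bar> = u - s" by simp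
      have "\<bar>cov s u - cov s' u\<bar> \<le> C1 * (?P + ?Q)" using C1(2)[of s' s u h] 1 H unfolding e by blast
      then show ?thesis using C1P C2P unfolding D by linarith
    next
      case 2
      then have e: "\<bar>s - u\<bar> = s - u" using H by simp
      have "\<bar>cov s u - cov s' u\<bar> \<le> C2 * ?P" using C2(2)[of u s' s h] 2 H unfolding e by blast
      then show ?thesis using C1P C2P C2le unfolding D by linarith
    next
      \<comment> \<open>Both pieces have length at most \<open>h\<close>, and
        \<open>s - u \<le> h\<close>, so the scales seen from \<open>u\<close> differ from those
        seen from \<open>s\<close> by a factor of at most 2.\<close>
      case 3
      have e: "\<bar>s - u\<bar> = s - u" using 3 by simp
      have "\<bar>cov s u - cov u u\<bar> \<le> C2 * ?P" using C2(2)[of u u s h] 3 H unfolding e by auto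
      moreover have "\<bar>cov u u - cov s' u\<bar> \<le> C1 * (2 * (?P + ?Q))"
      proof -
        have "\<bar>cov u u - cov s' u\<bar> \<le> C1 * (h * h powr (2 * \<alpha> - 2) + h * (h + u) powr (2 * \<alpha> - 2))"
          using C1(2)[of s' u u h] 3 H by auto
        also have "\<dots> \<le> C1 * (h * (2 * (h + \<bar>s - u\<bar>) powr (2 * \<alpha> - 2)) + h * (2 * (h + s) powr (2 * \<alpha> - 2)))"
          using 3 H C1 alpha_gt alpha_le by (intro mult_left_mono add_mono powr_le_scaled) auto
        finally show ?thesis by (simp add: algebra_simps)
      qed
      ultimately show ?thesis using C2le unfolding D by (simp add: algebra_simps)
    qed
  qed
  moreover have "0 \<le> 2 * C1 + C2" using C1 C2 by simp
  ultimately show thesis using that by blast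
qed

section \<open>The order of the integrated local error\<close>

text \<open>The order of the local error for the step size \<open>h\<close>; with \<open>h = T / n\<close> it is comparable to
  \<open>euler_rate \<alpha> n + 1 / n\<close>. Note that \<open>euler_rate (2 / 3) 1 = 0\<close>.\<close>

definition srate :: "real \<Rightarrow> real" where
  "srate h = (if \<alpha> > 2 / 3 then h else if \<alpha> = 2 / 3 then h * (1 + ln (T / h)) else h powr (3 * \<alpha> - 1))"

lemma nn_integral_L_reflect:
  assumes [measurable]: "f \<in> borel_measurable borel"
  shows "(\<integral>\<^sup>+s. f (t - s) \<partial>L) \<le> (\<integral>\<^sup>+x. f x \<partial>lborel)"
proof -
  have "(\<integral>\<^sup>+s. f (t - s) \<partial>L) \<le> (\<integral>\<^sup>+s. f (t + (-1) * s) \<partial>lborel)"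
    unfolding nn_integral_L by (intro nn_integral_mono) (auto simp: indicator_def)
  also have "\<dots> = (\<integral>\<^sup>+x. f x \<partial>lborel)"
    by (subst (2) nn_integral_real_affine[where c = "-1" and t = t]) auto
  finally show ?thesis .
qed

lemma nn_integral_L_shift:
  assumes [measurable]: "f \<in> borel_measurable borel"
  shows "(\<integral>\<^sup>+s. f (t + s) \<partial>L) \<le> (\<integral>\<^sup>+x. f x \<partial>lborel)"
proof -
  have "(\<integral>\<^sup>+s. f (t + s) \<partial>L) \<le> (\<integral>\<^sup>+s. f (t + 1 * s) \<partial>lborel)"
    unfolding nn_integral_L by (intro nn_integral_mono) (auto simp: indicator_def)
  also have "\<dots> = (\<integral>\<^sup>+x. f x \<partial>lborel)"
    by (subst (2) nn_integral_real_affine[where c = 1 and t = t]) auto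
  finally show ?thesis .
qed

text \<open>The three regimes of the rate originate here: the exponent 3 \<alpha> - 3 is above, at
  or below -1 according to the position of \<alpha> relative to 2/3. The range ends at
  \<open>2 * T\<close> because it must contain \<open>h + \<bar>s - u\<bar>\<close>.\<close>

lemma tail_integral:
  obtains C J where "0 \<le> C" "\<And>h. 0 < h \<Longrightarrow> h \<le> T \<Longrightarrow> 0 \<le> J h"
    "\<And>h. 0 < h \<Longrightarrow> h \<le> T \<Longrightarrow> (\<integral>\<^sup>+x. ennreal (indicator {h..2 * T} x * x powr (3 * \<alpha> - 3)) \<partial>lborel) \<le> ennreal (J h)"
    "\<And>h. 0 < h \<Longrightarrow> h \<le> T \<Longrightarrow> h * J h \<le> C * srate h"
    "\<And>h. 0 < h \<Longrightarrow> h \<le> T \<Longrightarrow> h powr (3 * \<alpha> - 1) \<le> C * srate h"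
proof -
  consider "\<alpha> > 2 / 3" | "\<alpha> = 2 / 3" | "\<alpha> < 2 / 3" by linarith
  then show thesis
  proof cases
    case 1
    let ?J = "(2 * T) powr (3 * \<alpha> - 2) / (3 * \<alpha> - 2)"
    show thesis
    proof (rule that[of "?J + T powr (3 * \<alpha> - 2)" "\<lambda>_. ?J"])
      show "(\<integral>\<^sup>+x. ennreal (indicator {h..2 * T} x * x powr (3 * \<alpha> - 3)) \<partial>lborel) \<le> ennreal ?J"
        if "0 < h" "h \<le> T" for h
      proof -
        have "(\<integral>\<^sup>+x. ennreal (indicator {h..2 * T} x * x powr (3 * \<alpha> - 3)) \<partial>lborel)
          \<le> (\<integral>\<^sup>+x. ennreal (indicator {0<..2 * T} x * x powr (3 * \<alpha> - 3)) \<partial>lborel)"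
          using that by (intro nn_integral_mono) (auto simp: indicator_def)
        also have "\<dots> = ennreal ((2 * T) powr (3 * \<alpha> - 3 + 1) / (3 * \<alpha> - 3 + 1))"
          using 1 T_pos by (intro nn_integral_powr_Ioc) auto
        finally show ?thesis by simp
      qed
      show "h powr (3 * \<alpha> - 1) \<le> (?J + T powr (3 * \<alpha> - 2)) * srate h" if "0 < h" "h \<le> T" for h
      proof -
        have "h powr (3 * \<alpha> - 1) = h powr (3 * \<alpha> - 2) * h"
          using powr_mult_base[of h "3 * \<alpha> - 2"] that by (simp add: mult.commute)
        also have "\<dots> \<le> T powr (3 * \<alpha> - 2) * h" using that 1 by (intro mult_right_mono powr_mono2) auto
        also have "\<dots> \<le> (?J + T powr (3 * \<alpha> - 2)) * srate h"
          using that 1 by (simp add: srate_def mult_right_mono)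
        finally show ?thesis .
      qed
    qed (use 1 in \<open>auto simp: srate_def algebra_simps\<close>)
  next
    case 2
    show thesis
    proof (rule that[of "1" "\<lambda>h. ln (2 * T) - ln h"])
      show "(\<integral>\<^sup>+x. ennreal (indicator {h..2 * T} x * x powr (3 * \<alpha> - 3)) \<partial>lborel) \<le> ennreal (ln (2 * T) - ln h)"
        if "0 < h" "h \<le> T" for h
      proof -
        have "3 * \<alpha> - 3 = -1" using 2 by simp
        then show ?thesis using nn_integral_inverse_Icc[of h "2 * T"] that by simp
      qed
      show "h * (ln (2 * T) - ln h) \<le> 1 * srate h" if "0 < h" "h \<le> T" for h
      proof -
        have "ln (2 * T) - ln h = ln 2 + ln (T / h)" using that by (simp add: ln_mult ln_div)
        also have "\<dots> \<le> 1 + ln (T / h)" using ln_2_less_1 by simp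
        finally show ?thesis using that 2 by (simp add: srate_def)
      qed
      show "h powr (3 * \<alpha> - 1) \<le> 1 * srate h" if "0 < h" "h \<le> T" for h
      proof -
        have e: "3 * \<alpha> - 1 = 1" using 2 by simp
        have "h * 1 \<le> h * (1 + ln (T / h))" using that by (intro mult_left_mono) auto
        then show ?thesis unfolding e using that 2 by (simp add: srate_def)
      qed
    qed auto
  next
    case 3
    show thesis
    proof (rule that[of "1 / (2 - 3 * \<alpha>) + 1" "\<lambda>h. h powr (3 * \<alpha> - 2) / (2 - 3 * \<alpha>)"])
      show "(\<integral>\<^sup>+x. ennreal (indicator {h..2 * T} x * x powr (3 * \<alpha> - 3)) \<partial>lborel) \<le> ennreal (h powr (3 * \<alpha> - 2) / (2 - 3 * \<alpha>))"
        if "0 < h" "h \<le> T" for h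
      proof -
        have "(\<integral>\<^sup>+x. ennreal (indicator {h..2 * T} x * x powr (3 * \<alpha> - 3)) \<partial>lborel)
          \<le> (\<integral>\<^sup>+x. ennreal (indicator {h..} x * x powr (3 * \<alpha> - 3)) \<partial>lborel)"
          by (intro nn_integral_mono) (auto simp: indicator_def)
        also have "\<dots> = ennreal (h powr (3 * \<alpha> - 3 + 1) / - (3 * \<alpha> - 3 + 1))"
          using 3 that by (intro nn_integral_powr_Ici) auto
        finally show ?thesis by simp
      qed
      show "h * (h powr (3 * \<alpha> - 2) / (2 - 3 * \<alpha>)) \<le> (1 / (2 - 3 * \<alpha>) + 1) * srate h" if "0 < h" "h \<le> T" for h
        using powr_mult_base[of h "3 * \<alpha> - 2"] that 3 by (simp add: srate_def algebra_simps)
    qed (use 3 in \<open>auto simp: srate_def algebra_simps\<close>)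
  qed
qed

text \<open>The singularities at \<open>s = t\<close> and \<open>s = u\<close> may be arbitrarily
  close. Evaluating both powers at the smaller of the two distances gives one power of exponent 3
  \<alpha> - 3, whatever the position of \<open>u\<close>. Within \<open>h\<close> of
  \<open>t\<close> the second power is frozen at \<open>h\<close> instead, which contributes h^(3
  \<alpha> - 1).\<close>

lemma conv_bound:
  obtains C where "0 \<le> C" "\<And>h t u. 0 < h \<Longrightarrow> h \<le> T \<Longrightarrow> t \<le> T \<Longrightarrow> 0 \<le> u \<Longrightarrow> u \<le> T \<Longrightarrow>
    (\<integral>\<^sup>+s. ennreal (K (t - s) * (h * (h + \<bar>s - u\<bar>) powr (2 * \<alpha> - 2))) \<partial>L) \<le> ennreal (C * srate h)"
proof -
  obtain C J where C: "0 \<le> C" and J: "\<And>h. 0 < h \<Longrightarrow> h \<le> T \<Longrightarrow> 0 \<le> J h"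
    "\<And>h. 0 < h \<Longrightarrow> h \<le> T \<Longrightarrow> (\<integral>\<^sup>+x. ennreal (indicator {h..2 * T} x * x powr (3 * \<alpha> - 3)) \<partial>lborel) \<le> ennreal (J h)"
    "\<And>h. 0 < h \<Longrightarrow> h \<le> T \<Longrightarrow> h * J h \<le> C * srate h"
    and P: "\<And>h. 0 < h \<Longrightarrow> h \<le> T \<Longrightarrow> h powr (3 * \<alpha> - 1) \<le> C * srate h"
    by (fact tail_integral)
  define D where "D = (C / \<alpha> + 3 * C) / Gamma \<alpha>"
  have D: "0 \<le> D" using C alpha_gt less_imp_le[OF Gamma_alpha_pos] by (simp add: D_def)
  have "(\<integral>\<^sup>+s. ennreal (K (t - s) * (h * (h + \<bar>s - u\<bar>) powr (2 * \<alpha> - 2))) \<partial>L) \<le> ennreal (D * srate h)"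
    if H: "0 < h" "h \<le> T" "t \<le> T" "0 \<le> u" "u \<le> T" for h t u
  proof -
    let ?g = "\<lambda>x. indicator {h..2 * T} x * x powr (3 * \<alpha> - 3)"
    let ?k = "\<lambda>x. indicator {0<..h} x * x powr (\<alpha> - 1)"
    \<comment> \<open>The last two terms are the power of \<open>h + \<bar>s - u\<bar>\<close>, one
      for each sign of \<open>s - u\<close>; in this form each is a shifted or reflected
      tail.\<close>
    let ?f = "\<lambda>s. h powr (2 * \<alpha> - 2) * ?k (t - s) + (?g (t - s) + (?g (h - u + s) + ?g (h + u - s)))"
    have pt: "tpow (\<alpha> - 1) (t - s) * (h + \<bar>s - u\<bar>) powr (2 * \<alpha> - 2) \<le> ?f s" if s: "s \<in> {0..T}" for s
    proof (cases "0 < t - s")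
      case False
      then show ?thesis by (simp add: tpow_def add_nonneg_nonneg)
    next
      case True
      define x z where "x = t - s" and "z = h + \<bar>s - u\<bar>"
      have x: "0 < x" "x \<le> T" and z: "h \<le> z" "z \<le> 2 * T" using True H s by (auto simp: x_def z_def)
      have gz: "z powr (3 * \<alpha> - 3) \<le> ?g (h - u + s) + ?g (h + u - s)"
        using z by (cases "u \<le> s") (auto simp: z_def indicator_def algebra_simps)
      have gz0: "0 \<le> ?g (h - u + s) + ?g (h + u - s)" by simp
      have "x powr (\<alpha> - 1) * z powr (2 * \<alpha> - 2) \<le> h powr (2 * \<alpha> - 2) * ?k x + (?g x + z powr (3 * \<alpha> - 3))"
      proof (cases "x \<le> h")
        case True
        have "x powr (\<alpha> - 1) * z powr (2 * \<alpha> - 2) \<le> x powr (\<alpha> - 1) * h powr (2 * \<alpha> - 2)"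
          using z H alpha_le by (intro mult_left_mono powr_mono2') auto
        then show ?thesis using True x by (simp add: mult.commute add_nonneg_nonneg add_increasing2)
      next
        case False
        show ?thesis
        proof (cases "x \<le> z")
          case True
          have "x powr (\<alpha> - 1) * z powr (2 * \<alpha> - 2) \<le> x powr (\<alpha> - 1) * x powr (2 * \<alpha> - 2)"
            using True x alpha_le by (intro mult_left_mono powr_mono2') auto
          also have "\<dots> = ?g x" using False x by (simp add: powr_add[symmetric])
          finally show ?thesis by (simp add: add_increasing2 add_increasing)
        next
          case xz: False
          have "x powr (\<alpha> - 1) * z powr (2 * \<alpha> - 2) \<le> z powr (\<alpha> - 1) * z powr (2 * \<alpha> - 2)"
            using xz z H alpha_le by (intro mult_right_mono powr_mono2') auto
          also have "\<dots> = z powr (3 * \<alpha> - 3)" by (simp add: powr_add[symmetric])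
          finally show ?thesis by (simp add: add_increasing2 add_increasing)
        qed
      qed
      then show ?thesis using gz True by (simp add: tpow_def x_def[symmetric] z_def[symmetric])
    qed
    have Ik: "(\<integral>\<^sup>+s. ennreal (?k (t - s)) \<partial>L) \<le> ennreal (h powr \<alpha> / \<alpha>)"
      by (rule nn_integral_L_reflect[of "\<lambda>x. ennreal (?k x)" t, THEN order.trans])
         (use nn_integral_powr_Ioc[of "\<alpha> - 1" h] H alpha_gt in auto)
    have Ig: "(\<integral>\<^sup>+s. ennreal (?g (c - s)) \<partial>L) \<le> ennreal (J h)" for c
      by (rule nn_integral_L_reflect[of "\<lambda>x. ennreal (?g x)" c, THEN order.trans]) (use J H in auto)
    have Ig': "(\<integral>\<^sup>+s. ennreal (?g (c + s)) \<partial>L) \<le> ennreal (J h)" for c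
      by (rule nn_integral_L_shift[of "\<lambda>x. ennreal (?g x)" c, THEN order.trans]) (use J H in auto)
    have hG: "0 \<le> h / Gamma \<alpha>" using H less_imp_le[OF Gamma_alpha_pos] by simp
    have "(\<integral>\<^sup>+s. ennreal (K (t - s) * (h * (h + \<bar>s - u\<bar>) powr (2 * \<alpha> - 2))) \<partial>L)
      \<le> (\<integral>\<^sup>+s. ennreal (h / Gamma \<alpha> * ?f s) \<partial>L)"
    proof (intro nn_integral_mono ennreal_leI)
      fix s assume "s \<in> space L"
      then have "s \<in> {0..T}" by simp
      from mult_left_mono[OF pt[OF this] hG]
      show "K (t - s) * (h * (h + \<bar>s - u\<bar>) powr (2 * \<alpha> - 2)) \<le> h / Gamma \<alpha> * ?f s"
        unfolding K_def by (simp only: times_divide_eq_left times_divide_eq_right mult_ac)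
    qed
    also have "\<dots> \<le> ennreal (h / Gamma \<alpha> * (h powr (2 * \<alpha> - 2) * (h powr \<alpha> / \<alpha>) + (J h + (J h + J h))))"
      using hG H J(1)[of h] alpha_gt by (intro nn_bound_cmult nn_bound_add Ik Ig Ig') auto
    also have "h / Gamma \<alpha> * (h powr (2 * \<alpha> - 2) * (h powr \<alpha> / \<alpha>) + (J h + (J h + J h)))
        = (h powr (3 * \<alpha> - 1) / \<alpha> + 3 * (h * J h)) / Gamma \<alpha>"
    proof -
      have "h * (h powr (2 * \<alpha> - 2) * (h powr \<alpha>)) = h powr (3 * \<alpha> - 1)"
        using powr_mult_base[of h "3 * \<alpha> - 2"] H by (simp add: powr_add[symmetric])
      then show ?thesis by (simp add: distrib_left add_divide_distrib mult_ac)
    qed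
    also have "\<dots> \<le> (C * srate h / \<alpha> + 3 * (C * srate h)) / Gamma \<alpha>"
      using P J(3) H alpha_gt less_imp_le[OF Gamma_alpha_pos] by (intro divide_right_mono add_mono mult_left_mono) auto
    also have "\<dots> = D * srate h" by (simp add: D_def add_divide_distrib algebra_simps)
    finally show ?thesis by (simp add: ennreal_leI)
  qed
  from that[OF D this] show thesis .
qed

end

section \<open>The time grid\<close>

lemma grid_floor_bounds:
  assumes "0 < T" "1 \<le> n" "0 \<le> s"
  shows "0 \<le> grid_floor T n s" "grid_floor T n s \<le> s" "s - grid_floor T n s \<le> T / real n"
proof -
  have f: "0 \<le> s * real n / T" using assms by simp
  have j: "real (nat \<lfloor>s * real n / T\<rfloor>) \<le> s * real n / T" "s * real n / T < real (nat \<lfloor>s * real n / T\<rfloor>) + 1"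
    using f by linarith+
  have g: "grid_floor T n s = real (nat \<lfloor>s * real n / T\<rfloor>) * (T / real n)"
    by (simp add: grid_floor_def grid_point_def)
  have s: "s = (s * real n / T) * (T / real n)" using assms by simp
  have Tn: "0 < T / real n" using assms by simp
  show "0 \<le> grid_floor T n s" unfolding g using Tn by (intro mult_nonneg_nonneg) auto
  show "grid_floor T n s \<le> s"
    by (subst (2) s, unfold g, intro mult_right_mono j(1)) (use Tn in simp)
  have "s \<le> (real (nat \<lfloor>s * real n / T\<rfloor>) + 1) * (T / real n)"
    by (subst s, intro mult_right_mono less_imp_le[OF j(2)]) (use Tn in simp)
  then show "s - grid_floor T n s \<le> T / real n" unfolding g by (simp add: algebra_simps)
qed

lemma grid_floor_measurable [measurable]: "grid_floor T n \<in> borel_measurable borel"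
  unfolding grid_floor_def grid_point_def by measurable

lemma grid_floor_index_less:
  assumes "0 < T" "1 \<le> n" "0 \<le> s" "s < grid_point T n k"
  shows "nat \<lfloor>s * real n / T\<rfloor> < k"
proof -
  have "s * real n / T < real k"
    using assms by (simp add: grid_point_def field_simps)
  moreover have "0 \<le> s * real n / T" using assms by simp
  ultimately show ?thesis by linarith
qed

lemma grid_point_range:
  assumes "0 < T" "1 \<le> n" "k \<le> n"
  shows "grid_point T n k \<in> {0..T}"
  using assms by (auto simp: grid_point_def field_simps)

section \<open>Local errors, equations for means and covariances, and a discrete Gronwall
  inequality\<close>

context fractional
begin

lemma eta_range: "1 \<le> n \<Longrightarrow> s \<in> {0..T} \<Longrightarrow> grid_floor T n s \<in> {0..T}"
  using grid_floor_bounds[OF T_pos, of n s] by auto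

lemma K_bounded_integrable:
  assumes [measurable]: "f \<in> borel_measurable L" and "\<And>s. s \<in> {0..T} \<Longrightarrow> \<bar>f s\<bar> \<le> B" "t \<le> T"
  shows "integrable L (\<lambda>s. K (t - s) * f s)" "\<bar>\<integral>s. K (t - s) * f s \<partial>L\<bar> \<le> KI * B"
proof -
  have B: "0 \<le> B" using assms(2)[of 0] T_pos by auto
  have le: "\<bar>K (t - s) * f s\<bar> \<le> K (t - s) * B" if "s \<in> {0..T}" for s
    using assms(2)[OF that] by (auto simp: abs_mult intro!: mult_left_mono)
  have i: "integrable L (\<lambda>s. K (t - s) * B)" using K_integrable assms by auto
  show 1: "integrable L (\<lambda>s. K (t - s) * f s)"
    by (rule Bochner_Integration.integrable_bound[OF i]) (use le B in \<open>auto simp: abs_mult\<close>)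
  have "\<bar>\<integral>s. K (t - s) * f s \<partial>L\<bar> \<le> (\<integral>s. K (t - s) * B \<partial>L)"
    using 1 i le by (intro integral_abs_bound[THEN order.trans] integral_mono) auto
  also have "\<dots> \<le> KI * B" using K_integral_le[OF assms(3)] B by (simp add: mult_right_mono)
  finally show "\<bar>\<integral>s. K (t - s) * f s \<partial>L\<bar> \<le> KI * B" .
qed

text \<open>The second term of the increment bound, with \<open>h + s\<close>, is the first one for
  \<open>u = 0\<close>, so the convolution bound is used twice; hence \<open>D + D\<close>.\<close>

lemma cov_local_error:
  obtains C where "0 \<le> C"
    "\<And>n t u. 1 \<le> n \<Longrightarrow> t \<le> T \<Longrightarrow> u \<in> {0..T} \<Longrightarrow>
      \<bar>\<integral>s. K (t - s) * (cov s u - cov (grid_floor T n s) u) \<partial>L\<bar> \<le> C * srate (T / real n)"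
proof -
  obtain C where C: "0 \<le> C" "\<And>s' s u h. 0 \<le> s' \<Longrightarrow> s' \<le> s \<Longrightarrow> s \<le> T \<Longrightarrow> 0 \<le> u \<Longrightarrow> u \<le> T \<Longrightarrow> s - s' \<le> h \<Longrightarrow> 0 < h \<Longrightarrow>
    \<bar>cov s u - cov s' u\<bar> \<le> C * (h * (h + \<bar>s - u\<bar>) powr (2 * \<alpha> - 2) + h * (h + s) powr (2 * \<alpha> - 2))"
    by (fact cov_diff_le)
  obtain D where D: "0 \<le> D" "\<And>h t u. 0 < h \<Longrightarrow> h \<le> T \<Longrightarrow> t \<le> T \<Longrightarrow> 0 \<le> u \<Longrightarrow> u \<le> T \<Longrightarrow>
    (\<integral>\<^sup>+s. ennreal (K (t - s) * (h * (h + \<bar>s - u\<bar>) powr (2 * \<alpha> - 2))) \<partial>L) \<le> ennreal (D * srate h)"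
    by (fact conv_bound)
  obtain B where B: "\<And>s u. s \<le> T \<Longrightarrow> u \<le> T \<Longrightarrow> \<bar>cov s u\<bar> \<le> B" using cov_bound by metis
  have "\<bar>\<integral>s. K (t - s) * (cov s u - cov (grid_floor T n s) u) \<partial>L\<bar> \<le> (C * (D + D)) * srate (T / real n)"
    if H: "1 \<le> n" "t \<le> T" "u \<in> {0..T}" for n t u
  proof -
    define h where "h = T / real n"
    have h: "0 < h" "h \<le> T" using H T_pos by (auto simp: h_def field_simps)
    let ?F = "\<lambda>s. K (t - s) * (cov s u - cov (grid_floor T n s) u)"
    let ?P = "\<lambda>u s. K (t - s) * (h * (h + \<bar>s - u\<bar>) powr (2 * \<alpha> - 2))"
    have sr: "0 \<le> srate h" using h by (auto simp: srate_def intro!: mult_nonneg_nonneg add_nonneg_nonneg)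
    have i: "integrable L ?F"
    proof (rule K_bounded_integrable(1))
      show "\<bar>cov s u - cov (grid_floor T n s) u\<bar> \<le> 2 * B" if "s \<in> {0..T}" for s
        using B[of s u] B[of "grid_floor T n s" u] H eta_range[OF H(1) that] that by auto
    qed (use H in measurable)
    have pt: "\<bar>?F s\<bar> \<le> C * (?P u s + ?P 0 s)" if s: "s \<in> {0..T}" for s
    proof -
      have "\<bar>cov s u - cov (grid_floor T n s) u\<bar> \<le> C * (h * (h + \<bar>s - u\<bar>) powr (2 * \<alpha> - 2) + h * (h + s) powr (2 * \<alpha> - 2))"
        using C(2)[of "grid_floor T n s" s u h] grid_floor_bounds[OF T_pos H(1), of s] s H h by (auto simp: h_def)
      from mult_left_mono[OF this K_nonneg[of "t - s"]]
      have "\<bar>?F s\<bar> \<le> K (t - s) * (C * (h * (h + \<bar>s - u\<bar>) powr (2 * \<alpha> - 2) + h * (h + s) powr (2 * \<alpha> - 2)))"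
        by (simp only: abs_mult abs_of_nonneg[OF K_nonneg])
      also have "\<dots> = C * (?P u s + ?P 0 s)" using s by (simp add: distrib_left mult_ac)
      finally show ?thesis .
    qed
    have "ennreal \<bar>integral\<^sup>L L ?F\<bar> \<le> (\<integral>\<^sup>+s. ennreal (norm (?F s)) \<partial>L)"
      using integral_norm_bound_ennreal[OF i] by simp
    also have "\<dots> \<le> (\<integral>\<^sup>+s. ennreal (C * (?P u s + ?P 0 s)) \<partial>L)"
      using pt by (intro nn_integral_mono ennreal_leI) simp
    also have "\<dots> \<le> ennreal (C * (D * srate h + D * srate h))"
      using H D h C sr by (intro nn_bound_cmult nn_bound_add D(2)) auto
    finally show ?thesis using C D sr
      by (subst (asm) ennreal_le_iff) (auto simp: h_def algebra_simps)
  qed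
  moreover have "0 \<le> C * (D + D)" using C D by auto
  ultimately show thesis using that by blast
qed

text \<open>Multiply the resolvent equation by \<open>\<phi>\<close> and integrate, exchanging the
  integrals by Fubini. The choices \<open>K (t - v)\<close>, \<open>R (u - v)\<close> and 1 for
  \<open>\<phi> v\<close> give the equations for the mixed covariance, for the covariance and for
  the mean.\<close>

lemma resolvent_transform:
  assumes [measurable]: "\<phi> \<in> borel_measurable borel" and sq: "integrable L (\<lambda>v. (\<phi> v)\<^sup>2)"
    and u: "u \<in> {0..T}"
  shows "(\<integral>v. \<phi> v * R (u - v) \<partial>L) =
    (\<integral>v. \<phi> v * K (u - v) \<partial>L) + \<kappa> * (\<integral>s. K (u - s) * (\<integral>v. \<phi> v * R (s - v) \<partial>L) \<partial>L)"
proof -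
  obtain B where B: "0 \<le> B" "\<And>t. t \<le> T \<Longrightarrow> integrable L (\<lambda>s. (R (t - s))\<^sup>2)"
     "\<And>t. t \<le> T \<Longrightarrow> integrable L (\<lambda>s. (K (t - s))\<^sup>2)"
     "\<And>t. t \<le> T \<Longrightarrow> (\<integral>s. (R (t - s))\<^sup>2 \<partial>L) \<le> B"
    using R_sq_bound by metis
  have iR: "integrable L (\<lambda>v. \<phi> v * R (s - v))" if "s \<le> T" for s
    using B(2) that by (intro square_integrable_mult sq) auto
  have bR: "\<bar>\<integral>v. \<bar>\<phi> v\<bar> * \<bar>R (s - v)\<bar> \<partial>L\<bar> \<le> ((\<integral>x. (\<phi> x)\<^sup>2 \<partial>L) + B) / 2" if "s \<le> T" for s
  proof -
    have "\<bar>\<integral>v. \<bar>\<phi> v\<bar> * \<bar>R (s - v)\<bar> \<partial>L\<bar> \<le> ((\<integral>x. \<bar>\<phi> x\<bar>\<^sup>2 \<partial>L) + (\<integral>x. \<bar>R (s - x)\<bar>\<^sup>2 \<partial>L)) / 2"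
      using B(2)[OF that] sq by (intro square_integrable_mult) (simp_all only: power2_abs, measurable)
    also have "\<dots> \<le> ((\<integral>x. (\<phi> x)\<^sup>2 \<partial>L) + B) / 2"
      using B(4)[OF that] by simp
    finally show ?thesis .
  qed
  have iK: "integrable L (\<lambda>v. \<phi> v * K (u - v))"
    using u B by (intro square_integrable_mult sq) auto
  interpret LL: pair_sigma_finite L L ..
  let ?f = "\<lambda>(s, v). K (u - s) * (\<phi> v * R (s - v))"
  have int: "integrable (L \<Otimes>\<^sub>M L) ?f"
  proof (rule LL.Fubini_integrable)
    show "?f \<in> borel_measurable (L \<Otimes>\<^sub>M L)" by (rule measurable_LL) measurable
    show "AE s in L. integrable L (\<lambda>v. ?f (s, v))"
      using iR by (auto intro!: AE_I2)
    have "integrable L (\<lambda>s. K (u - s) * (\<integral>v. \<bar>\<phi> v\<bar> * \<bar>R (s - v)\<bar> \<partial>L))"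
    proof (rule K_bounded_integrable(1))
      show "(\<lambda>s. \<integral>v. \<bar>\<phi> v\<bar> * \<bar>R (s - v)\<bar> \<partial>L) \<in> borel_measurable L"
        unfolding integral_L by measurable
      show "\<bar>\<integral>v. \<bar>\<phi> v\<bar> * \<bar>R (s - v)\<bar> \<partial>L\<bar> \<le> ((\<integral>x. (\<phi> x)\<^sup>2 \<partial>L) + B) / 2" if "s \<in> {0..T}" for s
        using bR that by auto
    qed (use u in auto)
    then show "integrable L (\<lambda>s. \<integral>v. norm (?f (s, v)) \<partial>L)"
      by (simp add: abs_mult)
  qed
  have "(\<integral>v. (\<integral>s. K (u - s) * (\<phi> v * R (s - v)) \<partial>L) \<partial>L) = (\<integral>s. (\<integral>v. K (u - s) * (\<phi> v * R (s - v)) \<partial>L) \<partial>L)"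
    using LL.Fubini_integral[OF int] by simp
  moreover have "(\<integral>s. K (u - s) * (\<phi> v * R (s - v)) \<partial>L) = \<phi> v * (\<integral>s. K (u - s) * R (s - v) \<partial>L)" for v
    by (subst integral_mult_right_zero[symmetric]) (simp only: mult_ac)
  ultimately have F: "(\<integral>v. \<phi> v * (\<integral>s. K (u - s) * R (s - v) \<partial>L) \<partial>L) = (\<integral>s. K (u - s) * (\<integral>v. \<phi> v * R (s - v) \<partial>L) \<partial>L)"
    by simp
  have iKR: "integrable L (\<lambda>v. \<phi> v * (\<integral>s. K (u - s) * R (s - v) \<partial>L))"
    using LL.integrable_snd[of "\<lambda>s v. K (u - s) * (\<phi> v * R (s - v))"] int
    by (simp add: mult.left_commute[of _ "\<phi> _"])
  have "(\<integral>v. \<phi> v * R (u - v) \<partial>L) = (\<integral>v. \<phi> v * K (u - v) + \<kappa> * (\<phi> v * (\<integral>s. K (u - s) * R (s - v) \<partial>L)) \<partial>L)"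
    using u resolvent_L by (intro Bochner_Integration.integral_cong) (auto simp: algebra_simps)
  also have "\<dots> = (\<integral>v. \<phi> v * K (u - v) \<partial>L) + \<kappa> * (\<integral>v. \<phi> v * (\<integral>s. K (u - s) * R (s - v) \<partial>L) \<partial>L)"
    using iK iKR by (subst Bochner_Integration.integral_add) auto
  finally show ?thesis unfolding F .
qed

definition Kcov :: "real \<Rightarrow> real \<Rightarrow> real" where
  "Kcov s u = (\<integral>v. K (s - v) * K (u - v) \<partial>L)"

text \<open>Up to the factor \<open>\<sigma>\<close>, the covariance of the Wiener integral at
  \<open>s\<close> with the solution at \<open>u\<close>: an intermediate stage between
  \<open>Kcov\<close>, where neither argument is resolved, and \<open>cov\<close>, where both
  are.\<close>

definition mixed_cov :: "real \<Rightarrow> real \<Rightarrow> real" where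
  "mixed_cov s u = (\<integral>v. K (s - v) * R (u - v) \<partial>L)"

lemma mixed_cov_bound:
  obtains B where "0 \<le> B" "\<And>s u. s \<le> T \<Longrightarrow> u \<le> T \<Longrightarrow> \<bar>mixed_cov s u\<bar> \<le> B"
proof -
  obtain B where B: "0 \<le> B" "\<And>t. t \<le> T \<Longrightarrow> integrable L (\<lambda>s. (R (t - s))\<^sup>2)"
     "\<And>t. t \<le> T \<Longrightarrow> integrable L (\<lambda>s. (K (t - s))\<^sup>2)"
     "\<And>t. t \<le> T \<Longrightarrow> (\<integral>s. (R (t - s))\<^sup>2 \<partial>L) \<le> B"
     "\<And>t. t \<le> T \<Longrightarrow> (\<integral>s. (K (t - s))\<^sup>2 \<partial>L) \<le> B"
    using R_sq_bound by metis
  have "\<bar>mixed_cov s u\<bar> \<le> B" if "s \<le> T" "u \<le> T" for s u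
    unfolding mixed_cov_def
    by (rule square_integrable_mult(2)[THEN order.trans])
       (use B(2,3) that add_mono[OF B(5)[OF that(1)] B(4)[OF that(2)]] in auto)
  from that[OF B(1) this] show thesis .
qed

lemma mixed_cov_measurable [measurable]: "(\<lambda>u. mixed_cov s u) \<in> borel_measurable borel"
  unfolding mixed_cov_def integral_L by measurable

lemma mixed_cov_eq:
  assumes "t \<in> {0..T}" "u \<in> {0..T}"
  shows "mixed_cov t u = Kcov t u + \<kappa> * (\<integral>s. K (u - s) * mixed_cov t s \<partial>L)"
  unfolding mixed_cov_def Kcov_def
  by (rule resolvent_transform) (use assms R_sq_bound in \<open>auto intro: R_sq_bound\<close>)

lemma cov_eq:
  assumes "t \<in> {0..T}" "u \<in> {0..T}"
  shows "cov t u = mixed_cov t u + \<kappa> * (\<integral>s. K (t - s) * cov s u \<partial>L)"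
  using resolvent_transform[of "\<lambda>v. R (u - v)" t] assms R_sq_bound
  unfolding mixed_cov_def cov_def by (auto simp: mult.commute intro: R_sq_bound)

definition Rint :: "real \<Rightarrow> real" where "Rint t = (\<integral>v. R (t - v) \<partial>L)"

lemma Rint_measurable [measurable]: "Rint \<in> borel_measurable borel"
  unfolding Rint_def integral_L by measurable

lemma Rint_eq:
  assumes "t \<in> {0..T}"
  shows "Rint t = (\<integral>s. K (t - s) \<partial>L) + \<kappa> * (\<integral>s. K (t - s) * Rint s \<partial>L)"
  using resolvent_transform[of "\<lambda>_. 1" t] assms by (simp add: Rint_def)

lemma Rint_shift:
  assumes "s \<in> {0..T}"
  shows "Rint s = (\<integral>r. indicator {0<..s} r * R r \<partial>lborel)" "integrable lborel (\<lambda>r. indicator {0<..s} r * R r)"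
proof -
  obtain B where B: "\<And>t. t \<le> T \<Longrightarrow> integrable L (\<lambda>s. (R (t - s))\<^sup>2)"
    using R_sq_bound by metis
  have i: "integrable L (\<lambda>v. R (s - v))"
    using square_integrable_mult(1)[of L "\<lambda>_. 1" "\<lambda>v. R (s - v)"] assms B by auto
  let ?f = "\<lambda>v. indicator {0..T} v * R (s - v)"
  have eq: "?f (s + (-1) * r) = indicator {0<..s} r * R r" for r
    using assms by (cases "0 < r") (auto simp: indicator_def R_nonpos algebra_simps)
  show "Rint s = (\<integral>r. indicator {0<..s} r * R r \<partial>lborel)"
    unfolding Rint_def integral_L
    by (subst lborel_integral_real_affine[where c = "-1" and t = s]) (simp_all only: eq, simp_all)
  have "integrable lborel (\<lambda>r. ?f (s + (-1) * r))"
    using i unfolding integrable_L by (subst lborel_integrable_real_affine_iff) auto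
  then show "integrable lborel (\<lambda>r. indicator {0<..s} r * R r)"
    by (simp only: eq)
qed

lemma Rint_diff_le:
  obtains C where "0 \<le> C" "\<And>s' s h. 0 \<le> s' \<Longrightarrow> s' \<le> s \<Longrightarrow> s \<le> T \<Longrightarrow> s - s' \<le> h \<Longrightarrow> 0 < h \<Longrightarrow>
    \<bar>Rint s - Rint s'\<bar> \<le> C * (h * (h + s) powr (\<alpha> - 1))"
proof -
  obtain C where C: "0 < C" "\<And>x. 0 < x \<Longrightarrow> x \<le> T \<Longrightarrow> \<bar>R x\<bar> \<le> C * x powr (\<alpha> - 1)"
    using R_bounds by metis
  have "\<bar>Rint s - Rint s'\<bar> \<le> (C * (6 / \<alpha>)) * (h * (h + s) powr (\<alpha> - 1))"
    if H: "0 \<le> s'" "s' \<le> s" "s \<le> T" "s - s' \<le> h" "0 < h" for s' s h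
  proof -
    have F: "Rint s = (\<integral>r. indicator {0<..s} r * R r \<partial>lborel)" "integrable lborel (\<lambda>r. indicator {0<..s} r * R r)"
      "Rint s' = (\<integral>r. indicator {0<..s'} r * R r \<partial>lborel)" "integrable lborel (\<lambda>r. indicator {0<..s'} r * R r)"
      using Rint_shift[of s] Rint_shift[of s'] H by auto
    have "ennreal \<bar>Rint s - Rint s'\<bar> = ennreal (norm (\<integral>r. indicator {0<..s} r * R r - indicator {0<..s'} r * R r \<partial>lborel))"
      using F by simp
    also have "\<dots> \<le> (\<integral>\<^sup>+r. ennreal (norm (indicator {0<..s} r * R r - indicator {0<..s'} r * R r)) \<partial>lborel)"
      using F by (intro integral_norm_bound_ennreal) auto
    also have "\<dots> \<le> (\<integral>\<^sup>+r. ennreal (C * (indicator {s'<..s} r * r powr (\<alpha> - 1))) \<partial>lborel)"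
      using H C by (intro nn_integral_mono ennreal_leI) (auto simp: indicator_def)
    also have "\<dots> \<le> ennreal (C * (6 / (\<alpha> - 1 + 1) * (h * (h + s) powr (\<alpha> - 1))))"
      using H C(1) alpha_gt alpha_le by (intro nn_bound_cmult strip_bound) auto
    finally show ?thesis
      using C(1) H alpha_gt by (subst (asm) ennreal_le_iff) (auto simp: mult_ac)
  qed
  moreover have "0 \<le> C * (6 / \<alpha>)" using C(1) alpha_gt by simp
  ultimately show thesis using that by blast
qed

lemma Rint_bound: obtains B where "0 \<le> B" "\<And>s. s \<in> {0..T} \<Longrightarrow> \<bar>Rint s\<bar> \<le> B"
proof -
  obtain C where C: "0 \<le> C" "\<And>s' s h. 0 \<le> s' \<Longrightarrow> s' \<le> s \<Longrightarrow> s \<le> T \<Longrightarrow> s - s' \<le> h \<Longrightarrow> 0 < h \<Longrightarrow>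
    \<bar>Rint s - Rint s'\<bar> \<le> C * (h * (h + s) powr (\<alpha> - 1))"
    by (fact Rint_diff_le)
  have 0: "Rint 0 = 0" using Rint_shift(1)[of 0] T_pos by simp
  have "\<bar>Rint s\<bar> \<le> C * (T * T powr (\<alpha> - 1))" if "s \<in> {0..T}" for s
  proof -
    have "\<bar>Rint s\<bar> \<le> C * (T * (T + s) powr (\<alpha> - 1))" using C(2)[of 0 s T] 0 that T_pos by simp
    also have "\<dots> \<le> C * (T * T powr (\<alpha> - 1))"
      using that T_pos C(1) alpha_le by (intro mult_left_mono powr_mono2') auto
    finally show ?thesis .
  qed
  moreover have "0 \<le> C * (T * T powr (\<alpha> - 1))" using C T_pos by simp
  ultimately show thesis using that by blast
qed

text \<open>The increment of \<open>Rint\<close> over a step is at most of order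
  \<open>h * s powr (\<alpha> - 1)\<close>, and convolving this power with \<open>K\<close> gives a
  Beta integral, bounded as \<alpha> > 1/2. The mean therefore has order 1/n in all regimes.\<close>

lemma Rint_local_error:
  obtains C where "0 \<le> C"
    "\<And>n t. 1 \<le> n \<Longrightarrow> t \<in> {0..T} \<Longrightarrow>
      \<bar>\<integral>s. K (t - s) * (Rint s - Rint (grid_floor T n s)) \<partial>L\<bar> \<le> C / real n"
proof -
  obtain C where C: "0 \<le> C" "\<And>s' s h. 0 \<le> s' \<Longrightarrow> s' \<le> s \<Longrightarrow> s \<le> T \<Longrightarrow> s - s' \<le> h \<Longrightarrow> 0 < h \<Longrightarrow>
    \<bar>Rint s - Rint s'\<bar> \<le> C * (h * (h + s) powr (\<alpha> - 1))"
    by (fact Rint_diff_le)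
  define E where "E = C * T * (Beta \<alpha> \<alpha> * T powr (2 * \<alpha> - 1)) / Gamma \<alpha>"
  have "\<bar>\<integral>s. K (t - s) * (Rint s - Rint (grid_floor T n s)) \<partial>L\<bar> \<le> E / real n"
    if H: "1 \<le> n" "t \<in> {0..T}" for n t
  proof -
    define h where "h = T / real n"
    have h: "0 < h" using H T_pos by (simp add: h_def)
    let ?c = "C * h / Gamma \<alpha>"
    let ?g = "\<lambda>s. tpow (\<alpha> - 1) (t - s) * tpow (\<alpha> - 1) (s - 0)"
    have c: "0 \<le> ?c" using C h less_imp_le[OF Gamma_alpha_pos] by simp
    have g: "integrable lborel ?g" "integral\<^sup>L lborel ?g = Beta \<alpha> \<alpha> * tpow (2 * \<alpha> - 1) t"
      using has_bochner_integral_tpow_conv[of \<alpha> \<alpha> t 0] alpha_gt by (auto simp: has_bochner_integral_iff)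
    have pt: "\<bar>indicator {0..T} s * (K (t - s) * (Rint s - Rint (grid_floor T n s)))\<bar> \<le> ?c * ?g s" for s
    proof (cases "0 < s \<and> s \<le> T")
      case False
      \<comment> \<open>At \<open>s = 0\<close> the majorant vanishes by the convention of
        \<open>tpow\<close>, but so does the increment, since 0 is a grid point.\<close>
      have "grid_floor T n 0 = 0" by (simp add: grid_floor_def grid_point_def)
      moreover have "0 \<le> ?c * ?g s" using c by (intro mult_nonneg_nonneg) auto
      ultimately show ?thesis using False by (cases "s = 0") (auto simp: indicator_def)
    next
      case True
      have "\<bar>Rint s - Rint (grid_floor T n s)\<bar> \<le> C * (h * (h + s) powr (\<alpha> - 1))"
        using grid_floor_bounds[OF T_pos H(1), of s] True H h by (intro C(2)) (auto simp: h_def)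
      also have "\<dots> \<le> C * (h * s powr (\<alpha> - 1))"
        using True h C alpha_le by (intro mult_left_mono powr_mono2') auto
      finally have "\<bar>Rint s - Rint (grid_floor T n s)\<bar> \<le> C * (h * s powr (\<alpha> - 1))" .
      from mult_left_mono[OF this K_nonneg[of "t - s"]] show ?thesis
        using True less_imp_le[OF Gamma_alpha_pos] by (auto simp add: abs_mult K_def tpow_def mult_ac)
    qed
    have gi: "integrable lborel (\<lambda>s. ?c * ?g s)" by (intro integrable_mult_right g)
    have "\<bar>\<integral>s. K (t - s) * (Rint s - Rint (grid_floor T n s)) \<partial>L\<bar> \<le> (\<integral>s. ?c * ?g s \<partial>lborel)"
      unfolding integral_L
    proof (rule integral_abs_bound[THEN order.trans], rule integral_mono[OF _ gi pt])
      show "integrable lborel (\<lambda>x. \<bar>indicat_real {0..T} x * (K (t - x) * (Rint x - Rint (grid_floor T n x)))\<bar>)"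
      proof (rule Bochner_Integration.integrable_bound[OF gi])
        show "AE x in lborel. norm \<bar>indicat_real {0..T} x * (K (t - x) * (Rint x - Rint (grid_floor T n x)))\<bar> \<le> norm (?c * ?g x)"
          using order.trans[OF pt abs_ge_self] by (simp only: real_norm_def abs_abs AE_I2)
      qed measurable
    qed
    also have "\<dots> = ?c * (Beta \<alpha> \<alpha> * tpow (2 * \<alpha> - 1) t)" using g by simp
    also have "\<dots> \<le> ?c * (Beta \<alpha> \<alpha> * T powr (2 * \<alpha> - 1))"
      using c H alpha_gt by (intro mult_left_mono) (auto simp: tpow_def Beta_def intro!: powr_mono2)
    also have "\<dots> = E / real n" by (simp add: E_def h_def)
    finally show ?thesis .
  qed
  moreover have "0 \<le> E" using C T_pos alpha_gt less_imp_le[OF Gamma_alpha_pos] by (simp add: E_def Beta_def)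
  ultimately show thesis using that by blast
qed

definition gidx :: "nat \<Rightarrow> real \<Rightarrow> nat" where "gidx n s = nat \<lfloor>s * real n / T\<rfloor>"

lemma grid_floor_gidx: "grid_floor T n s = grid_point T n (gidx n s)"
  by (simp add: gidx_def grid_floor_def)

lemma gidx_measurable [measurable]: "gidx n \<in> borel \<rightarrow>\<^sub>M count_space UNIV"
  unfolding gidx_def by measurable

text \<open>The integral of \<open>K (grid_point T n k - s)\<close> over the cell on which the
  scheme is frozen at the grid point \<open>i\<close>. Selecting the cell by its index makes sums
  over \<open>i\<close> collapse pointwise.\<close>

definition wt :: "nat \<Rightarrow> nat \<Rightarrow> nat \<Rightarrow> real" where
  "wt n k i = (\<integral>s. K (grid_point T n k - s) * (if gidx n s = i then 1 else 0) \<partial>L)"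

lemma wt_nonneg: "0 \<le> wt n k i"
  unfolding wt_def by (intro Bochner_Integration.integral_nonneg) auto

text \<open>The kernel vanishes for \<open>s\<close> from the grid point \<open>k\<close> on, so
  only cells of smaller index contribute: the scheme is explicit. This also excludes
  \<open>s = T\<close>, whose index is \<open>n\<close>.\<close>

lemma grid_integral:
  assumes "1 \<le> n" "k \<le> n"
  shows "integrable L (\<lambda>s. K (grid_point T n k - s) * a (gidx n s))"
    and "(\<integral>s. K (grid_point T n k - s) * a (gidx n s) \<partial>L) = (\<Sum>i<k. wt n k i * a i)"
proof -
  have t: "grid_point T n k \<le> T" using grid_point_range[OF T_pos] assms by auto
  have eq: "K (grid_point T n k - s) * a (gidx n s) =
      (\<Sum>i<k. K (grid_point T n k - s) * (if gidx n s = i then 1 else 0) * a i)" if "s \<in> {0..T}" for s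
  proof (cases "s < grid_point T n k")
    case True
    then have "gidx n s < k" using grid_floor_index_less[OF T_pos assms(1), of s k] that by (simp add: gidx_def)
    then show ?thesis by (simp add: if_distrib[of "\<lambda>x. _ * x"] if_distrib[of "\<lambda>x. x * _"] cong: if_cong)
  qed (simp add: K_def tpow_def)
  have i: "integrable L (\<lambda>s. K (grid_point T n k - s) * (if gidx n s = i then 1 else 0) * a i)" for i
    using K_bounded_integrable(1)[of "\<lambda>s. if gidx n s = i then 1 else 0" 1, OF _ _ t] by (auto cong: if_cong)
  show "integrable L (\<lambda>s. K (grid_point T n k - s) * a (gidx n s))"
    by (subst Bochner_Integration.integrable_cong[OF refl eq]) (auto intro!: i)
  show "(\<integral>s. K (grid_point T n k - s) * a (gidx n s) \<partial>L) = (\<Sum>i<k. wt n k i * a i)"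
  proof -
    have "(\<integral>s. K (grid_point T n k - s) * a (gidx n s) \<partial>L) =
        (\<integral>s. (\<Sum>i<k. K (grid_point T n k - s) * (if gidx n s = i then 1 else 0) * a i) \<partial>L)"
      using eq by (intro Bochner_Integration.integral_cong) auto
    also have "\<dots> = (\<Sum>i<k. (\<integral>s. K (grid_point T n k - s) * (if gidx n s = i then 1 else 0) * a i \<partial>L))"
      by (rule Bochner_Integration.integral_sum) (rule i)
    also have "\<dots> = (\<Sum>i<k. wt n k i * a i)" unfolding wt_def by (simp only: integral_mult_left_zero)
    finally show ?thesis .
  qed
qed

text \<open>The ansatz 2 b exp(l t_k) is carried through a strong induction. Freezing the
  exponential at grid points only lowers it, so the sum is dominated by the continuous weighted
  integral, whose contraction factor 1/2 does not depend on \<open>n\<close>.\<close>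

lemma discrete_gronwall:
  obtains C where "0 \<le> C"
    "\<And>n a b k. 1 \<le> n \<Longrightarrow> 0 \<le> b \<Longrightarrow> (\<And>k. k \<le> n \<Longrightarrow> \<bar>a k\<bar> \<le> \<bar>\<kappa>\<bar> * (\<Sum>i<k. wt n k i * \<bar>a i\<bar>) + b) \<Longrightarrow> k \<le> n \<Longrightarrow> \<bar>a k\<bar> \<le> C * b"
proof -
  obtain l where l: "0 < l" "\<And>t. t \<le> T \<Longrightarrow> \<bar>\<kappa>\<bar> * (\<integral>s. K (t - s) * exp (- l * (t - s)) \<partial>L) \<le> 1 / 2"
    using gronwall_weight by metis
  have "\<bar>a k\<bar> \<le> (2 * exp (l * T)) * b"
    if H: "1 \<le> n" "0 \<le> b" "\<And>k. k \<le> n \<Longrightarrow> \<bar>a k\<bar> \<le> \<bar>\<kappa>\<bar> * (\<Sum>i<k. wt n k i * \<bar>a i\<bar>) + b" "k \<le> n" for n a b k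
  proof -
    let ?t = "grid_point T n"
    have "\<bar>a k\<bar> \<le> 2 * b * exp (l * ?t k)" if "k \<le> n" for k
      using that
    proof (induction k rule: less_induct)
      case (less k)
      have t: "0 \<le> ?t k" "?t k \<le> T" using grid_point_range[OF T_pos H(1) less.prems] by auto
      have "(\<Sum>i<k. wt n k i * \<bar>a i\<bar>) \<le> (\<Sum>i<k. wt n k i * (2 * b * exp (l * ?t i)))"
        using less H by (intro sum_mono mult_left_mono wt_nonneg) auto
      also have "\<dots> = (\<integral>s. K (?t k - s) * (2 * b * exp (l * ?t (gidx n s))) \<partial>L)"
        by (rule grid_integral(2)[OF H(1) less.prems, symmetric])
      also have "\<dots> \<le> (\<integral>s. 2 * b * exp (l * ?t k) * (K (?t k - s) * exp (- l * (?t k - s))) \<partial>L)"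
      proof (rule integral_mono)
        show "integrable L (\<lambda>s. K (?t k - s) * (2 * b * exp (l * ?t (gidx n s))))"
          by (rule grid_integral(1)[OF H(1) less.prems])
        show "integrable L (\<lambda>s. 2 * b * exp (l * ?t k) * (K (?t k - s) * exp (- l * (?t k - s))))"
          using K_exp_integrable[of l "?t k"] l(1) t by simp
        fix s assume "s \<in> space L"
        then have "?t (gidx n s) \<le> s"
          using grid_floor_bounds(2)[OF T_pos H(1), of s] by (simp add: grid_floor_gidx)
        then have "exp (l * ?t (gidx n s)) \<le> exp (l * s)" using l(1) by simp
        also have "\<dots> = exp (l * ?t k) * exp (- l * (?t k - s))" by (simp add: exp_add[symmetric] algebra_simps)
        finally have "K (?t k - s) * (2 * b * exp (l * ?t (gidx n s))) \<le>
            K (?t k - s) * (2 * b * (exp (l * ?t k) * exp (- l * (?t k - s))))"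
          using H(2) by (intro mult_left_mono) auto
        then show "K (?t k - s) * (2 * b * exp (l * ?t (gidx n s))) \<le>
            2 * b * exp (l * ?t k) * (K (?t k - s) * exp (- l * (?t k - s)))" by (simp only: mult_ac)
      qed
      also have "\<dots> = 2 * b * exp (l * ?t k) * (\<integral>s. K (?t k - s) * exp (- l * (?t k - s)) \<partial>L)" by simp
      finally have "\<bar>\<kappa>\<bar> * (\<Sum>i<k. wt n k i * \<bar>a i\<bar>) \<le>
          \<bar>\<kappa>\<bar> * (2 * b * exp (l * ?t k) * (\<integral>s. K (?t k - s) * exp (- l * (?t k - s)) \<partial>L))"
        by (intro mult_left_mono) auto
      also have "\<dots> = 2 * b * exp (l * ?t k) * (\<bar>\<kappa>\<bar> * (\<integral>s. K (?t k - s) * exp (- l * (?t k - s)) \<partial>L))"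
        by (simp only: mult_ac)
      also have "\<dots> \<le> 2 * b * exp (l * ?t k) * (1 / 2)"
        using l(2)[OF t(2)] H(2) by (intro mult_left_mono) auto
      finally have "\<bar>a k\<bar> \<le> b * exp (l * ?t k) + b" using H(3)[OF less.prems] by linarith
      moreover have "b * 1 \<le> b * exp (l * ?t k)" using H(2) l(1) t by (intro mult_left_mono) auto
      ultimately show ?case by simp
    qed
    from this[OF H(4)] have "\<bar>a k\<bar> \<le> 2 * b * exp (l * ?t k)" .
    also have "\<dots> \<le> 2 * b * exp (l * T)"
      using H(2) l(1) grid_point_range[OF T_pos H(1) H(4)] by (intro mult_left_mono) auto
    finally show ?thesis by (simp add: mult_ac)
  qed
  moreover have "0 \<le> 2 * exp (l * T)" by simp
  ultimately show thesis using that by blast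
qed

end

section \<open>The solution\<close>

locale volterra_model = fractional \<alpha> \<kappa> T + brownian_motion M W
  for \<alpha> \<kappa> T :: real and M :: "'a measure" and W +
  fixes x0 \<kappa>1 \<sigma> :: real and X :: "real \<Rightarrow> 'a \<Rightarrow> real" and Xe :: "nat \<Rightarrow> real \<Rightarrow> 'a \<Rightarrow> real"
  assumes solution: "strong_solution M W T x0 \<kappa>1 \<kappa> \<sigma> \<alpha> X"
    and euler: "1 \<le> n \<Longrightarrow> euler_scheme M W T x0 \<kappa>1 \<kappa> \<sigma> \<alpha> n (Xe n)"
begin

lemma frac_kernel_K:
  assumes "t \<le> T"
  shows "indicator {0..t} s * frac_kernel \<alpha> t s = indicator {0..T} s * K (t - s)"
  using assms by (auto simp: indicator_def frac_kernel_def K_def tpow_def)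

lemma volterra_eqE:
  assumes "volterra_eq M W x0 \<kappa>1 \<kappa> \<sigma> \<alpha> V Z t" "t \<in> {0..T}"
  obtains Y where "has_wiener_integral M W (frac_kernel \<alpha> t) t Y"
    "AE \<omega> in M. V t \<omega> = x0 + (\<integral>s. K (t - s) * (\<kappa>1 + \<kappa> * Z s \<omega>) \<partial>L) + \<sigma> * Y \<omega>"
proof -
  from assms(1) obtain Y where Y: "has_wiener_integral M W (frac_kernel \<alpha> t) t Y"
    and e: "AE \<omega> in M. V t \<omega> = x0 + (LBINT s:{0..t}. frac_kernel \<alpha> t s * (\<kappa>1 + \<kappa> * Z s \<omega>)) + \<sigma> * Y \<omega>"
    unfolding volterra_eq_def by auto
  have "(LBINT s:{0..t}. frac_kernel \<alpha> t s * (\<kappa>1 + \<kappa> * Z s \<omega>)) = (\<integral>s. K (t - s) * (\<kappa>1 + \<kappa> * Z s \<omega>) \<partial>L)" for \<omega>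
    unfolding integral_L set_lebesgue_integral_def
    using frac_kernel_K[of t] assms(2)
    by (intro Bochner_Integration.integral_cong) (simp_all add: mult.assoc[symmetric])
  with Y e show thesis using that by simp
qed

text \<open>Each instance of the equation comes with its own version of the Wiener integral.
  Choosing one per time, equal to all others almost surely, makes the noise of solution and scheme
  literally the same, so that it cancels.\<close>

definition Y :: "real \<Rightarrow> 'a \<Rightarrow> real" where
  "Y t = (SOME Y. has_wiener_integral M W (frac_kernel \<alpha> t) t Y)"

lemma Y_wiener:
  assumes "t \<in> {0..T}"
  shows "has_wiener_integral M W (frac_kernel \<alpha> t) t (Y t)"
proof -
  have "volterra_eq M W x0 \<kappa>1 \<kappa> \<sigma> \<alpha> X X t" using solution assms by (simp add: strong_solution_def)
  then obtain Y' where "has_wiener_integral M W (frac_kernel \<alpha> t) t Y'"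
    using assms by (auto elim: volterra_eqE)
  then show ?thesis unfolding Y_def by (rule someI[of "has_wiener_integral M W (frac_kernel \<alpha> t) t"])
qed

lemma volterra_eq_Y:
  assumes "volterra_eq M W x0 \<kappa>1 \<kappa> \<sigma> \<alpha> V Z t" "t \<in> {0..T}"
  shows "AE \<omega> in M. V t \<omega> = x0 + (\<integral>s. K (t - s) * (\<kappa>1 + \<kappa> * Z s \<omega>) \<partial>L) + \<sigma> * Y t \<omega>"
proof -
  obtain Y' where "has_wiener_integral M W (frac_kernel \<alpha> t) t Y'"
    and e: "AE \<omega> in M. V t \<omega> = x0 + (\<integral>s. K (t - s) * (\<kappa>1 + \<kappa> * Z s \<omega>) \<partial>L) + \<sigma> * Y' \<omega>"
    by (fact volterra_eqE[OF assms])
  then have "AE \<omega> in M. Y' \<omega> = Y t \<omega>" using wiener_integral_unique Y_wiener[OF assms(2)] by blast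
  with e show ?thesis by eventually_elim simp
qed

lemma Y_sqint: "t \<in> {0..T} \<Longrightarrow> sqint M (Y t)"
  by (rule wiener_integral_sqint[OF Y_wiener])

lemma Y_mean: "t \<in> {0..T} \<Longrightarrow> (\<integral>\<omega>. Y t \<omega> \<partial>M) = 0"
  by (rule wiener_integral_mean[OF Y_wiener])

lemma Y_cov:
  assumes "t \<in> {0..T}" "u \<in> {0..T}"
  shows "(\<integral>\<omega>. Y t \<omega> * Y u \<omega> \<partial>M) = Kcov t u"
proof -
  have "(\<integral>\<omega>. Y t \<omega> * Y u \<omega> \<partial>M) = (\<integral>s. (indicator {0..T} s * K (t - s)) * (indicator {0..T} s * K (u - s)) \<partial>lborel)"
    using wiener_isometry[OF Y_wiener Y_wiener, of t u] assms by (simp add: frac_kernel_K)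
  also have "\<dots> = Kcov t u"
    unfolding Kcov_def integral_L by (intro Bochner_Integration.integral_cong) (auto simp: indicator_def)
  finally show ?thesis .
qed

lemma X_joint: "(\<lambda>(s, \<omega>). X s \<omega>) \<in> borel_measurable (L \<Otimes>\<^sub>M M)"
proof -
  have "sets (L \<Otimes>\<^sub>M M) = sets (restrict_space borel {0..T} \<Otimes>\<^sub>M M)"
    by (intro sets_pair_measure_cong sets_L refl)
  then show ?thesis using solution by (simp add: strong_solution_def cong: measurable_cong_sets)
qed

lemma section_measurable:
  assumes "(\<lambda>(s, \<omega>). Z s \<omega>) \<in> borel_measurable (L \<Otimes>\<^sub>M M)" "s \<in> {0..T}"
  shows "Z s \<in> borel_measurable M"
  using measurable_compose[OF measurable_Pair1'[of s L M] assms(1)] assms(2) by simp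

lemma X_second_moment:
  obtains B where "0 \<le> B" "\<And>t. t \<in> {0..T} \<Longrightarrow> sqint M (X t)" "\<And>t. t \<in> {0..T} \<Longrightarrow> (\<integral>\<omega>. (X t \<omega>)\<^sup>2 \<partial>M) \<le> B"
proof -
  define S where "S = (SUP t\<in>{0..T}. \<integral>\<^sup>+\<omega>. ennreal ((X t \<omega>)\<^sup>2) \<partial>M)"
  have S: "S < \<infinity>" using solution by (simp add: strong_solution_def S_def)
  have le: "(\<integral>\<^sup>+\<omega>. ennreal ((X t \<omega>)\<^sup>2) \<partial>M) \<le> S" if "t \<in> {0..T}" for t
    unfolding S_def using that by (intro SUP_upper)
  have m: "X t \<in> borel_measurable M" if "t \<in> {0..T}" for t
    using section_measurable[OF X_joint that] .
  have i: "integrable M (\<lambda>\<omega>. (X t \<omega>)\<^sup>2)" if "t \<in> {0..T}" for t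
    using m[OF that] le_less_trans[OF le[OF that] S] by (intro integrableI_bounded) auto
  have "(\<integral>\<omega>. (X t \<omega>)\<^sup>2 \<partial>M) \<le> enn2real S" if "t \<in> {0..T}" for t
  proof -
    have "ennreal (\<integral>\<omega>. (X t \<omega>)\<^sup>2 \<partial>M) \<le> S"
      using le[OF that] nn_integral_eq_integral[OF i[OF that]] by simp
    then have "enn2real (ennreal (\<integral>\<omega>. (X t \<omega>)\<^sup>2 \<partial>M)) \<le> enn2real S"
      using S by (intro enn2real_mono) auto
    then show ?thesis by simp
  qed
  then show thesis using that[of "enn2real S"] i m by (auto simp: sqint_def)
qed

text \<open>Uniformly bounded second moments and joint measurability make the integrand absolutely
  integrable on the product. For \<open>V = 1\<close> the first claim is the integrability of the
  paths against the kernel.\<close>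

lemma kernel_fubini:
  assumes Z: "(\<lambda>(s, \<omega>). Z s \<omega>) \<in> borel_measurable (L \<Otimes>\<^sub>M M)"
    and sq: "\<And>s. s \<in> {0..T} \<Longrightarrow> sqint M (Z s)" "\<And>s. s \<in> {0..T} \<Longrightarrow> (\<integral>\<omega>. (Z s \<omega>)\<^sup>2 \<partial>M) \<le> B"
    and V: "sqint M V" and t: "t \<in> {0..T}"
  shows "AE \<omega> in M. integrable L (\<lambda>s. K (t - s) * (Z s \<omega> * V \<omega>))"
    and "(\<integral>\<omega>. (\<integral>s. K (t - s) * Z s \<omega> \<partial>L) * V \<omega> \<partial>M) = (\<integral>s. K (t - s) * (\<integral>\<omega>. Z s \<omega> * V \<omega> \<partial>M) \<partial>L)"
proof -
  interpret P: pair_sigma_finite L M ..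
  let ?f = "\<lambda>(s, \<omega>). K (t - s) * (Z s \<omega> * V \<omega>)"
  have [measurable]: "V \<in> borel_measurable M" using V by (rule sqint_measurable)
  note Z[measurable]
  have Km: "(\<lambda>p. K (t - fst p)) \<in> borel_measurable (L \<Otimes>\<^sub>M M)"
    by (rule measurable_L_pair) measurable
  have fm: "?f \<in> borel_measurable (L \<Otimes>\<^sub>M M)"
  proof -
    have "(\<lambda>p. K (t - fst p) * ((\<lambda>(s, \<omega>). Z s \<omega>) p * V (snd p))) \<in> borel_measurable (L \<Otimes>\<^sub>M M)"
      by (intro borel_measurable_times Km Z) measurable
    then show ?thesis by (simp add: case_prod_unfold)
  qed
  have am: "(\<lambda>s. \<integral>\<omega>. \<bar>Z s \<omega> * V \<omega>\<bar> \<partial>M) \<in> borel_measurable L"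
    by (intro borel_measurable_lebesgue_integral) measurable
  have ab: "\<bar>\<integral>\<omega>. \<bar>Z s \<omega> * V \<omega>\<bar> \<partial>M\<bar> \<le> (B + (\<integral>\<omega>. (V \<omega>)\<^sup>2 \<partial>M)) / 2" if "s \<in> {0..T}" for s
  proof -
    have "\<bar>\<integral>\<omega>. \<bar>Z s \<omega>\<bar> * \<bar>V \<omega>\<bar> \<partial>M\<bar> \<le> ((\<integral>\<omega>. \<bar>Z s \<omega>\<bar>\<^sup>2 \<partial>M) + (\<integral>\<omega>. \<bar>V \<omega>\<bar>\<^sup>2 \<partial>M)) / 2"
      using sq(1)[OF that] V by (intro square_integrable_mult) (auto simp: sqint_def)
    then show ?thesis using sq(2)[OF that] by (simp add: abs_mult)
  qed
  have int: "integrable (L \<Otimes>\<^sub>M M) ?f"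
  proof (rule P.Fubini_integrable[OF fm])
    have "integrable L (\<lambda>s. K (t - s) * (\<integral>\<omega>. \<bar>Z s \<omega> * V \<omega>\<bar> \<partial>M))"
      using t by (intro K_bounded_integrable(1)[OF am ab]) auto
    then show "integrable L (\<lambda>s. \<integral>\<omega>. norm (?f (s, \<omega>)) \<partial>M)"
      by (simp add: abs_mult[of "K _"])
    show "AE s in L. integrable M (\<lambda>\<omega>. ?f (s, \<omega>))"
      using sqint_mult[OF sq(1) V] by (auto intro!: AE_I2)
  qed
  show "AE \<omega> in M. integrable L (\<lambda>s. K (t - s) * (Z s \<omega> * V \<omega>))"
    using P.AE_integrable_snd[of "\<lambda>s \<omega>. K (t - s) * (Z s \<omega> * V \<omega>)"] int by simp
  have "(\<integral>\<omega>. (\<integral>s. K (t - s) * (Z s \<omega> * V \<omega>) \<partial>L) \<partial>M) = (\<integral>s. (\<integral>\<omega>. K (t - s) * (Z s \<omega> * V \<omega>) \<partial>M) \<partial>L)"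
    using P.Fubini_integral[OF int] by simp
  moreover have "(\<integral>s. K (t - s) * Z s \<omega> \<partial>L) * V \<omega> = (\<integral>s. K (t - s) * (Z s \<omega> * V \<omega>) \<partial>L)" for \<omega>
    by (subst integral_mult_left_zero[symmetric]) (simp only: mult.assoc)
  ultimately show "(\<integral>\<omega>. (\<integral>s. K (t - s) * Z s \<omega> \<partial>L) * V \<omega> \<partial>M) = (\<integral>s. K (t - s) * (\<integral>\<omega>. Z s \<omega> * V \<omega> \<partial>M) \<partial>L)"
    by simp
qed

definition IK :: "real \<Rightarrow> real" where "IK t = (\<integral>s. K (t - s) \<partial>L)"

lemma X_eq:
  assumes t: "t \<in> {0..T}"
  shows "AE \<omega> in M. X t \<omega> = x0 + \<kappa>1 * IK t + \<kappa> * (\<integral>s. K (t - s) * X s \<omega> \<partial>L) + \<sigma> * Y t \<omega>"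
    and "AE \<omega> in M. integrable L (\<lambda>s. K (t - s) * X s \<omega>)"
proof -
  obtain B where B: "\<And>t. t \<in> {0..T} \<Longrightarrow> sqint M (X t)" "\<And>t. t \<in> {0..T} \<Longrightarrow> (\<integral>\<omega>. (X t \<omega>)\<^sup>2 \<partial>M) \<le> B"
    using X_second_moment by metis
  show i: "AE \<omega> in M. integrable L (\<lambda>s. K (t - s) * X s \<omega>)"
    using kernel_fubini(1)[OF X_joint B sqint_const[of 1] t] by simp
  have "volterra_eq M W x0 \<kappa>1 \<kappa> \<sigma> \<alpha> X X t" using solution t by (simp add: strong_solution_def)
  from volterra_eq_Y[OF this t] i
  show "AE \<omega> in M. X t \<omega> = x0 + \<kappa>1 * IK t + \<kappa> * (\<integral>s. K (t - s) * X s \<omega> \<partial>L) + \<sigma> * Y t \<omega>"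
  proof eventually_elim
    case (elim \<omega>)
    have "K (t - s) * (\<kappa>1 + \<kappa> * X s \<omega>) = \<kappa>1 * K (t - s) + \<kappa> * (K (t - s) * X s \<omega>)" for s
      by (simp add: algebra_simps)
    then have "(\<integral>s. K (t - s) * (\<kappa>1 + \<kappa> * X s \<omega>) \<partial>L) = \<kappa>1 * IK t + \<kappa> * (\<integral>s. K (t - s) * X s \<omega> \<partial>L)"
      using elim(2) K_integrable[of t] t by (simp add: IK_def)
    then show ?case using elim(1) by simp
  qed
qed

text \<open>The explicit solution of the averaged equation; it is identified with the expectation of
  \<open>X\<close> only after uniqueness has been applied to the centred process.\<close>

definition mean :: "real \<Rightarrow> real" where "mean t = x0 + (\<kappa>1 + \<kappa> * x0) * Rint t"

lemma mean_measurable [measurable]: "mean \<in> borel_measurable borel"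
  unfolding mean_def by measurable

lemma mean_bound: obtains B where "0 \<le> B" "\<And>t. t \<in> {0..T} \<Longrightarrow> \<bar>mean t\<bar> \<le> B"
proof -
  obtain B where B: "0 \<le> B" "\<And>t. t \<in> {0..T} \<Longrightarrow> \<bar>Rint t\<bar> \<le> B" using Rint_bound by metis
  have "\<bar>mean t\<bar> \<le> \<bar>x0\<bar> + \<bar>\<kappa>1 + \<kappa> * x0\<bar> * B" if "t \<in> {0..T}" for t
  proof -
    have "\<bar>mean t\<bar> \<le> \<bar>x0\<bar> + \<bar>\<kappa>1 + \<kappa> * x0\<bar> * \<bar>Rint t\<bar>"
      unfolding mean_def abs_mult[symmetric] by (rule abs_triangle_ineq)
    also have "\<dots> \<le> \<bar>x0\<bar> + \<bar>\<kappa>1 + \<kappa> * x0\<bar> * B" using B(2)[OF that] by (intro add_left_mono mult_left_mono) auto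
    finally show ?thesis .
  qed
  then show thesis using that[of "\<bar>x0\<bar> + \<bar>\<kappa>1 + \<kappa> * x0\<bar> * B"] B(1) by auto
qed

lemma K_mean_integrable: "t \<in> {0..T} \<Longrightarrow> integrable L (\<lambda>s. K (t - s) * mean s)"
proof -
  assume t: "t \<in> {0..T}"
  obtain B where "\<And>t. t \<in> {0..T} \<Longrightarrow> \<bar>mean t\<bar> \<le> B" using mean_bound by metis
  then show ?thesis using t by (intro K_bounded_integrable(1)) auto
qed

lemma mean_eq:
  assumes t: "t \<in> {0..T}"
  shows "mean t = x0 + \<kappa>1 * IK t + \<kappa> * (\<integral>s. K (t - s) * mean s \<partial>L)"
proof -
  obtain B where B: "\<And>t. t \<in> {0..T} \<Longrightarrow> \<bar>Rint t\<bar> \<le> B" using Rint_bound by metis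
  have i: "integrable L (\<lambda>s. K (t - s) * Rint s)"
    using B t by (intro K_bounded_integrable(1)) auto
  have "(\<integral>s. K (t - s) * mean s \<partial>L) = (\<integral>s. x0 * K (t - s) + (\<kappa>1 + \<kappa> * x0) * (K (t - s) * Rint s) \<partial>L)"
    by (intro Bochner_Integration.integral_cong) (auto simp: mean_def algebra_simps)
  also have "\<dots> = x0 * IK t + (\<kappa>1 + \<kappa> * x0) * (\<integral>s. K (t - s) * Rint s \<partial>L)"
    using i K_integrable[of t] t by (simp add: IK_def)
  finally have I: "(\<integral>s. K (t - s) * mean s \<partial>L) = x0 * IK t + (\<kappa>1 + \<kappa> * x0) * (\<integral>s. K (t - s) * Rint s \<partial>L)" .
  show ?thesis unfolding I mean_def[of t] Rint_eq[OF t] IK_def[symmetric] by (simp add: algebra_simps)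
qed

text \<open>Subtracting the deterministic solution leaves a homogeneous linear equation driven by
  the noise alone.\<close>

definition G :: "real \<Rightarrow> 'a \<Rightarrow> real" where "G t \<omega> = X t \<omega> - mean t"

lemma G_joint: "(\<lambda>(s, \<omega>). G s \<omega>) \<in> borel_measurable (L \<Otimes>\<^sub>M M)"
proof -
  have "(\<lambda>p. mean (fst p)) \<in> borel_measurable (L \<Otimes>\<^sub>M M)" by (rule measurable_L_pair) measurable
  then have "(\<lambda>p. (\<lambda>(s, \<omega>). X s \<omega>) p - mean (fst p)) \<in> borel_measurable (L \<Otimes>\<^sub>M M)"
    by (intro borel_measurable_diff X_joint)
  then show ?thesis by (simp add: G_def case_prod_unfold)
qed

lemma G_second_moment:
  obtains B where "0 \<le> B" "\<And>t. t \<in> {0..T} \<Longrightarrow> (\<integral>\<omega>. (G t \<omega>)\<^sup>2 \<partial>M) \<le> B"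
proof -
  obtain B where B: "0 \<le> B" "\<And>t. t \<in> {0..T} \<Longrightarrow> sqint M (X t)" "\<And>t. t \<in> {0..T} \<Longrightarrow> (\<integral>\<omega>. (X t \<omega>)\<^sup>2 \<partial>M) \<le> B"
    by (fact X_second_moment)
  obtain D where D: "0 \<le> D" "\<And>t. t \<in> {0..T} \<Longrightarrow> \<bar>mean t\<bar> \<le> D" using mean_bound by metis
  have "(\<integral>\<omega>. (G t \<omega>)\<^sup>2 \<partial>M) \<le> 2 * B + 2 * D\<^sup>2" if t: "t \<in> {0..T}" for t
  proof -
    have "sqint M (\<lambda>\<omega>. X t \<omega> - mean t)" using B(2)[OF t] by (intro sqint_diff) auto
    then have i: "integrable M (\<lambda>\<omega>. (G t \<omega>)\<^sup>2)" by (simp add: G_def sqint_def)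
    have i2: "integrable M (\<lambda>\<omega>. (X t \<omega>)\<^sup>2)" using B(2)[OF t] by (simp add: sqint_def)
    have m: "(mean t)\<^sup>2 \<le> D\<^sup>2" using D(2)[OF t] D(1) by (simp add: abs_le_square_iff[symmetric])
    have "(\<integral>\<omega>. (G t \<omega>)\<^sup>2 \<partial>M) \<le> (\<integral>\<omega>. 2 * (X t \<omega>)\<^sup>2 + 2 * D\<^sup>2 \<partial>M)"
    proof (rule integral_mono[OF i])
      show "(G t \<omega>)\<^sup>2 \<le> 2 * (X t \<omega>)\<^sup>2 + 2 * D\<^sup>2" for \<omega>
        using m sum_squares_bound[of "X t \<omega>" "- mean t"] by (simp add: G_def power2_diff)
    qed (use i2 in simp)
    also have "\<dots> \<le> 2 * B + 2 * D\<^sup>2" using i2 B(3)[OF t] by (simp add: prob_space)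
    finally show ?thesis .
  qed
  then show thesis using that[of "2 * B + 2 * D\<^sup>2"] B(1) by auto
qed

lemma G_sqint: "t \<in> {0..T} \<Longrightarrow> sqint M (G t)"
proof -
  assume t: "t \<in> {0..T}"
  obtain B where B: "0 \<le> B" "\<And>t. t \<in> {0..T} \<Longrightarrow> sqint M (X t)" "\<And>t. t \<in> {0..T} \<Longrightarrow> (\<integral>\<omega>. (X t \<omega>)\<^sup>2 \<partial>M) \<le> B"
    by (fact X_second_moment)
  have "sqint M (\<lambda>\<omega>. X t \<omega> - mean t)" using B(2)[OF t] by (intro sqint_diff) auto
  then show ?thesis by (simp add: G_def[abs_def])
qed

lemma G_eq:
  assumes t: "t \<in> {0..T}"
  shows "AE \<omega> in M. G t \<omega> = \<kappa> * (\<integral>s. K (t - s) * G s \<omega> \<partial>L) + \<sigma> * Y t \<omega>"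
    and "AE \<omega> in M. integrable L (\<lambda>s. K (t - s) * G s \<omega>)"
proof -
  note Km = K_mean_integrable[OF t]
  show "AE \<omega> in M. G t \<omega> = \<kappa> * (\<integral>s. K (t - s) * G s \<omega> \<partial>L) + \<sigma> * Y t \<omega>"
    using X_eq[OF t]
  proof eventually_elim
    case (elim \<omega>)
    have "(\<integral>s. K (t - s) * G s \<omega> \<partial>L) = (\<integral>s. K (t - s) * X s \<omega> \<partial>L) - (\<integral>s. K (t - s) * mean s \<partial>L)"
      using elim(2) Km by (simp add: G_def right_diff_distrib)
    then show ?case using elim(1) mean_eq[OF t] by (simp add: G_def[of t] right_diff_distrib)
  qed
  show "AE \<omega> in M. integrable L (\<lambda>s. K (t - s) * G s \<omega>)"
    using X_eq(2)[OF t] by eventually_elim (use Km in \<open>simp add: G_def right_diff_distrib\<close>)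
qed

lemma G_inner_measurable:
  assumes "V \<in> borel_measurable M"
  shows "(\<lambda>s. \<integral>\<omega>. G s \<omega> * V \<omega> \<partial>M) \<in> borel_measurable L"
proof (rule borel_measurable_lebesgue_integral)
  have "(\<lambda>p. (\<lambda>(s, \<omega>). G s \<omega>) p * V (snd p)) \<in> borel_measurable (L \<Otimes>\<^sub>M M)"
    by (intro borel_measurable_times G_joint measurable_compose[OF measurable_snd assms])
  then show "(\<lambda>(s, \<omega>). G s \<omega> * V \<omega>) \<in> borel_measurable (L \<Otimes>\<^sub>M M)" by (simp add: case_prod_unfold)
qed

lemma G_inner_eq:
  assumes V: "sqint M V" and t: "t \<in> {0..T}"
  shows "(\<integral>\<omega>. G t \<omega> * V \<omega> \<partial>M) = \<kappa> * (\<integral>s. K (t - s) * (\<integral>\<omega>. G s \<omega> * V \<omega> \<partial>M) \<partial>L) + \<sigma> * (\<integral>\<omega>. Y t \<omega> * V \<omega> \<partial>M)"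
proof -
  obtain B where B: "\<And>t. t \<in> {0..T} \<Longrightarrow> (\<integral>\<omega>. (G t \<omega>)\<^sup>2 \<partial>M) \<le> B" using G_second_moment by metis
  let ?J = "\<lambda>\<omega>. \<kappa> * (\<integral>s. K (t - s) * G s \<omega> \<partial>L)"
  have Jm: "(\<lambda>\<omega>. \<integral>s. K (t - s) * G s \<omega> \<partial>L) \<in> borel_measurable M"
  proof (rule L.borel_measurable_lebesgue_integral)
    have "(\<lambda>p. K (t - snd p)) \<in> borel_measurable (M \<Otimes>\<^sub>M L)"
      by (intro measurable_compose[OF measurable_snd] measurable_L) measurable
    moreover have "(\<lambda>(\<omega>, s). G s \<omega>) \<in> borel_measurable (M \<Otimes>\<^sub>M L)"
      using measurable_pair_swap[OF G_joint] by simp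
    ultimately have "(\<lambda>p. K (t - snd p) * (\<lambda>(\<omega>, s). G s \<omega>) p) \<in> borel_measurable (M \<Otimes>\<^sub>M L)"
      by (intro borel_measurable_times)
    then show "(\<lambda>(\<omega>, s). K (t - s) * G s \<omega>) \<in> borel_measurable (M \<Otimes>\<^sub>M L)" by (simp add: case_prod_unfold)
  qed
  \<comment> \<open>Square integrability of the drift term is read off the equation, as the
    difference of the solution and the noise; only its measurability comes from the
    integral.\<close>
  have "sqint M ?J"
  proof (rule sqint_cong_AE)
    show "sqint M (\<lambda>\<omega>. G t \<omega> - \<sigma> * Y t \<omega>)" using t by (intro sqint_diff sqint_cmult G_sqint Y_sqint)
    show "?J \<in> borel_measurable M" using Jm by simp
    show "AE \<omega> in M. G t \<omega> - \<sigma> * Y t \<omega> = ?J \<omega>" using G_eq(1)[OF t] by eventually_elim simp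
  qed
  note J = this
  have [measurable]: "V \<in> borel_measurable M" "G t \<in> borel_measurable M" "Y t \<in> borel_measurable M" "?J \<in> borel_measurable M"
    using V J G_sqint[OF t] Y_sqint[OF t] by (auto simp: sqint_def)
  have "(\<integral>\<omega>. G t \<omega> * V \<omega> \<partial>M) = (\<integral>\<omega>. ?J \<omega> * V \<omega> + \<sigma> * (Y t \<omega> * V \<omega>) \<partial>M)"
  proof (rule integral_cong_AE)
    show "AE \<omega> in M. G t \<omega> * V \<omega> = ?J \<omega> * V \<omega> + \<sigma> * (Y t \<omega> * V \<omega>)"
      using G_eq(1)[OF t] by eventually_elim (simp add: algebra_simps)
  qed measurable
  also have "\<dots> = (\<integral>\<omega>. ?J \<omega> * V \<omega> \<partial>M) + \<sigma> * (\<integral>\<omega>. Y t \<omega> * V \<omega> \<partial>M)"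
    using sqint_mult[OF J V] sqint_mult[OF Y_sqint[OF t] V] by (subst Bochner_Integration.integral_add) auto
  also have "(\<integral>\<omega>. ?J \<omega> * V \<omega> \<partial>M) = \<kappa> * (\<integral>\<omega>. (\<integral>s. K (t - s) * G s \<omega> \<partial>L) * V \<omega> \<partial>M)"
    by (simp add: mult.assoc)
  also have "\<dots> = \<kappa> * (\<integral>s. K (t - s) * (\<integral>\<omega>. G s \<omega> * V \<omega> \<partial>M) \<partial>L)"
    using kernel_fubini(2)[OF G_joint G_sqint B V t] by simp
  finally show ?thesis .
qed

lemma G_inner_bound:
  assumes V: "sqint M V"
  obtains B where "\<And>t. t \<in> {0..T} \<Longrightarrow> \<bar>\<integral>\<omega>. G t \<omega> * V \<omega> \<partial>M\<bar> \<le> B"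
proof -
  obtain B where B: "\<And>t. t \<in> {0..T} \<Longrightarrow> (\<integral>\<omega>. (G t \<omega>)\<^sup>2 \<partial>M) \<le> B" using G_second_moment by metis
  have "\<bar>\<integral>\<omega>. G t \<omega> * V \<omega> \<partial>M\<bar> \<le> (B + (\<integral>\<omega>. (V \<omega>)\<^sup>2 \<partial>M)) / 2" if "t \<in> {0..T}" for t
    using square_integrable_mult(2)[of M "G t" V] G_sqint[OF that] V B[OF that] by (simp add: sqint_def)
  then show thesis using that by blast
qed

text \<open>Inner products with the solution are determined by those with the Wiener integrals, since they
  solve a linear Volterra equation.\<close>

lemma G_inner_unique:
  assumes V: "sqint M V" and [measurable]: "f \<in> borel_measurable borel"
    and b: "\<And>t. t \<in> {0..T} \<Longrightarrow> \<bar>f t\<bar> \<le> B"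
    and eq: "\<And>t. t \<in> {0..T} \<Longrightarrow> f t = \<kappa> * (\<integral>s. K (t - s) * f s \<partial>L) + \<sigma> * (\<integral>\<omega>. Y t \<omega> * V \<omega> \<partial>M)"
    and t: "t \<in> {0..T}"
  shows "(\<integral>\<omega>. G t \<omega> * V \<omega> \<partial>M) = f t"
proof -
  let ?g = "\<lambda>s. \<integral>\<omega>. G s \<omega> * V \<omega> \<partial>M"
  obtain D where D: "\<And>t. t \<in> {0..T} \<Longrightarrow> \<bar>?g t\<bar> \<le> D" using G_inner_bound[OF V] by metis
  have gm: "?g \<in> borel_measurable L" using V by (intro G_inner_measurable) (simp add: sqint_def)
  have "?g t - f t = 0"
  proof (rule volterra_unique[where f = "\<lambda>t. ?g t - f t" and B = "D + B"])
    show "(\<lambda>t. ?g t - f t) \<in> borel_measurable L" using gm by (intro borel_measurable_diff) auto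
    show "\<bar>?g t - f t\<bar> \<le> D + B" if "t \<in> {0..T}" for t
      using D[OF that] b[OF that] by linarith
    show "?g t - f t = \<kappa> * (\<integral>s. K (t - s) * (?g s - f s) \<partial>L)" if t: "t \<in> {0..T}" for t
    proof -
      have "integrable L (\<lambda>s. K (t - s) * ?g s)" "integrable L (\<lambda>s. K (t - s) * f s)"
        using t by (auto intro!: K_bounded_integrable(1) gm D b)
      then have I: "(\<integral>s. K (t - s) * (?g s - f s) \<partial>L) = (\<integral>s. K (t - s) * ?g s \<partial>L) - (\<integral>s. K (t - s) * f s \<partial>L)"
        by (simp add: right_diff_distrib)
      show ?thesis unfolding I using eq[OF t] G_inner_eq[OF V t] by (simp add: right_diff_distrib)
    qed
  qed (rule t)
  then show ?thesis by simp
qed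

lemma G_mean: "t \<in> {0..T} \<Longrightarrow> (\<integral>\<omega>. G t \<omega> \<partial>M) = 0"
  using G_inner_unique[of "\<lambda>_. 1" "\<lambda>_. 0" 0 t] by (simp add: Y_mean)

lemma X_mean: "t \<in> {0..T} \<Longrightarrow> (\<integral>\<omega>. X t \<omega> \<partial>M) = mean t"
proof -
  assume t: "t \<in> {0..T}"
  have "integrable M (G t)" using t by (intro sqint_integrable G_sqint)
  then have "(\<integral>\<omega>. G t \<omega> + mean t \<partial>M) = mean t" using G_mean[OF t] by (simp add: prob_space)
  then show ?thesis by (simp add: G_def)
qed

lemma G_Y_inner:
  assumes "t \<in> {0..T}" "u \<in> {0..T}"
  shows "(\<integral>\<omega>. G u \<omega> * Y t \<omega> \<partial>M) = \<sigma> * mixed_cov t u"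
proof -
  obtain B where B: "0 \<le> B" "\<And>s u. s \<le> T \<Longrightarrow> u \<le> T \<Longrightarrow> \<bar>mixed_cov s u\<bar> \<le> B" using mixed_cov_bound by metis
  show ?thesis
  proof (rule G_inner_unique[where B = "\<bar>\<sigma>\<bar> * B"])
    show "sqint M (Y t)" using assms by (intro Y_sqint)
    show "\<bar>\<sigma> * mixed_cov t u\<bar> \<le> \<bar>\<sigma>\<bar> * B" if "u \<in> {0..T}" for u
      unfolding abs_mult using B that assms by (intro mult_left_mono) auto
    show "\<sigma> * mixed_cov t u = \<kappa> * (\<integral>s. K (u - s) * (\<sigma> * mixed_cov t s) \<partial>L) + \<sigma> * (\<integral>\<omega>. Y u \<omega> * Y t \<omega> \<partial>M)"
      if "u \<in> {0..T}" for u
    proof -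
      have "(\<integral>s. K (u - s) * (\<sigma> * mixed_cov t s) \<partial>L) = \<sigma> * (\<integral>s. K (u - s) * mixed_cov t s \<partial>L)"
        by (subst integral_mult_right_zero[symmetric]) (simp only: mult_ac)
      moreover have "(\<integral>\<omega>. Y u \<omega> * Y t \<omega> \<partial>M) = Kcov t u" using Y_cov[OF assms(1) that] by (simp add: mult.commute)
      ultimately show ?thesis using mixed_cov_eq[OF assms(1) that] by (simp add: algebra_simps)
    qed
  qed (use assms in auto)
qed

text \<open>Uniqueness is applied twice: pairing with a Wiener integral first gave the mixed
  covariance, and this is the source term needed now for the pairing with
  \<open>G u\<close>.\<close>

lemma G_cov:
  assumes "t \<in> {0..T}" "u \<in> {0..T}"
  shows "(\<integral>\<omega>. G t \<omega> * G u \<omega> \<partial>M) = \<sigma>\<^sup>2 * cov t u"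
proof -
  obtain B where B: "0 \<le> B" "\<And>s u. s \<le> T \<Longrightarrow> u \<le> T \<Longrightarrow> \<bar>cov s u\<bar> \<le> B" using cov_bound by metis
  show ?thesis
  proof (rule G_inner_unique[where B = "\<sigma>\<^sup>2 * B" and f = "\<lambda>t. \<sigma>\<^sup>2 * cov t u"])
    show "sqint M (G u)" using assms by (intro G_sqint)
    show "\<bar>\<sigma>\<^sup>2 * cov t u\<bar> \<le> \<sigma>\<^sup>2 * B" if "t \<in> {0..T}" for t
      unfolding abs_mult abs_power2 using B that assms by (intro mult_left_mono) auto
    show "\<sigma>\<^sup>2 * cov t u = \<kappa> * (\<integral>s. K (t - s) * (\<sigma>\<^sup>2 * cov s u) \<partial>L) + \<sigma> * (\<integral>\<omega>. Y t \<omega> * G u \<omega> \<partial>M)"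
      if "t \<in> {0..T}" for t
    proof -
      have "(\<integral>s. K (t - s) * (\<sigma>\<^sup>2 * cov s u) \<partial>L) = \<sigma>\<^sup>2 * (\<integral>s. K (t - s) * cov s u \<partial>L)"
        by (subst integral_mult_right_zero[symmetric]) (simp only: mult_ac)
      moreover have "(\<integral>\<omega>. Y t \<omega> * G u \<omega> \<partial>M) = \<sigma> * mixed_cov t u" using G_Y_inner[OF that assms(2)] by (simp add: mult.commute)
      ultimately show ?thesis using cov_eq[OF that assms(2)] by (simp add: algebra_simps power2_eq_square)
    qed
  qed (use assms in auto)
qed

end

section \<open>The error of the Euler scheme\<close>

lemma euler_rate_nonneg: "1 \<le> n \<Longrightarrow> 0 \<le> euler_rate \<alpha> n"
  by (auto simp: euler_rate_def)

lemma euler_rate_le_1: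
  assumes "1 / 2 < \<alpha>" "1 \<le> n"
  shows "euler_rate \<alpha> n \<le> 1"
proof -
  have "ln (real n) \<le> real n" using ln_le_minus_one[of "real n"] assms by simp
  moreover have "1 \<le> real n powr (3 * \<alpha> - 1)" using assms by (intro ge_one_powr_ge_zero) auto
  ultimately show ?thesis using assms by (auto simp: euler_rate_def field_simps)
qed

text \<open>From n = 3 on, n is at least exp 1, so the logarithm in the case \<alpha> = 2/3 is at
  least 1.\<close>

lemma inverse_le_euler_rate:
  assumes "1 / 2 < \<alpha>" "3 \<le> n"
  shows "1 / real n \<le> euler_rate \<alpha> n"
proof -
  have "1 \<le> ln (real n)"
    using assms exp_le by (subst ln_ge_iff) auto
  moreover have "1 / real n \<le> 1 / real n powr (3 * \<alpha> - 1)" if "\<alpha> \<le> 2 / 3"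
    using that assms powr_mono[of "3 * \<alpha> - 1" 1 "real n"] by (intro divide_left_mono) auto
  ultimately show ?thesis using assms by (auto simp: euler_rate_def divide_right_mono)
qed

context fractional
begin

text \<open>For \<open>h = T / n\<close> the ratio \<open>T / h\<close> is \<open>n\<close>, so the
  logarithms agree; the added 1/n pays for the 1 in \<open>1 + ln (T / h)\<close>.\<close>

lemma srate_euler_rate:
  obtains C where "0 \<le> C" "\<And>n. 1 \<le> n \<Longrightarrow> srate (T / real n) \<le> C * (euler_rate \<alpha> n + 1 / real n)"
proof -
  have "srate (T / real n) \<le> (T + T powr (3 * \<alpha> - 1)) * (euler_rate \<alpha> n + 1 / real n)" if n: "1 \<le> n" for n
  proof -
    have 1: "srate (T / real n) \<le> T * (euler_rate \<alpha> n + 1 / real n)" if "2 / 3 \<le> \<alpha>"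
      using that n T_pos by (auto simp: srate_def euler_rate_def field_simps)
    have 2: "srate (T / real n) \<le> T powr (3 * \<alpha> - 1) * (euler_rate \<alpha> n + 1 / real n)" if "\<alpha> < 2 / 3"
      using that n T_pos by (auto simp: srate_def euler_rate_def powr_divide distrib_left)
    have "0 \<le> T * (euler_rate \<alpha> n + 1 / real n)" "0 \<le> T powr (3 * \<alpha> - 1) * (euler_rate \<alpha> n + 1 / real n)"
      using T_pos euler_rate_nonneg[OF n, of \<alpha>] by auto
    then show ?thesis using 1 2 unfolding distrib_right by (cases "2 / 3 \<le> \<alpha>") linarith+
  qed
  moreover have "0 \<le> T + T powr (3 * \<alpha> - 1)" using T_pos by simp
  ultimately show thesis using that by blast
qed

lemma euler_rate_tendsto: "(\<lambda>n. euler_rate \<alpha> n) \<longlonglongrightarrow> 0"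
proof -
  consider "\<alpha> > 2 / 3" | "\<alpha> = 2 / 3" | "\<alpha> < 2 / 3" by linarith
  then show ?thesis
  proof cases
    case 1
    then show ?thesis using lim_1_over_n by (simp add: euler_rate_def[abs_def])
  next
    case 2
    then show ?thesis using lim_ln_over_n by (simp add: euler_rate_def[abs_def])
  next
    case 3
    have "((\<lambda>n. real n powr - (3 * \<alpha> - 1)) \<longlongrightarrow> 0) sequentially"
      by (rule tendsto_neg_powr[OF _ filterlim_real_sequentially]) (use alpha_gt in simp)
    moreover have "euler_rate \<alpha> n = real n powr - (3 * \<alpha> - 1)" for n
      using 3 unfolding powr_minus_divide by (simp add: euler_rate_def)
    ultimately show ?thesis by (simp only:)
  qed
qed

text \<open>The negative power of \<open>t\<close> is at least that of \<open>T\<close>, hence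
  bounded below by a positive constant, and 1/n is absorbed. The slack \<open>a\<close> and
  \<open>b\<close> is room for the remaining terms of the claimed bounds, such as those of a second
  time point.\<close>

lemma inverse_euler_rate_le:
  assumes "1 \<le> n" "0 < t" "t \<le> T" "0 \<le> a" "0 \<le> b"
  shows "euler_rate \<alpha> n + 1 / real n \<le>
    (1 + T powr (2 - 2 * \<alpha>)) * ((1 + a) * euler_rate \<alpha> n + (t powr (2 * \<alpha> - 2) + b) / real n)"
proof -
  let ?c = "T powr (2 - 2 * \<alpha>)" and ?r = "euler_rate \<alpha> n" and ?q = "(t powr (2 * \<alpha> - 2) + b) / real n"
  have r: "0 \<le> ?r" "0 \<le> ?q" "0 \<le> a * ?r" using assms euler_rate_nonneg by auto
  have "1 = ?c * T powr (2 * \<alpha> - 2)" using T_pos by (simp add: powr_add[symmetric])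
  also have "\<dots> \<le> ?c * (t powr (2 * \<alpha> - 2) + b)"
  proof -
    have "T powr (2 * \<alpha> - 2) \<le> t powr (2 * \<alpha> - 2)" using assms alpha_le by (intro powr_mono2') auto
    then show ?thesis using assms by (intro mult_left_mono) auto
  qed
  finally have "1 / real n \<le> ?c * ?q" using assms by (simp add: divide_right_mono)
  moreover have "0 \<le> ?c * ((1 + a) * ?r)" "?r \<le> (1 + a) * ?r" using r by (simp_all add: distrib_right)
  moreover have "(1 + ?c) * (A + q) = A + q + ?c * A + ?c * q" for A q by (simp add: algebra_simps)
  ultimately show ?thesis using r(2) by (simp only:)
qed

end

text \<open>The constants are parameters since they must not depend on the probability space.\<close>

locale volterra_bounds = volterra_model +
  fixes gc lc rc rb cb sc :: real
  assumes gc: "0 \<le> gc" "\<And>n a b k. 1 \<le> n \<Longrightarrow> 0 \<le> b \<Longrightarrow>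
      (\<And>k. k \<le> n \<Longrightarrow> \<bar>a k\<bar> \<le> \<bar>\<kappa>\<bar> * (\<Sum>i<k. wt n k i * \<bar>a i\<bar>) + b) \<Longrightarrow> k \<le> n \<Longrightarrow> \<bar>a k\<bar> \<le> gc * b"
    and lc: "0 \<le> lc" "\<And>n t u. 1 \<le> n \<Longrightarrow> t \<le> T \<Longrightarrow> u \<in> {0..T} \<Longrightarrow>
      \<bar>\<integral>s. K (t - s) * (cov s u - cov (grid_floor T n s) u) \<partial>L\<bar> \<le> lc * srate (T / real n)"
    and rc: "0 \<le> rc" "\<And>n t. 1 \<le> n \<Longrightarrow> t \<in> {0..T} \<Longrightarrow>
      \<bar>\<integral>s. K (t - s) * (Rint s - Rint (grid_floor T n s)) \<partial>L\<bar> \<le> rc / real n"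
    and rb: "0 \<le> rb" "\<And>t. t \<in> {0..T} \<Longrightarrow> \<bar>Rint t\<bar> \<le> rb"
    and cb: "0 \<le> cb" "\<And>s u. s \<le> T \<Longrightarrow> u \<le> T \<Longrightarrow> \<bar>cov s u\<bar> \<le> cb"
    and sc: "0 \<le> sc" "\<And>n. 1 \<le> n \<Longrightarrow> srate (T / real n) \<le> sc * (euler_rate \<alpha> n + 1 / real n)"
begin

section \<open>The scheme at the grid points\<close>

abbreviation "gp \<equiv> grid_point T"

lemma gp_range: "1 \<le> n \<Longrightarrow> k \<le> n \<Longrightarrow> gp n k \<in> {0..T}"
  by (rule grid_point_range[OF T_pos])

lemma gp_le: "1 \<le> n \<Longrightarrow> k \<le> n \<Longrightarrow> gp n k \<le> T"
  using gp_range[of n k] by simp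

text \<open>At grid points the drift integral involves only earlier grid values, so the scheme
  becomes a finite recursion in \<open>k\<close>.\<close>

lemma Xe_eq:
  assumes "1 \<le> n" "k \<le> n"
  shows "AE \<omega> in M. Xe n (gp n k) \<omega> =
    x0 + (\<Sum>i<k. wt n k i * (\<kappa>1 + \<kappa> * Xe n (gp n i) \<omega>)) + \<sigma> * Y (gp n k) \<omega>"
proof -
  have "volterra_eq M W x0 \<kappa>1 \<kappa> \<sigma> \<alpha> (Xe n) (\<lambda>s. Xe n (grid_floor T n s)) (gp n k)"
    using euler[OF assms(1)] gp_range[OF assms] by (simp add: euler_scheme_def)
  from volterra_eq_Y[OF this gp_range[OF assms]] show ?thesis
    using grid_integral(2)[OF assms, of "\<lambda>i. \<kappa>1 + \<kappa> * Xe n (gp n i) \<omega>" for \<omega>] by (simp add: grid_floor_gidx)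
qed

lemma Xe_sqint:
  assumes "1 \<le> n" "k \<le> n"
  shows "sqint M (Xe n (gp n k))"
  using assms(2)
proof (induction k rule: less_induct)
  case (less k)
  show ?case
  proof (rule sqint_cong_AE)
    show "sqint M (\<lambda>\<omega>. x0 + (\<Sum>i<k. wt n k i * (\<kappa>1 + \<kappa> * Xe n (gp n i) \<omega>)) + \<sigma> * Y (gp n k) \<omega>)"
      using less assms(1) by (intro sqint_add sqint_sum sqint_cmult sqint_const Y_sqint gp_range) auto
    show "Xe n (gp n k) \<in> borel_measurable M"
      using euler[OF assms(1)] gp_range[OF assms(1) less.prems] by (simp add: euler_scheme_def)
    show "AE \<omega> in M. x0 + (\<Sum>i<k. wt n k i * (\<kappa>1 + \<kappa> * Xe n (gp n i) \<omega>)) + \<sigma> * Y (gp n k) \<omega> = Xe n (gp n k) \<omega>"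
      using Xe_eq[OF assms(1) less.prems] by eventually_elim simp
  qed
qed

definition emean :: "nat \<Rightarrow> nat \<Rightarrow> real" where "emean n k = (\<integral>\<omega>. Xe n (gp n k) \<omega> \<partial>M)"

lemma emean_eq:
  assumes "1 \<le> n" "k \<le> n"
  shows "emean n k = x0 + (\<Sum>i<k. wt n k i * (\<kappa>1 + \<kappa> * emean n i))"
proof -
  have i: "integrable M (Xe n (gp n i))" if "i \<le> n" for i
    using Xe_sqint[OF assms(1) that] by (rule sqint_integrable)
  have iY: "integrable M (Y (gp n k))" by (intro sqint_integrable Y_sqint gp_range assms)
  have [measurable]: "Xe n (gp n i) \<in> borel_measurable M" if "i \<le> n" for i
    using Xe_sqint[OF assms(1) that] by (rule sqint_measurable)
  have "emean n k = (\<integral>\<omega>. x0 + (\<Sum>i<k. wt n k i * (\<kappa>1 + \<kappa> * Xe n (gp n i) \<omega>)) + \<sigma> * Y (gp n k) \<omega> \<partial>M)"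
    unfolding emean_def using Xe_eq[OF assms] i iY assms
    by (intro integral_cong_AE) (auto intro!: borel_measurable_add borel_measurable_sum borel_measurable_times)
  also have "\<dots> = x0 + (\<Sum>i<k. wt n k i * (\<kappa>1 + \<kappa> * emean n i)) + \<sigma> * (\<integral>\<omega>. Y (gp n k) \<omega> \<partial>M)"
  proof -
    let ?f = "\<lambda>i \<omega>. wt n k i * (\<kappa>1 + \<kappa> * Xe n (gp n i) \<omega>)"
    have f: "integrable M (?f i)" if "i \<in> {..<k}" for i using i[of i] that assms by simp
    have "(\<integral>\<omega>. (\<Sum>i<k. ?f i \<omega>) \<partial>M) = (\<Sum>i<k. \<integral>\<omega>. ?f i \<omega> \<partial>M)"
      by (rule Bochner_Integration.integral_sum[OF f])
    also have "\<dots> = (\<Sum>i<k. wt n k i * (\<kappa>1 + \<kappa> * emean n i))"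
      using i assms by (intro sum.cong) (auto simp: emean_def prob_space)
    finally have I: "(\<integral>\<omega>. (\<Sum>i<k. ?f i \<omega>) \<partial>M) = (\<Sum>i<k. wt n k i * (\<kappa>1 + \<kappa> * emean n i))" .
    have "integrable M (\<lambda>\<omega>. \<Sum>i<k. ?f i \<omega>)" by (rule Bochner_Integration.integrable_sum[OF f])
    then show ?thesis using iY I by (simp add: prob_space)
  qed
  finally show ?thesis using Y_mean[OF gp_range[OF assms]] by simp
qed

definition mE :: real where "mE = gc * (\<bar>\<kappa>\<bar> * \<bar>\<kappa>1 + \<kappa> * x0\<bar> * rc)"

lemma mE_nonneg: "0 \<le> mE" using gc rc by (simp add: mE_def)

text \<open>Freezing is exact for constants, so only the multiple of \<open>Rint\<close> in the mean
  contributes a local error. The error follows the recursion of the scheme with this source.\<close>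

lemma mean_error:
  assumes "1 \<le> n" "k \<le> n"
  shows "\<bar>mean (gp n k) - emean n k\<bar> \<le> mE / real n"
proof -
  let ?b = "\<bar>\<kappa>\<bar> * (\<bar>\<kappa>1 + \<kappa> * x0\<bar> * (rc / real n))"
  have rec: "mean (gp n k) - emean n k = \<kappa> * (\<Sum>i<k. wt n k i * (mean (gp n i) - emean n i))
      + \<kappa> * ((\<kappa>1 + \<kappa> * x0) * (\<integral>s. K (gp n k - s) * (Rint s - Rint (grid_floor T n s)) \<partial>L))" if k: "k \<le> n" for k
  proof -
    note g = grid_integral[OF assms(1) k]
    have i1: "integrable L (\<lambda>s. K (gp n k - s) * mean s)" by (rule K_mean_integrable[OF gp_range[OF assms(1) k]])
    have i2: "integrable L (\<lambda>s. K (gp n k - s) * mean (gp n (gidx n s)))" by (rule g(1))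
    have "(\<kappa>1 + \<kappa> * x0) * (\<integral>s. K (gp n k - s) * (Rint s - Rint (grid_floor T n s)) \<partial>L) =
        (\<integral>s. K (gp n k - s) * mean s - K (gp n k - s) * mean (gp n (gidx n s)) \<partial>L)"
      by (subst integral_mult_right_zero[symmetric], intro Bochner_Integration.integral_cong)
         (auto simp: mean_def grid_floor_gidx algebra_simps)
    also have "\<dots> = (\<integral>s. K (gp n k - s) * mean s \<partial>L) - (\<Sum>i<k. wt n k i * mean (gp n i))"
      using i1 i2 g(2)[of "\<lambda>i. mean (gp n i)"] by simp
    finally have e1: "(\<kappa>1 + \<kappa> * x0) * (\<integral>s. K (gp n k - s) * (Rint s - Rint (grid_floor T n s)) \<partial>L) =
       (\<integral>s. K (gp n k - s) * mean s \<partial>L) - (\<Sum>i<k. wt n k i * mean (gp n i))" .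
    have e2: "IK (gp n k) = (\<Sum>i<k. wt n k i)" using g(2)[of "\<lambda>_. 1"] by (simp add: IK_def)
    have e3: "emean n k = x0 + \<kappa>1 * (\<Sum>i<k. wt n k i) + \<kappa> * (\<Sum>i<k. wt n k i * emean n i)"
      unfolding emean_eq[OF assms(1) k] by (simp add: distrib_left sum.distrib sum_distrib_left mult_ac)
    show ?thesis unfolding e1 e3 mean_eq[OF gp_range[OF assms(1) k]] e2
      by (simp add: right_diff_distrib sum_subtractf)
  qed
  have "\<bar>mean (gp n k) - emean n k\<bar> \<le> gc * ?b"
  proof (rule gc(2)[where a = "\<lambda>k. mean (gp n k) - emean n k", OF assms(1) _ _ assms(2)])
    show "0 \<le> ?b" using rc by simp
    show "\<bar>mean (gp n k) - emean n k\<bar> \<le> \<bar>\<kappa>\<bar> * (\<Sum>i<k. wt n k i * \<bar>mean (gp n i) - emean n i\<bar>) + ?b" if k: "k \<le> n" for k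
    proof (subst rec[OF k], rule order.trans[OF abs_triangle_ineq], rule add_mono)
      have "\<bar>\<Sum>i<k. wt n k i * (mean (gp n i) - emean n i)\<bar> \<le> (\<Sum>i<k. wt n k i * \<bar>mean (gp n i) - emean n i\<bar>)"
        by (rule order.trans[OF sum_abs]) (simp add: abs_mult wt_nonneg)
      then show "\<bar>\<kappa> * (\<Sum>i<k. wt n k i * (mean (gp n i) - emean n i))\<bar> \<le> \<bar>\<kappa>\<bar> * (\<Sum>i<k. wt n k i * \<bar>mean (gp n i) - emean n i\<bar>)"
        unfolding abs_mult by (rule mult_left_mono) simp
      show "\<bar>\<kappa> * ((\<kappa>1 + \<kappa> * x0) * (\<integral>s. K (gp n k - s) * (Rint s - Rint (grid_floor T n s)) \<partial>L))\<bar> \<le> ?b"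
        unfolding abs_mult by (intro mult_left_mono rc(2) assms gp_range k) auto
    qed
  qed
  then show ?thesis by (simp add: mE_def mult.assoc)
qed

definition Ge :: "nat \<Rightarrow> nat \<Rightarrow> 'a \<Rightarrow> real" where "Ge n k \<omega> = Xe n (gp n k) \<omega> - emean n k"

lemma Ge_sqint: "1 \<le> n \<Longrightarrow> k \<le> n \<Longrightarrow> sqint M (Ge n k)"
  using sqint_diff[OF Xe_sqint sqint_const] by (simp add: Ge_def[abs_def])

lemma Ge_mean: "1 \<le> n \<Longrightarrow> k \<le> n \<Longrightarrow> (\<integral>\<omega>. Ge n k \<omega> \<partial>M) = 0"
  using sqint_integrable[OF Xe_sqint, of n k] by (simp add: Ge_def emean_def prob_space)

lemma Ge_eq:
  assumes "1 \<le> n" "k \<le> n"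
  shows "AE \<omega> in M. Ge n k \<omega> = \<kappa> * (\<Sum>i<k. wt n k i * Ge n i \<omega>) + \<sigma> * Y (gp n k) \<omega>"
  using Xe_eq[OF assms]
proof eventually_elim
  case (elim \<omega>)
  show ?case unfolding Ge_def elim emean_eq[OF assms]
    by (simp add: right_diff_distrib distrib_left sum.distrib sum_distrib_left sum_subtractf mult_ac)
qed

text \<open>By the recursion, each centred value is a linear combination of earlier ones and a
  Wiener integral, so strong induction stays inside the Gaussian space.\<close>

lemma Ge_wiener_limit:
  assumes "1 \<le> n" "k \<le> n"
  shows "wiener_limit (Ge n k)"
  using assms(2)
proof (induction k rule: less_induct)
  case (less k)
  show ?case
  proof (rule wiener_limit_cong_AE)
    show "wiener_limit (\<lambda>\<omega>. \<kappa> * (\<Sum>i<k. wt n k i * Ge n i \<omega>) + \<sigma> * Y (gp n k) \<omega>)"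
      using less assms(1)
      by (intro wiener_limit_add wiener_limit_cmult wiener_limit_sum wiener_limit_wiener_integral[OF Y_wiener] gp_range) auto
    show "Ge n k \<in> borel_measurable M" using Ge_sqint[OF assms(1) less.prems] by (rule sqint_measurable)
    show "AE \<omega> in M. \<kappa> * (\<Sum>i<k. wt n k i * Ge n i \<omega>) + \<sigma> * Y (gp n k) \<omega> = Ge n k \<omega>"
      using Ge_eq[OF assms(1) less.prems] by eventually_elim simp
  qed
qed

section \<open>Propagation of the error in mean square pairings\<close>

definition err :: "nat \<Rightarrow> nat \<Rightarrow> 'a \<Rightarrow> real" where "err n k \<omega> = G (gp n k) \<omega> - Ge n k \<omega>"

text \<open>The local error: it is almost surely \<open>\<kappa>\<close> times the integral of
  \<open>K (gp n k - s) * (G s - G (grid_floor T n s))\<close>.\<close>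

definition loc :: "nat \<Rightarrow> nat \<Rightarrow> 'a \<Rightarrow> real" where
  "loc n k \<omega> = err n k \<omega> - \<kappa> * (\<Sum>i<k. wt n k i * err n i \<omega>)"

lemma err_sqint: "1 \<le> n \<Longrightarrow> k \<le> n \<Longrightarrow> sqint M (err n k)"
  using sqint_diff[OF G_sqint[OF gp_range] Ge_sqint] by (simp add: err_def[abs_def])

lemma loc_sqint:
  assumes "1 \<le> n" "k \<le> n"
  shows "sqint M (loc n k)"
  unfolding loc_def[abs_def] using assms
  by (intro sqint_diff sqint_cmult sqint_sum err_sqint) auto

lemma inner_sum:
  assumes "\<And>i. i < k \<Longrightarrow> sqint M (f i)" "sqint M V"
  shows "(\<integral>\<omega>. (\<Sum>i<k. w i * f i \<omega>) * V \<omega> \<partial>M) = (\<Sum>i<k. w i * (\<integral>\<omega>. f i \<omega> * V \<omega> \<partial>M))"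
proof -
  have "(\<integral>\<omega>. (\<Sum>i<k. w i * f i \<omega>) * V \<omega> \<partial>M) = (\<integral>\<omega>. (\<Sum>i<k. w i * (f i \<omega> * V \<omega>)) \<partial>M)"
    by (simp add: sum_distrib_right mult.assoc)
  also have "\<dots> = (\<Sum>i<k. (\<integral>\<omega>. w i * (f i \<omega> * V \<omega>) \<partial>M))"
    using sqint_mult[OF assms(1) assms(2)] by (intro Bochner_Integration.integral_sum) auto
  finally show ?thesis by simp
qed

lemma Ge_inner_eq:
  assumes n: "1 \<le> n" "k \<le> n" and V: "sqint M V"
  shows "(\<integral>\<omega>. Ge n k \<omega> * V \<omega> \<partial>M) = \<kappa> * (\<Sum>i<k. wt n k i * (\<integral>\<omega>. Ge n i \<omega> * V \<omega> \<partial>M)) + \<sigma> * (\<integral>\<omega>. Y (gp n k) \<omega> * V \<omega> \<partial>M)"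
proof -
  let ?S = "\<lambda>\<omega>. \<Sum>i<k. wt n k i * Ge n i \<omega>"
  have S: "sqint M ?S" using n by (intro sqint_sum sqint_cmult Ge_sqint) auto
  have Yk: "sqint M (Y (gp n k))" by (intro Y_sqint gp_range n)
  have "(\<integral>\<omega>. Ge n k \<omega> * V \<omega> \<partial>M) = (\<integral>\<omega>. \<kappa> * (?S \<omega> * V \<omega>) + \<sigma> * (Y (gp n k) \<omega> * V \<omega>) \<partial>M)"
  proof (rule integral_cong_AE)
    show "AE \<omega> in M. Ge n k \<omega> * V \<omega> = \<kappa> * (?S \<omega> * V \<omega>) + \<sigma> * (Y (gp n k) \<omega> * V \<omega>)"
      using Ge_eq[OF n] by eventually_elim (simp add: distrib_right mult.assoc)
  qed (use sqint_mult[OF Ge_sqint[OF n] V] sqint_mult[OF S V] sqint_mult[OF Yk V] in auto)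
  also have "\<dots> = \<kappa> * (\<integral>\<omega>. ?S \<omega> * V \<omega> \<partial>M) + \<sigma> * (\<integral>\<omega>. Y (gp n k) \<omega> * V \<omega> \<partial>M)"
    using sqint_mult[OF S V] sqint_mult[OF Yk V] by simp
  also have "(\<integral>\<omega>. ?S \<omega> * V \<omega> \<partial>M) = (\<Sum>i<k. wt n k i * (\<integral>\<omega>. Ge n i \<omega> * V \<omega> \<partial>M))"
    using n V by (intro inner_sum Ge_sqint) auto
  finally show ?thesis .
qed

lemma err_inner:
  assumes "1 \<le> n" "k \<le> n" "sqint M V"
  shows "(\<integral>\<omega>. err n k \<omega> * V \<omega> \<partial>M) = (\<integral>\<omega>. G (gp n k) \<omega> * V \<omega> \<partial>M) - (\<integral>\<omega>. Ge n k \<omega> * V \<omega> \<partial>M)"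
  using sqint_mult[OF G_sqint[OF gp_range[OF assms(1,2)]] assms(3)] sqint_mult[OF Ge_sqint[OF assms(1,2)] assms(3)]
  by (simp add: err_def left_diff_distrib)

lemma loc_inner:
  assumes "1 \<le> n" "k \<le> n" "sqint M V"
  shows "(\<integral>\<omega>. loc n k \<omega> * V \<omega> \<partial>M) =
    (\<integral>\<omega>. err n k \<omega> * V \<omega> \<partial>M) - \<kappa> * (\<Sum>i<k. wt n k i * (\<integral>\<omega>. err n i \<omega> * V \<omega> \<partial>M))"
proof -
  let ?S = "\<lambda>\<omega>. \<Sum>i<k. wt n k i * err n i \<omega>"
  have S: "sqint M ?S" using assms by (intro sqint_sum sqint_cmult err_sqint) auto
  have "(\<integral>\<omega>. loc n k \<omega> * V \<omega> \<partial>M) = (\<integral>\<omega>. err n k \<omega> * V \<omega> - \<kappa> * (?S \<omega> * V \<omega>) \<partial>M)"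
    by (simp add: loc_def left_diff_distrib mult.assoc)
  also have "\<dots> = (\<integral>\<omega>. err n k \<omega> * V \<omega> \<partial>M) - \<kappa> * (\<integral>\<omega>. ?S \<omega> * V \<omega> \<partial>M)"
    using sqint_mult[OF S assms(3)] sqint_mult[OF err_sqint[OF assms(1,2)] assms(3)] by simp
  also have "(\<integral>\<omega>. ?S \<omega> * V \<omega> \<partial>M) = (\<Sum>i<k. wt n k i * (\<integral>\<omega>. err n i \<omega> * V \<omega> \<partial>M))"
    using assms by (intro inner_sum err_sqint) auto
  finally show ?thesis .
qed

text \<open>The pairings of the Wiener integral with \<open>V\<close> cancel, and the terms of the
  scheme cancel by the definition of \<open>loc\<close>. What is left sees only how
  \<open>\<integral>\<omega>. G s \<omega> * V \<omega> \<partial>M\<close> varies within a cell,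
  for any \<open>V\<close>.\<close>

lemma loc_inner_G:
  assumes n: "1 \<le> n" "k \<le> n" and V: "sqint M V"
  shows "(\<integral>\<omega>. loc n k \<omega> * V \<omega> \<partial>M) = \<kappa> * ((\<integral>s. K (gp n k - s) * (\<integral>\<omega>. G s \<omega> * V \<omega> \<partial>M) \<partial>L)
     - (\<integral>s. K (gp n k - s) * (\<integral>\<omega>. G (grid_floor T n s) \<omega> * V \<omega> \<partial>M) \<partial>L))"
proof -
  have "(\<Sum>i<k. wt n k i * (\<integral>\<omega>. err n i \<omega> * V \<omega> \<partial>M)) =
      (\<Sum>i<k. wt n k i * (\<integral>\<omega>. G (gp n i) \<omega> * V \<omega> \<partial>M)) - (\<Sum>i<k. wt n k i * (\<integral>\<omega>. Ge n i \<omega> * V \<omega> \<partial>M))"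
    unfolding sum_subtractf[symmetric] using n V by (intro sum.cong) (simp_all add: err_inner right_diff_distrib)
  moreover have "(\<Sum>i<k. wt n k i * (\<integral>\<omega>. G (gp n i) \<omega> * V \<omega> \<partial>M)) =
      (\<integral>s. K (gp n k - s) * (\<integral>\<omega>. G (grid_floor T n s) \<omega> * V \<omega> \<partial>M) \<partial>L)"
    unfolding grid_floor_gidx by (rule grid_integral(2)[OF n, symmetric])
  ultimately show ?thesis
    unfolding loc_inner[OF n V] err_inner[OF n V] G_inner_eq[OF V gp_range[OF n]] Ge_inner_eq[OF n V]
    by (simp add: right_diff_distrib)
qed

text \<open>For fixed \<open>V\<close> the pairings of \<open>err\<close> obey the recursion of the
  scheme with the pairings of \<open>loc\<close> as source, so the deterministic Gronwall inequality
  applies.\<close>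

lemma err_inner_le:
  assumes n: "1 \<le> n" "k \<le> n" and V: "sqint M V" and b: "\<And>k. k \<le> n \<Longrightarrow> \<bar>\<integral>\<omega>. loc n k \<omega> * V \<omega> \<partial>M\<bar> \<le> b" "0 \<le> b"
  shows "\<bar>\<integral>\<omega>. err n k \<omega> * V \<omega> \<partial>M\<bar> \<le> gc * b"
proof (rule gc(2)[where a = "\<lambda>k. \<integral>\<omega>. err n k \<omega> * V \<omega> \<partial>M", OF n(1) b(2) _ n(2)])
  fix k assume k: "k \<le> n"
  let ?a = "\<lambda>k. \<integral>\<omega>. err n k \<omega> * V \<omega> \<partial>M"
  have "?a k = \<kappa> * (\<Sum>i<k. wt n k i * ?a i) + (\<integral>\<omega>. loc n k \<omega> * V \<omega> \<partial>M)"
    using loc_inner[OF n(1) k V] by simp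
  then have "\<bar>?a k\<bar> \<le> \<bar>\<kappa>\<bar> * \<bar>\<Sum>i<k. wt n k i * ?a i\<bar> + \<bar>\<integral>\<omega>. loc n k \<omega> * V \<omega> \<partial>M\<bar>"
    by (simp only: abs_mult[symmetric] abs_triangle_ineq)
  also have "\<dots> \<le> \<bar>\<kappa>\<bar> * (\<Sum>i<k. wt n k i * \<bar>?a i\<bar>) + b"
    by (intro add_mono mult_left_mono order.trans[OF sum_abs] b k) (simp_all add: abs_mult wt_nonneg)
  finally show "\<bar>?a k\<bar> \<le> \<bar>\<kappa>\<bar> * (\<Sum>i<k. wt n k i * \<bar>?a i\<bar>) + b" .
qed

definition bE :: "nat \<Rightarrow> real" where "bE n = \<bar>\<kappa>\<bar> * (\<sigma>\<^sup>2 * (lc * srate (T / real n)))"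

lemma srate_nonneg: "1 \<le> n \<Longrightarrow> 0 \<le> srate (T / real n)"
  using T_pos by (auto simp: srate_def intro!: mult_nonneg_nonneg divide_nonneg_nonneg add_nonneg_nonneg)

lemma bE_nonneg: "1 \<le> n \<Longrightarrow> 0 \<le> bE n"
  using srate_nonneg lc by (simp add: bE_def)

lemma loc_G_le:
  assumes n: "1 \<le> n" "k \<le> n" and u: "u \<in> {0..T}"
  shows "\<bar>\<integral>\<omega>. loc n k \<omega> * G u \<omega> \<partial>M\<bar> \<le> bE n"
proof -
  have i1: "integrable L (\<lambda>s. K (gp n k - s) * cov s u)"
    using cb(2) u gp_le[OF n] by (intro K_bounded_integrable(1)[where B = cb]) auto
  have i2: "integrable L (\<lambda>s. K (gp n k - s) * cov (grid_floor T n s) u)"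
    unfolding grid_floor_gidx by (rule grid_integral(1)[OF n])
  have e1: "(\<integral>s. K (gp n k - s) * (\<integral>\<omega>. G s \<omega> * G u \<omega> \<partial>M) \<partial>L) = (\<integral>s. \<sigma>\<^sup>2 * (K (gp n k - s) * cov s u) \<partial>L)"
    using u by (intro Bochner_Integration.integral_cong) (auto simp: G_cov)
  have e2: "(\<integral>s. K (gp n k - s) * (\<integral>\<omega>. G (grid_floor T n s) \<omega> * G u \<omega> \<partial>M) \<partial>L) =
      (\<integral>s. \<sigma>\<^sup>2 * (K (gp n k - s) * cov (grid_floor T n s) u) \<partial>L)"
    using u eta_range[OF n(1)] by (intro Bochner_Integration.integral_cong) (simp_all add: G_cov)
  have "(\<integral>\<omega>. loc n k \<omega> * G u \<omega> \<partial>M) = \<kappa> * (\<sigma>\<^sup>2 * (\<integral>s. K (gp n k - s) * (cov s u - cov (grid_floor T n s) u) \<partial>L))"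
    unfolding loc_inner_G[OF n G_sqint[OF u]] e1 e2 using i1 i2 by (simp add: right_diff_distrib)
  then show ?thesis
    unfolding bE_def using lc(2)[OF n(1) gp_le[OF n] u] by (simp add: abs_mult mult_left_mono)
qed

text \<open>Taking \<open>V = loc n l\<close>, the paired function is itself bounded by
  \<open>bE n\<close> because of the estimate against \<open>G\<close>. Its increments are simply
  bounded by twice that size, and the kernel contributes its mass \<open>KI\<close>.\<close>

lemma loc_loc_le:
  assumes n: "1 \<le> n" "k \<le> n" "l \<le> n"
  shows "\<bar>\<integral>\<omega>. loc n k \<omega> * loc n l \<omega> \<partial>M\<bar> \<le> \<bar>\<kappa>\<bar> * (2 * KI * bE n)"
proof -
  have V: "sqint M (loc n l)" using n by (intro loc_sqint)
  let ?g = "\<lambda>s. \<integral>\<omega>. G s \<omega> * loc n l \<omega> \<partial>M"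
  have b: "\<bar>?g s\<bar> \<le> bE n" if "s \<in> {0..T}" for s
    using loc_G_le[OF n(1,3) that] by (simp add: mult.commute)
  have gm: "?g \<in> borel_measurable L" using V by (intro G_inner_measurable sqint_measurable)
  have "\<bar>\<integral>s. K (gp n k - s) * ?g s \<partial>L\<bar> \<le> KI * bE n"
    using gm b gp_le[OF n(1,2)] by (intro K_bounded_integrable(2))
  moreover have "\<bar>\<integral>s. K (gp n k - s) * ?g (grid_floor T n s) \<partial>L\<bar> \<le> KI * bE n"
  proof (rule K_bounded_integrable(2)[OF _ _ gp_le[OF n(1,2)]])
    have "(\<lambda>s. (\<lambda>i. ?g (gp n i)) (gidx n s)) \<in> borel_measurable borel"
      by (rule measurable_compose[OF gidx_measurable]) simp
    then show "(\<lambda>s. ?g (grid_floor T n s)) \<in> borel_measurable L"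
      unfolding grid_floor_gidx by (rule measurable_L)
    show "\<bar>?g (grid_floor T n s)\<bar> \<le> bE n" if "s \<in> {0..T}" for s
      using b eta_range[OF n(1) that] by blast
  qed
  ultimately have "\<bar>(\<integral>s. K (gp n k - s) * ?g s \<partial>L) - (\<integral>s. K (gp n k - s) * ?g (grid_floor T n s) \<partial>L)\<bar> \<le> 2 * KI * bE n"
    by linarith
  then show ?thesis unfolding loc_inner_G[OF n(1,2) V] abs_mult by (intro mult_left_mono) auto
qed

text \<open>Gronwall once in each index: with \<open>V = loc n k\<close> it replaces
  \<open>loc n l\<close> by \<open>err n l\<close>, and with \<open>V = err n l\<close> it replaces
  \<open>loc n k\<close> by \<open>err n k\<close>.\<close>

lemma err_err_le:
  assumes n: "1 \<le> n" "k \<le> n" "l \<le> n"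
  shows "\<bar>\<integral>\<omega>. err n k \<omega> * err n l \<omega> \<partial>M\<bar> \<le> gc * (gc * (\<bar>\<kappa>\<bar> * (2 * KI * bE n)))"
proof (rule err_inner_le[OF n(1,2) err_sqint[OF n(1,3)]])
  have nn: "0 \<le> \<bar>\<kappa>\<bar> * (2 * KI * bE n)" using KI_nonneg bE_nonneg[OF n(1)] by simp
  show "0 \<le> gc * (\<bar>\<kappa>\<bar> * (2 * KI * bE n))" using nn gc by simp
  show "\<bar>\<integral>\<omega>. loc n k \<omega> * err n l \<omega> \<partial>M\<bar> \<le> gc * (\<bar>\<kappa>\<bar> * (2 * KI * bE n))" if "k \<le> n" for k
    using err_inner_le[OF n(1,3) loc_sqint[OF n(1) that] loc_loc_le[OF n(1) _ that] nn] by (simp add: mult.commute)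
qed

lemma err_G_le:
  assumes n: "1 \<le> n" "k \<le> n" and u: "u \<in> {0..T}"
  shows "\<bar>\<integral>\<omega>. err n k \<omega> * G u \<omega> \<partial>M\<bar> \<le> gc * bE n"
  using err_inner_le[OF n G_sqint[OF u] loc_G_le[OF n(1) _ u] bE_nonneg[OF n(1)]] .

definition vE :: real where
  "vE = (2 * gc + gc * (gc * (\<bar>\<kappa>\<bar> * (2 * KI)))) * (\<bar>\<kappa>\<bar> * (\<sigma>\<^sup>2 * lc)) * sc"

lemma vE_nonneg: "0 \<le> vE"
  using gc lc sc KI_nonneg by (simp add: vE_def)

text \<open>Expanding \<open>Ge = G - err\<close>, the covariance error is linear in the inner products of the error
  with the Gaussian solution, up to a term that is quadratic in the error.\<close>

lemma cov_error:
  assumes n: "1 \<le> n" "k \<le> n" "l \<le> n"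
  shows "\<bar>(\<integral>\<omega>. G (gp n k) \<omega> * G (gp n l) \<omega> \<partial>M) - (\<integral>\<omega>. Ge n k \<omega> * Ge n l \<omega> \<partial>M)\<bar> \<le> vE * (euler_rate \<alpha> n + 1 / real n)"
proof -
  have s: "sqint M (err n k)" "sqint M (err n l)" "sqint M (G (gp n k))" "sqint M (G (gp n l))"
    using n by (auto intro!: err_sqint G_sqint gp_range simp del: atLeastAtMost_iff)
  have "Ge n k \<omega> * Ge n l \<omega> = G (gp n k) \<omega> * G (gp n l) \<omega> - err n k \<omega> * G (gp n l) \<omega> - err n l \<omega> * G (gp n k) \<omega>
     + err n k \<omega> * err n l \<omega>" for \<omega>
    by (simp add: err_def algebra_simps)
  then have "(\<integral>\<omega>. Ge n k \<omega> * Ge n l \<omega> \<partial>M) = (\<integral>\<omega>. G (gp n k) \<omega> * G (gp n l) \<omega> \<partial>M) - (\<integral>\<omega>. err n k \<omega> * G (gp n l) \<omega> \<partial>M)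
     - (\<integral>\<omega>. err n l \<omega> * G (gp n k) \<omega> \<partial>M) + (\<integral>\<omega>. err n k \<omega> * err n l \<omega> \<partial>M)"
    using sqint_mult[OF s(3,4)] sqint_mult[OF s(1,4)] sqint_mult[OF s(2,3)] sqint_mult[OF s(1,2)]
    by (simp only: Bochner_Integration.integral_add Bochner_Integration.integral_diff
        Bochner_Integration.integrable_add Bochner_Integration.integrable_diff)
  moreover have "\<bar>\<integral>\<omega>. err n k \<omega> * G (gp n l) \<omega> \<partial>M\<bar> \<le> gc * bE n" "\<bar>\<integral>\<omega>. err n l \<omega> * G (gp n k) \<omega> \<partial>M\<bar> \<le> gc * bE n"
    by (rule err_G_le[OF n(1,2) gp_range[OF n(1,3)]], rule err_G_le[OF n(1,3) gp_range[OF n(1,2)]])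
  ultimately have "\<bar>(\<integral>\<omega>. G (gp n k) \<omega> * G (gp n l) \<omega> \<partial>M) - (\<integral>\<omega>. Ge n k \<omega> * Ge n l \<omega> \<partial>M)\<bar> \<le>
     gc * bE n + gc * bE n + gc * (gc * (\<bar>\<kappa>\<bar> * (2 * KI * bE n)))"
    using err_err_le[OF n] by linarith
  also have "\<dots> = (2 * gc + gc * (gc * (\<bar>\<kappa>\<bar> * (2 * KI)))) * (\<bar>\<kappa>\<bar> * (\<sigma>\<^sup>2 * lc)) * srate (T / real n)"
    by (simp add: bE_def algebra_simps)
  also have "\<dots> \<le> (2 * gc + gc * (gc * (\<bar>\<kappa>\<bar> * (2 * KI)))) * (\<bar>\<kappa>\<bar> * (\<sigma>\<^sup>2 * lc)) * (sc * (euler_rate \<alpha> n + 1 / real n))"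
    using gc lc KI_nonneg by (intro mult_left_mono sc n) auto
  finally show ?thesis by (simp add: vE_def mult.assoc)
qed

text \<open>Refining the grid keeps \<open>gp n k\<close> as a grid point, so \<open>G (gp n k)\<close> is a mean square limit of
  Gaussian random variables.\<close>

lemma G_gauss:
  assumes n: "1 \<le> n" "k \<le> n"
  shows "gauss M (G (gp n k)) (\<integral>\<omega>. (G (gp n k) \<omega>)\<^sup>2 \<partial>M)"
proof -
  let ?N = "\<lambda>j. n * Suc j" and ?k = "\<lambda>j. k * Suc j"
  have N: "1 \<le> ?N j" "?k j \<le> ?N j" for j using n mult_le_mono1[OF n(2), of "Suc j"] by auto
  have gpN: "gp (?N j) (?k j) = gp n k" for j
  proof -
    have "real k * T * real (Suc j) / (real n * real (Suc j)) = real k * T / real n"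
      by (rule mult_divide_mult_cancel_right) simp
    then show ?thesis by (simp only: grid_point_def of_nat_mult mult_ac)
  qed
  have lim: "(\<lambda>j. \<integral>\<omega>. (G (gp n k) \<omega> - Ge (?N j) (?k j) \<omega>)\<^sup>2 \<partial>M) \<longlonglongrightarrow> 0"
  proof (rule Lim_null_comparison)
    define c where "c = gc * (gc * (\<bar>\<kappa>\<bar> * (2 * KI * (\<bar>\<kappa>\<bar> * (\<sigma>\<^sup>2 * (lc * sc))))))"
    show "\<forall>\<^sub>F j in sequentially. norm (\<integral>\<omega>. (G (gp n k) \<omega> - Ge (?N j) (?k j) \<omega>)\<^sup>2 \<partial>M) \<le> c * (euler_rate \<alpha> (?N j) + 1 / real (?N j))"
    proof (rule always_eventually, rule allI)
      fix j
      have "norm (\<integral>\<omega>. (G (gp n k) \<omega> - Ge (?N j) (?k j) \<omega>)\<^sup>2 \<partial>M) = \<bar>\<integral>\<omega>. err (?N j) (?k j) \<omega> * err (?N j) (?k j) \<omega> \<partial>M\<bar>"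
        unfolding err_def gpN by (simp only: power2_eq_square real_norm_def)
      also have "\<dots> \<le> gc * (gc * (\<bar>\<kappa>\<bar> * (2 * KI * bE (?N j))))"
        by (rule err_err_le[OF N(1) N(2) N(2)])
      also have "\<dots> \<le> gc * (gc * (\<bar>\<kappa>\<bar> * (2 * KI * (\<bar>\<kappa>\<bar> * (\<sigma>\<^sup>2 * (lc * (sc * (euler_rate \<alpha> (?N j) + 1 / real (?N j)))))))))"
        unfolding bE_def using gc lc KI_nonneg by (intro mult_left_mono sc N) auto
      also have "\<dots> = c * (euler_rate \<alpha> (?N j) + 1 / real (?N j))" by (simp only: c_def mult.assoc)
      finally show "norm (\<integral>\<omega>. (G (gp n k) \<omega> - Ge (?N j) (?k j) \<omega>)\<^sup>2 \<partial>M) \<le> c * (euler_rate \<alpha> (?N j) + 1 / real (?N j))" .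
    qed
    have sm: "strict_mono ?N" using n by (auto simp: strict_mono_def)
    have "(\<lambda>n. c * (euler_rate \<alpha> n + 1 / real n)) \<longlonglongrightarrow> c * (0 + 0)"
      by (intro tendsto_mult_left tendsto_add euler_rate_tendsto lim_1_over_n)
    from LIMSEQ_subseq_LIMSEQ[OF this sm]
    show "(\<lambda>j. c * (euler_rate \<alpha> (?N j) + 1 / real (?N j))) \<longlonglongrightarrow> 0" by (simp add: o_def)
  qed
  show ?thesis
  proof (rule gauss_limit[OF G_sqint[OF gp_range[OF n]] _ _ lim])
    show "sqint M (Ge (?N j) (?k j))" for j by (rule Ge_sqint[OF N])
    show "\<exists>v. gauss M (Ge (?N j) (?k j)) v" for j
      using wiener_limit_gauss[OF Ge_wiener_limit[OF N]] by blast
  qed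
qed

section \<open>From means and covariances to moments and weak errors\<close>

definition mB :: real where "mB = \<bar>x0\<bar> + \<bar>\<kappa>1 + \<kappa> * x0\<bar> * rb"

lemma mean_le: "t \<in> {0..T} \<Longrightarrow> \<bar>mean t\<bar> \<le> mB"
proof -
  assume t: "t \<in> {0..T}"
  have "\<bar>mean t\<bar> \<le> \<bar>x0\<bar> + \<bar>\<kappa>1 + \<kappa> * x0\<bar> * \<bar>Rint t\<bar>"
    unfolding mean_def abs_mult[symmetric] by (rule abs_triangle_ineq)
  also have "\<dots> \<le> mB" unfolding mB_def using rb(2)[OF t] by (intro add_left_mono mult_left_mono) auto
  finally show ?thesis .
qed

lemma mean_error_le:
  assumes "1 \<le> n" "k \<le> n"
  shows "\<bar>mean (gp n k) - emean n k\<bar> \<le> mE" "\<bar>emean n k\<bar> \<le> mB + mE"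
proof -
  have "mE / real n \<le> mE / 1" using assms mE_nonneg by (intro divide_left_mono) auto
  then show "\<bar>mean (gp n k) - emean n k\<bar> \<le> mE" using mean_error[OF assms] by simp
  then show "\<bar>emean n k\<bar> \<le> mB + mE" using mean_le[OF gp_range[OF assms]] by linarith
qed

lemma mB_nonneg: "0 \<le> mB" using rb by (simp add: mB_def)

definition pE :: real where "pE = vE + (2 * mB + mE) * mE"

text \<open>Both centred processes have mean 0, so a second moment is a covariance plus a product of
  means. The product of means is compared factor by factor.\<close>

lemma product_error:
  assumes n: "1 \<le> n" "k \<le> n" "l \<le> n"
  shows "\<bar>(\<integral>\<omega>. X (gp n k) \<omega> * X (gp n l) \<omega> \<partial>M) - (\<integral>\<omega>. Xe n (gp n k) \<omega> * Xe n (gp n l) \<omega> \<partial>M)\<bar>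
    \<le> pE * (euler_rate \<alpha> n + 1 / real n)"
proof -
  let ?m = "mean (gp n k)" and ?m' = "mean (gp n l)" and ?e = "emean n k" and ?e' = "emean n l"
  have split: "(\<integral>\<omega>. (U \<omega> + a) * (V \<omega> + b) \<partial>M) = (\<integral>\<omega>. U \<omega> * V \<omega> \<partial>M) + a * b"
    if "sqint M U" "sqint M V" "(\<integral>\<omega>. U \<omega> \<partial>M) = 0" "(\<integral>\<omega>. V \<omega> \<partial>M) = 0" for U V a b
  proof -
    have "(\<integral>\<omega>. (U \<omega> + a) * (V \<omega> + b) \<partial>M) = (\<integral>\<omega>. U \<omega> * V \<omega> + (b * U \<omega> + a * V \<omega>) + a * b \<partial>M)"
      by (intro Bochner_Integration.integral_cong) (auto simp: algebra_simps)
    also have "\<dots> = (\<integral>\<omega>. U \<omega> * V \<omega> \<partial>M) + a * b"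
      using sqint_mult[OF that(1,2)] sqint_integrable[OF that(1)] sqint_integrable[OF that(2)] that(3,4)
      by (simp add: prob_space)
    finally show ?thesis .
  qed
  have 1: "(\<integral>\<omega>. X (gp n k) \<omega> * X (gp n l) \<omega> \<partial>M) = (\<integral>\<omega>. G (gp n k) \<omega> * G (gp n l) \<omega> \<partial>M) + ?m * ?m'"
    using split[OF G_sqint G_sqint G_mean G_mean, of "gp n k" "gp n l" ?m ?m'] gp_range[OF n(1)] n
    by (simp add: G_def)
  have 2: "(\<integral>\<omega>. Xe n (gp n k) \<omega> * Xe n (gp n l) \<omega> \<partial>M) = (\<integral>\<omega>. Ge n k \<omega> * Ge n l \<omega> \<partial>M) + ?e * ?e'"
    using split[OF Ge_sqint Ge_sqint Ge_mean Ge_mean, of n k n l ?e ?e'] n by (simp add: Ge_def)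
  have "?m * ?m' - ?e * ?e' = (?m - ?e) * ?m' + ?e * (?m' - ?e')" by (simp add: algebra_simps)
  also have "\<bar>(?m - ?e) * ?m' + ?e * (?m' - ?e')\<bar> \<le> \<bar>?m - ?e\<bar> * \<bar>?m'\<bar> + \<bar>?e\<bar> * \<bar>?m' - ?e'\<bar>"
    unfolding abs_mult[symmetric] by (rule abs_triangle_ineq)
  also have "\<dots> \<le> mE / real n * mB + (mB + mE) * (mE / real n)"
    using mE_nonneg mB_nonneg n
    by (intro add_mono mult_mono mean_error mean_error_le mean_le gp_range) auto
  also have "\<dots> = (2 * mB + mE) * mE * (1 / real n)" by (simp add: algebra_simps add_divide_distrib)
  also have "\<dots> \<le> (2 * mB + mE) * mE * (euler_rate \<alpha> n + 1 / real n)"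
    using mE_nonneg mB_nonneg euler_rate_nonneg[OF n(1), of \<alpha>] by (intro mult_left_mono) auto
  finally show ?thesis using cov_error[OF n] unfolding 1 2 pE_def distrib_right by linarith
qed

lemma covariance_error:
  assumes n: "1 \<le> n" "k \<le> n" "l \<le> n"
  shows "\<bar>covariance M (X (gp n k)) (X (gp n l)) - covariance M (Xe n (gp n k)) (Xe n (gp n l))\<bar>
    \<le> vE * (euler_rate \<alpha> n + 1 / real n)"
  using cov_error[OF n] gp_range[OF n(1,2)] gp_range[OF n(1,3)]
  unfolding covariance_def Ge_def emean_def G_def by (simp add: X_mean)

text \<open>A common bound for the means and variances of solution and scheme, which fixes one
  Lipschitz constant for all \<open>n\<close> and \<open>k\<close>. The variance of the scheme is
  that of the solution plus an error; the 2 bounds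
  \<open>euler_rate \<alpha> n + 1 / real n\<close>.\<close>

definition gB :: real where "gB = mB + mE + (\<sigma>\<^sup>2 * cb + 2 * vE)"

lemma weak_error:
  assumes n: "1 \<le> n" "k \<le> n" and P: "\<Psi> \<in> borel_measurable borel" "0 \<le> pc"
    "\<And>m m' v v'. \<bar>m\<bar> \<le> gB \<Longrightarrow> \<bar>m'\<bar> \<le> gB \<Longrightarrow> 0 \<le> v \<Longrightarrow> v \<le> gB \<Longrightarrow> 0 \<le> v' \<Longrightarrow> v' \<le> gB \<Longrightarrow>
      \<bar>normal_expect \<Psi> m v - normal_expect \<Psi> m' v'\<bar> \<le> pc * (\<bar>m - m'\<bar> + \<bar>v - v'\<bar>)"
  shows "\<bar>(\<integral>\<omega>. \<Psi> (Xe n (gp n k) \<omega>) \<partial>M) - (\<integral>\<omega>. \<Psi> (X (gp n k) \<omega>) \<partial>M)\<bar>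
    \<le> pc * (mE + vE) * (euler_rate \<alpha> n + 1 / real n)"
proof -
  let ?m = "mean (gp n k)" and ?e = "emean n k" and ?r = "euler_rate \<alpha> n + 1 / real n"
  let ?v = "\<integral>\<omega>. (G (gp n k) \<omega>)\<^sup>2 \<partial>M" and ?w = "\<integral>\<omega>. (Ge n k \<omega>)\<^sup>2 \<partial>M"
  have r: "0 \<le> ?r" "?r \<le> 2" "1 / real n \<le> ?r"
  proof -
    have "1 / real n \<le> 1" using n by simp
    then show "0 \<le> ?r" "?r \<le> 2" "1 / real n \<le> ?r"
      using euler_rate_nonneg[OF n(1), of \<alpha>] euler_rate_le_1[OF alpha_gt n(1)] by auto
  qed
  have "(\<integral>\<omega>. \<Psi> (?m + G (gp n k) \<omega>) \<partial>M) = normal_expect \<Psi> ?m ?v"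
    by (rule gauss_expect[OF G_gauss[OF n] P(1)])
  then have 1: "(\<integral>\<omega>. \<Psi> (X (gp n k) \<omega>) \<partial>M) = normal_expect \<Psi> ?m ?v" by (simp add: G_def)
  have "(\<integral>\<omega>. \<Psi> (?e + Ge n k \<omega>) \<partial>M) = normal_expect \<Psi> ?e ?w"
    by (rule gauss_expect[OF wiener_limit_gauss[OF Ge_wiener_limit[OF n]] P(1)])
  then have 2: "(\<integral>\<omega>. \<Psi> (Xe n (gp n k) \<omega>) \<partial>M) = normal_expect \<Psi> ?e ?w" by (simp add: Ge_def)
  have d: "\<bar>?v - ?w\<bar> \<le> vE * ?r" using cov_error[OF n n(2)] by (simp add: power2_eq_square)
  have vv: "vE * ?r \<le> 2 * vE" using r vE_nonneg mult_left_mono[OF r(2) vE_nonneg] by simp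
  have v: "0 \<le> ?v" "0 \<le> ?w" by auto
  have "\<bar>cov (gp n k) (gp n k)\<bar> \<le> cb" using gp_le[OF n] by (intro cb)
  then have vb: "?v \<le> \<sigma>\<^sup>2 * cb"
    using G_cov[OF gp_range[OF n] gp_range[OF n]] mult_left_mono[of "cov (gp n k) (gp n k)" cb "\<sigma>\<^sup>2"]
    by (simp add: power2_eq_square)
  have cbn: "0 \<le> \<sigma>\<^sup>2 * cb" using cb by simp
  have "\<bar>?m\<bar> \<le> gB" "\<bar>?e\<bar> \<le> gB" "?v \<le> gB" "?w \<le> gB"
    using mean_le[OF gp_range[OF n]] mean_error_le(2)[OF n] vb d vv cbn mB_nonneg mE_nonneg vE_nonneg
    unfolding gB_def by linarith+
  then have "\<bar>normal_expect \<Psi> ?e ?w - normal_expect \<Psi> ?m ?v\<bar> \<le> pc * (\<bar>?e - ?m\<bar> + \<bar>?w - ?v\<bar>)"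
    using v by (intro P(3))
  also have "\<dots> \<le> pc * (mE * ?r + vE * ?r)"
  proof -
    have "mE / real n \<le> mE * ?r" using mult_left_mono[OF r(3) mE_nonneg] by simp
    then show ?thesis using mean_error[OF n] d P(2) by (intro mult_left_mono add_mono) (auto simp: abs_minus_commute)
  qed
  finally show ?thesis unfolding 1 2 by (simp add: algebra_simps)
qed

end

theorem theorem2p7:
  fixes T x0 \<kappa>1 \<kappa>2 \<sigma> \<alpha> :: real
  assumes "T > 0" and "\<sigma> > 0" and "1 / 2 < \<alpha>" and "\<alpha> \<le> 1"
  shows
    "(\<exists>C\<ge>0. \<forall>(M :: 'a measure) W X Xe. volterra_setting M W T x0 \<kappa>1 \<kappa>2 \<sigma> \<alpha> X Xe \<longrightarrow>
        (\<forall>n\<ge>1. \<forall>k1\<in>{1..n}. \<forall>k2\<in>{1..n}.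
           let t1 = grid_point T n k1; t2 = grid_point T n k2;
               bound = C * ((1 + t1 powr (\<alpha> - 1) + t2 powr (\<alpha> - 1)) * euler_rate \<alpha> n
                         + (t1 powr (2 * \<alpha> - 2) + t2 powr (2 * \<alpha> - 2)) / real n)
           in \<bar>(\<integral>\<omega>. X t1 \<omega> \<partial>M) - (\<integral>\<omega>. Xe n t1 \<omega> \<partial>M)\<bar> \<le> C / real n \<and>
              \<bar>(\<integral>\<omega>. X t1 \<omega> * X t2 \<omega> \<partial>M) - (\<integral>\<omega>. Xe n t1 \<omega> * Xe n t2 \<omega> \<partial>M)\<bar> \<le> bound \<and>
              \<bar>covariance M (X t1) (X t2) - covariance M (Xe n t1) (Xe n t2)\<bar> \<le> bound))
     \<and>
     (\<forall>\<Psi>\<in>C_exp 2. \<exists>C\<ge>0. \<forall>(M :: 'a measure) W X Xe.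
        volterra_setting M W T x0 \<kappa>1 \<kappa>2 \<sigma> \<alpha> X Xe \<longrightarrow>
        (\<forall>n\<ge>1. \<forall>k\<in>{1..n}.
           let t = grid_point T n k
           in \<bar>(\<integral>\<omega>. \<Psi> (Xe n t \<omega>) \<partial>M) - (\<integral>\<omega>. \<Psi> (X t \<omega>) \<partial>M)\<bar>
                \<le> C * ((1 + t powr (\<alpha> - 1)) * euler_rate \<alpha> n + t powr (2 * \<alpha> - 2) / real n)))
     \<and>
     (\<forall>\<Psi>\<in>C_exp 2. \<forall>(M :: 'a measure) W X Xe.
        volterra_setting M W T x0 \<kappa>1 \<kappa>2 \<sigma> \<alpha> X Xe \<longrightarrow>
        (\<lambda>n. \<bar>(\<integral>\<omega>. \<Psi> (Xe n T \<omega>) \<partial>M) - (\<integral>\<omega>. \<Psi> (X T \<omega>) \<partial>M)\<bar>) \<in> O(euler_rate \<alpha>))"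
proof -
  interpret F: fractional \<alpha> \<kappa>2 T using assms by unfold_locales
  obtain gc where gc: "0 \<le> gc" "\<And>n a b k. 1 \<le> n \<Longrightarrow> 0 \<le> b \<Longrightarrow>
      (\<And>k. k \<le> n \<Longrightarrow> \<bar>a k\<bar> \<le> \<bar>\<kappa>2\<bar> * (\<Sum>i<k. F.wt n k i * \<bar>a i\<bar>) + b) \<Longrightarrow> k \<le> n \<Longrightarrow> \<bar>a k\<bar> \<le> gc * b"
    by (fact F.discrete_gronwall)
  obtain lc where lc: "0 \<le> lc" "\<And>n t u. 1 \<le> n \<Longrightarrow> t \<le> T \<Longrightarrow> u \<in> {0..T} \<Longrightarrow>
      \<bar>\<integral>s. F.K (t - s) * (F.cov s u - F.cov (grid_floor T n s) u) \<partial>F.L\<bar> \<le> lc * F.srate (T / real n)"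
    by (fact F.cov_local_error)
  obtain rc where rc: "0 \<le> rc" "\<And>n t. 1 \<le> n \<Longrightarrow> t \<in> {0..T} \<Longrightarrow>
      \<bar>\<integral>s. F.K (t - s) * (F.Rint s - F.Rint (grid_floor T n s)) \<partial>F.L\<bar> \<le> rc / real n"
    by (fact F.Rint_local_error)
  obtain rb where rb: "0 \<le> rb" "\<And>s. s \<in> {0..T} \<Longrightarrow> \<bar>F.Rint s\<bar> \<le> rb"
    by (fact F.Rint_bound)
  obtain cb where cb: "0 \<le> cb" "\<And>s u. s \<le> T \<Longrightarrow> u \<le> T \<Longrightarrow> \<bar>F.cov s u\<bar> \<le> cb"
    by (fact F.cov_bound)
  obtain sc where sc: "0 \<le> sc" "\<And>n. 1 \<le> n \<Longrightarrow> F.srate (T / real n) \<le> sc * (euler_rate \<alpha> n + 1 / real n)"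
    by (fact F.srate_euler_rate)
  \<comment> \<open>All constants have been chosen at this point, before any probability space is
    introduced; this is what gives the quantifiers of the claim the right order.\<close>
  have model: "volterra_bounds \<alpha> \<kappa>2 T M W x0 \<kappa>1 \<sigma> X Xe gc lc rc rb cb sc"
    if "volterra_setting M W T x0 \<kappa>1 \<kappa>2 \<sigma> \<alpha> X Xe" for M :: "'a measure" and W X Xe
  proof -
    interpret BM: brownian_motion M W using that by (simp add: volterra_setting_def)
    interpret V: volterra_model \<alpha> \<kappa>2 T M W x0 \<kappa>1 \<sigma> X Xe
      by unfold_locales (use that in \<open>auto simp: volterra_setting_def\<close>)
    show ?thesis
      by unfold_locales (fact gc lc rc rb cb sc)+
  qed
  \<comment> \<open>The locale constants depend on the numerical parameters only, so they can be
    named here without a model.\<close>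
  define mE where "mE = volterra_bounds.mE \<kappa>2 x0 \<kappa>1 gc rc"
  define vE where "vE = volterra_bounds.vE \<alpha> \<kappa>2 T \<sigma> gc lc sc"
  define pE where "pE = volterra_bounds.pE \<alpha> \<kappa>2 T x0 \<kappa>1 \<sigma> gc lc rc rb sc"
  define gB where "gB = volterra_bounds.gB \<alpha> \<kappa>2 T x0 \<kappa>1 \<sigma> gc lc rc rb cb sc"
  define kc where "kc = 1 + T powr (2 - 2 * \<alpha>)"
  have kc: "1 \<le> kc" by (simp add: kc_def)
  have gp_pos: "0 < grid_point T n k" "grid_point T n k \<le> T" if "1 \<le> n" "k \<in> {1..n}" for n k
    using that assms grid_point_range[of T n k] by (auto simp: grid_point_def)
  have rate: "0 \<le> euler_rate \<alpha> n + 1 / real n" if "1 \<le> n" for n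
    using euler_rate_nonneg[OF that, of \<alpha>] by simp
  have weak: "\<exists>C\<ge>0. \<forall>(M :: 'a measure) W X Xe n k. volterra_setting M W T x0 \<kappa>1 \<kappa>2 \<sigma> \<alpha> X Xe \<longrightarrow> 1 \<le> n \<longrightarrow> k \<le> n \<longrightarrow>
      \<bar>(\<integral>\<omega>. \<Psi> (Xe n (grid_point T n k) \<omega>) \<partial>M) - (\<integral>\<omega>. \<Psi> (X (grid_point T n k) \<omega>) \<partial>M)\<bar> \<le> C * (euler_rate \<alpha> n + 1 / real n)"
    if \<Psi>: "\<Psi> \<in> C_exp 2" for \<Psi>
  proof -
    \<comment> \<open>\<open>gB\<close> is taken in absolute value because its sign is known only
      inside an instance of the locale, and none is at hand yet; the same holds for
      \<open>mE + vE\<close> below.\<close>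
    obtain pc where pc: "0 \<le> pc"
      "\<And>m m' v v'. \<bar>m\<bar> \<le> \<bar>gB\<bar> \<Longrightarrow> \<bar>m'\<bar> \<le> \<bar>gB\<bar> \<Longrightarrow> 0 \<le> v \<Longrightarrow> v \<le> \<bar>gB\<bar> \<Longrightarrow> 0 \<le> v' \<Longrightarrow> v' \<le> \<bar>gB\<bar> \<Longrightarrow>
        \<bar>normal_expect \<Psi> m v - normal_expect \<Psi> m' v'\<bar> \<le> pc * (\<bar>m - m'\<bar> + \<bar>v - v'\<bar>)"
      by (fact normal_expect_lipschitz[OF \<Psi> abs_ge_zero[of gB]])
    have d: "(\<Psi> has_real_derivative deriv \<Psi> x) (at x)" for x
      by (rule C_exp_2E[OF \<Psi>]) simp
    have meas: "\<Psi> \<in> borel_measurable borel"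
      by (intro borel_measurable_continuous_onI continuous_at_imp_continuous_on ballI DERIV_isCont[OF d])
    have "\<bar>(\<integral>\<omega>. \<Psi> (Xe n (grid_point T n k) \<omega>) \<partial>M) - (\<integral>\<omega>. \<Psi> (X (grid_point T n k) \<omega>) \<partial>M)\<bar>
        \<le> (pc * \<bar>mE + vE\<bar>) * (euler_rate \<alpha> n + 1 / real n)"
      if S: "volterra_setting M W T x0 \<kappa>1 \<kappa>2 \<sigma> \<alpha> X Xe" and n: "1 \<le> n" "k \<le> n" for M :: "'a measure" and W X Xe n k
    proof -
      interpret B: volterra_bounds \<alpha> \<kappa>2 T M W x0 \<kappa>1 \<sigma> X Xe gc lc rc rb cb sc by (rule model[OF S])
      have "\<bar>(\<integral>\<omega>. \<Psi> (Xe n (grid_point T n k) \<omega>) \<partial>M) - (\<integral>\<omega>. \<Psi> (X (grid_point T n k) \<omega>) \<partial>M)\<bar>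
        \<le> pc * (mE + vE) * (euler_rate \<alpha> n + 1 / real n)"
        unfolding mE_def vE_def using pc n meas by (intro B.weak_error) (auto simp: gB_def)
      also have "\<dots> \<le> (pc * \<bar>mE + vE\<bar>) * (euler_rate \<alpha> n + 1 / real n)"
        using pc(1) by (intro mult_right_mono mult_left_mono rate n) auto
      finally show ?thesis .
    qed
    moreover have "0 \<le> pc * \<bar>mE + vE\<bar>" using pc by simp
    ultimately show ?thesis by blast
  qed
  show ?thesis
  proof (intro conjI, goal_cases)
    case 1
    define C where "C = (\<bar>mE\<bar> + \<bar>vE\<bar> + \<bar>pE\<bar>) * kc"
    have C: "0 \<le> C" "mE \<le> C" using kc mult_left_mono[OF kc, of "\<bar>mE\<bar> + \<bar>vE\<bar> + \<bar>pE\<bar>"] by (auto simp: C_def)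
    have "\<bar>(\<integral>\<omega>. X t1 \<omega> \<partial>M) - (\<integral>\<omega>. Xe n t1 \<omega> \<partial>M)\<bar> \<le> C / real n \<and>
        \<bar>(\<integral>\<omega>. X t1 \<omega> * X t2 \<omega> \<partial>M) - (\<integral>\<omega>. Xe n t1 \<omega> * Xe n t2 \<omega> \<partial>M)\<bar> \<le> C * r \<and>
        \<bar>covariance M (X t1) (X t2) - covariance M (Xe n t1) (Xe n t2)\<bar> \<le> C * r"
      if S: "volterra_setting M W T x0 \<kappa>1 \<kappa>2 \<sigma> \<alpha> X Xe" and n: "1 \<le> n" "k1 \<in> {1..n}" "k2 \<in> {1..n}"
        and t: "t1 = grid_point T n k1" "t2 = grid_point T n k2"
        and r: "r = (1 + t1 powr (\<alpha> - 1) + t2 powr (\<alpha> - 1)) * euler_rate \<alpha> n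
                         + (t1 powr (2 * \<alpha> - 2) + t2 powr (2 * \<alpha> - 2)) / real n"
      for M :: "'a measure" and W X Xe n k1 k2 t1 t2 r
    proof -
      interpret B: volterra_bounds \<alpha> \<kappa>2 T M W x0 \<kappa>1 \<sigma> X Xe gc lc rc rb cb sc by (rule model[OF S])
      have k: "k1 \<le> n" "k2 \<le> n" using n by auto
      \<comment> \<open>The terms of the second time point are put into the slack \<open>a\<close>
        and \<open>b\<close>, so \<open>t1\<close> alone absorbs 1/n.\<close>
      have rr: "euler_rate \<alpha> n + 1 / real n \<le> kc * r"
        using F.inverse_euler_rate_le[OF n(1) gp_pos[OF n(1,2)], of "t1 powr (\<alpha> - 1) + t2 powr (\<alpha> - 1)" "t2 powr (2 * \<alpha> - 2)"]
        unfolding r t kc_def by (simp add: add.assoc)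
      have le: "e * (euler_rate \<alpha> n + 1 / real n) \<le> C * r" if "e \<le> \<bar>mE\<bar> + \<bar>vE\<bar> + \<bar>pE\<bar>" for e
      proof -
        have "e * (euler_rate \<alpha> n + 1 / real n) \<le> (\<bar>mE\<bar> + \<bar>vE\<bar> + \<bar>pE\<bar>) * (euler_rate \<alpha> n + 1 / real n)"
          using that rate[OF n(1)] by (intro mult_right_mono)
        also have "\<dots> \<le> (\<bar>mE\<bar> + \<bar>vE\<bar> + \<bar>pE\<bar>) * (kc * r)" using rr by (intro mult_left_mono) auto
        finally show ?thesis by (simp add: C_def mult.assoc)
      qed
      have "\<bar>(\<integral>\<omega>. X t1 \<omega> \<partial>M) - (\<integral>\<omega>. Xe n t1 \<omega> \<partial>M)\<bar> \<le> mE / real n"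
        using B.mean_error[OF n(1) k(1)] B.X_mean[OF B.gp_range[OF n(1) k(1)]]
        by (simp add: t B.emean_def mE_def)
      moreover have "mE / real n \<le> C / real n" using C by (simp add: divide_right_mono)
      moreover have "\<bar>(\<integral>\<omega>. X t1 \<omega> * X t2 \<omega> \<partial>M) - (\<integral>\<omega>. Xe n t1 \<omega> * Xe n t2 \<omega> \<partial>M)\<bar> \<le> pE * (euler_rate \<alpha> n + 1 / real n)"
        unfolding t pE_def by (rule B.product_error[OF n(1) k])
      moreover have "\<bar>covariance M (X t1) (X t2) - covariance M (Xe n t1) (Xe n t2)\<bar> \<le> vE * (euler_rate \<alpha> n + 1 / real n)"
        unfolding t vE_def by (rule B.covariance_error[OF n(1) k])
      moreover have "pE \<le> \<bar>mE\<bar> + \<bar>vE\<bar> + \<bar>pE\<bar>" "vE \<le> \<bar>mE\<bar> + \<bar>vE\<bar> + \<bar>pE\<bar>" by auto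
      ultimately show ?thesis using le by (meson order.trans)
    qed
    then show ?case
      using C(1) unfolding Let_def by (intro exI[of _ C]) blast
  next
    case 2
    show ?case
    proof
      fix \<Psi> assume "\<Psi> \<in> C_exp 2"
      from weak[OF this] obtain C where C: "0 \<le> C" and w: "\<And>(M :: 'a measure) W X Xe n k.
        volterra_setting M W T x0 \<kappa>1 \<kappa>2 \<sigma> \<alpha> X Xe \<Longrightarrow> 1 \<le> n \<Longrightarrow> k \<le> n \<Longrightarrow>
        \<bar>(\<integral>\<omega>. \<Psi> (Xe n (grid_point T n k) \<omega>) \<partial>M) - (\<integral>\<omega>. \<Psi> (X (grid_point T n k) \<omega>) \<partial>M)\<bar> \<le> C * (euler_rate \<alpha> n + 1 / real n)"
        by blast
      have "\<bar>(\<integral>\<omega>. \<Psi> (Xe n (grid_point T n k) \<omega>) \<partial>M) - (\<integral>\<omega>. \<Psi> (X (grid_point T n k) \<omega>) \<partial>M)\<bar> \<le> C * kc *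
          ((1 + grid_point T n k powr (\<alpha> - 1)) * euler_rate \<alpha> n + grid_point T n k powr (2 * \<alpha> - 2) / real n)"
        if S: "volterra_setting M W T x0 \<kappa>1 \<kappa>2 \<sigma> \<alpha> X Xe" and n: "1 \<le> n" "k \<in> {1..n}" for M :: "'a measure" and W X Xe n k
      proof -
        have "euler_rate \<alpha> n + 1 / real n \<le> kc *
           ((1 + grid_point T n k powr (\<alpha> - 1)) * euler_rate \<alpha> n + grid_point T n k powr (2 * \<alpha> - 2) / real n)"
          using F.inverse_euler_rate_le[OF n(1) gp_pos[OF n], of "grid_point T n k powr (\<alpha> - 1)" 0] by (simp add: kc_def)
        from mult_left_mono[OF this C] show ?thesis using w[OF S n(1), of k] n by (simp add: mult.assoc)
      qed
      moreover have "0 \<le> C * kc" using C kc by simp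
      ultimately show "\<exists>C\<ge>0. \<forall>(M :: 'a measure) W X Xe.
        volterra_setting M W T x0 \<kappa>1 \<kappa>2 \<sigma> \<alpha> X Xe \<longrightarrow>
        (\<forall>n\<ge>1. \<forall>k\<in>{1..n}.
           let t = grid_point T n k
           in \<bar>(\<integral>\<omega>. \<Psi> (Xe n t \<omega>) \<partial>M) - (\<integral>\<omega>. \<Psi> (X t \<omega>) \<partial>M)\<bar>
                \<le> C * ((1 + t powr (\<alpha> - 1)) * euler_rate \<alpha> n + t powr (2 * \<alpha> - 2) / real n))"
        unfolding Let_def by blast
    qed
  next
    case 3
    show ?case
    proof (intro ballI allI impI)
      fix \<Psi> and M :: "'a measure" and W X Xe
      assume P: "\<Psi> \<in> C_exp 2" and S: "volterra_setting M W T x0 \<kappa>1 \<kappa>2 \<sigma> \<alpha> X Xe"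
      from weak[OF P] S obtain C where C: "0 \<le> C" and w: "\<And>n k. 1 \<le> n \<Longrightarrow> k \<le> n \<Longrightarrow>
        \<bar>(\<integral>\<omega>. \<Psi> (Xe n (grid_point T n k) \<omega>) \<partial>M) - (\<integral>\<omega>. \<Psi> (X (grid_point T n k) \<omega>) \<partial>M)\<bar> \<le> C * (euler_rate \<alpha> n + 1 / real n)"
        by blast
      show "(\<lambda>n. \<bar>(\<integral>\<omega>. \<Psi> (Xe n T \<omega>) \<partial>M) - (\<integral>\<omega>. \<Psi> (X T \<omega>) \<partial>M)\<bar>) \<in> O(euler_rate \<alpha>)"
      proof (rule bigoI[where c = "2 * C"], use eventually_ge_at_top[of 3] in eventually_elim)
        \<comment> \<open>For \<alpha> = 2/3 the rate vanishes at n = 1, so 1/n is compared with it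
          only from n = 3 on; there it at most doubles the bound, hence
          \<open>2 * C\<close>.\<close>
        fix n :: nat assume n: "3 \<le> n"
        have gT: "grid_point T n n = T" using n by (simp add: grid_point_def)
        have "\<bar>(\<integral>\<omega>. \<Psi> (Xe n T \<omega>) \<partial>M) - (\<integral>\<omega>. \<Psi> (X T \<omega>) \<partial>M)\<bar> \<le> C * (euler_rate \<alpha> n + 1 / real n)"
          using w[of n n] n unfolding gT by simp
        also have "\<dots> \<le> C * (euler_rate \<alpha> n + euler_rate \<alpha> n)"
          using inverse_le_euler_rate[OF assms(3) n] C by (intro mult_left_mono) auto
        finally show "norm \<bar>(\<integral>\<omega>. \<Psi> (Xe n T \<omega>) \<partial>M) - (\<integral>\<omega>. \<Psi> (X T \<omega>) \<partial>M)\<bar> \<le> 2 * C * norm (euler_rate \<alpha> n)"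
          using euler_rate_nonneg[of n \<alpha>] n by simp
      qed
    qed
  qed
qed

end
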